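(* Let $p$ be a prime, and identify $\mathcal{M}_2(\bar{\mathbb{F}}_p)$ with $\mathbb{A}^2(\bar{\mathbb{F}}_p)$ via $[f]\mapsto(\sigma_1,\sigma_2)$. The automorphism locus $\mathcal{A}_2(\bar{\mathbb{F}}_p)$ is described as follows. (1) $p=2$: Every point $x=(0,\sigma_2)$ of the line $\sigma_1=0$ other than $(0,1)$ lies in the automorphism locus, and no point off this line does; thus the line $\sigma_1=0$ is the Zariski closure of the set of points with nontrivial automorphism group. For every point $x$ of the line except $(0,0)$ and $(0,1)$, $\mathrm{Aut}(x)\cong C_2$. For $x=(0,0)$, $\mathrm{Aut}(x)\cong S_3$. For $x=(0,1)$, $\mathrm{Aut}(x)$ is trivial as a subgroup of $\mathrm{PGL}_2$, while the automorphism group scheme of $x$ is isomorphic to $\alpha_2=\mathrm{Spec}\,\bar{\mathbb{F}}_2[t]/(t^2)$. (2) $p=3$: $\mathcal{A}_2(\bar{\mathbb{F}}_3)$ is the cuspidal cubic curve $$2\sigma_1^3+\sigma_1^2\sigma_2-\sigma_1^2-\sigma_2^2-2\sigma_1\sigma_2=0,$$ and every point $x$ of it has $\mathrm{Aut}(x)\cong C_2$. (3) $p>3$: $\mathcal{A}_2(\bar{\mathbb{F}}_p)$ is the cuspidal cubic curve $$2\sigma_1^3+\sigma_1^2\sigma_2-\sigma_1^2-4\sigma_2^2-8\sigma_1\sigma_2+12\sigma_1+12\sigma_2-36=0.$$ Every point $x$ of it except the cusp has $\mathrm{Aut}(x)\cong C_2$, and when $x$ is the cusp, $\mathrm{Aut}(x)\cong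 S_3$.
   Context: Let $K=\bar{\mathbb{F}}_p$. $\mathrm{Rat}_2$ is the set of degree-$2$ endomorphisms of $\mathbb{P}^1$ over $K$; $\mathrm{PGL}_2(K)$ acts by $f^\alpha=\alpha^{-1}\circ f\circ\alpha$; $\mathcal{M}_2=\mathrm{Rat}_2/\mathrm{PGL}_2$ is the moduli space, and $[f]$ denotes the class of $f$. $\mathrm{Aut}(f)=\{\alpha\in\mathrm{PGL}_2(K):f^\alpha=f\}$; its conjugacy class depends only on $[f]$, and for $x=[f]$ we write $\mathrm{Aut}(x)\cong G$ if $\mathrm{Aut}(f)\cong G$. The automorphism locus $\mathcal{A}_2\subset\mathcal{M}_2$ is the set of classes $[f]$ with $\mathrm{Aut}(f)$ nontrivial. The map $[f]\mapsto(\sigma_1,\sigma_2)$, where $\sigma_1,\sigma_2$ are the first two elementary symmetric polynomials evaluated at the multipliers of the three fixed points of $f$ (counted with multiplicity), is an isomorphism $\mathcal{M}_2\to\mathbb{A}^2$ (known result, valid in every characteristic). The automorphism group scheme of $f$ is the closed subgroup scheme of $\mathrm{PGL}_{2}$ over $K$ defined by the equation $f\circ\phi=\phi\circ f$, $\phi\in\mathrm{PGL}_2$. The group scheme $\alpha_2$ is the closed subgroup scheme $\mathrm{Spec}\,\bar{\mathbb{F}}_2[t]/(t^2)$ of the additive group $\mathbb{G}_a$. A cuspidal cubic is an irreducible plane cubic whose unique singular point has a single tangent line of multiplicity two. *)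

theory Defs
  imports
    "HOL-Algebra.Algebraic_Closure_Type"
    "HOL-Algebra.Sym_Groups"
    "HOL-Algebra.Elementary_Groups"
    "HOL-Library.Numeral_Type"
    "Berlekamp_Zassenhaus.Finite_Field"
begin

text \<open>An algebraic closure of the prime field with \<open>CARD('p)\<close> elements.\<close>

type_synonym 'p Fp_bar = "'p mod_ring alg_closure"

instance alg_closure :: (field) field_gcd ..


section \<open>Rational maps of the projective line\<close>

text \<open>
  A nonconstant endomorphism of the projective line over \<open>K\<close> is a rational function, that is,
  an element of \<open>K(z)\<close>; its degree is the maximum of the degrees of numerator and denominator
  in lowest terms.
\<close>

abbreviation rat_num :: "'k::field_gcd poly fract \<Rightarrow> 'k poly" where
  "rat_num r \<equiv> fst (quot_of_fract r)"

abbreviation rat_den :: "'k::field_gcd poly fract \<Rightarrow> 'k poly" where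
  "rat_den r \<equiv> snd (quot_of_fract r)"

definition rat_degree :: "'k::field_gcd poly fract \<Rightarrow> nat" where
  "rat_degree r = max (Polynomial.degree (rat_num r)) (Polynomial.degree (rat_den r))"

definition rat_comp :: "'k::field_gcd poly fract \<Rightarrow> 'k poly fract \<Rightarrow> 'k poly fract" where
  "rat_comp r s =
     poly (map_poly (\<lambda>c. Fraction_Field.Fract [:c:] 1) (rat_num r)) s /
     poly (map_poly (\<lambda>c. Fraction_Field.Fract [:c:] 1) (rat_den r)) s"

definition Rat2 :: "'k::field_gcd poly fract set" where
  "Rat2 = {f. rat_degree f = 2}"

text \<open>A matrix modulo scalars is identified with its linear fractional transformation.\<close>

definition PGL2 :: "'k::field_gcd poly fract monoid" where
  "PGL2 = \<lparr>carrier = {Fraction_Field.Fract [:b, a:] [:d, c:] | a b c d. a * d - b * c \<noteq> 0},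
           monoid.mult = rat_comp, one = Fraction_Field.Fract [:0, 1:] 1\<rparr>"

definition rat_conj :: "'k::field_gcd poly fract \<Rightarrow> 'k poly fract \<Rightarrow> 'k poly fract" where
  "rat_conj f \<alpha> = rat_comp (inv\<^bsub>PGL2\<^esub> \<alpha>) (rat_comp f \<alpha>)"

definition Aut :: "'k::field_gcd poly fract \<Rightarrow> 'k poly fract monoid" where
  "Aut f = PGL2\<lparr>carrier := {\<alpha> \<in> carrier PGL2. rat_conj f \<alpha> = f}\<rparr>"


section \<open>The moduli space and its coordinates\<close>

definition M2 :: "'k::field_gcd poly fract set set" where
  "M2 = Rat2 // {(f, g). f \<in> Rat2 \<and> g \<in> Rat2 \<and> (\<exists>\<alpha> \<in> carrier PGL2. g = rat_conj f \<alpha>)}"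

definition A2 :: "'k::field_gcd poly fract set set" where
  "A2 = {c \<in> M2. \<exists>f \<in> c. carrier (Aut f) \<noteq> {\<one>\<^bsub>Aut f\<^esub>}}"

text \<open>
  The finite fixed points of \<open>f = F/G\<close> are the roots of \<open>z * G - F\<close>, with the same multiplicities;
  the multiplier at a fixed point is the derivative there. The point at infinity is moved to \<open>0\<close> by
  conjugating with \<open>1/z\<close>; it contributes nothing if it is not fixed, the order of vanishing being 0.
\<close>

definition fixed_poly :: "'k::field_gcd poly fract \<Rightarrow> 'k poly" where
  "fixed_poly f = [:0, 1:] * rat_den f - rat_num f"

definition rat_deriv_at :: "'k::field_gcd poly fract \<Rightarrow> 'k \<Rightarrow> 'k" where
  "rat_deriv_at f z =
     poly (pderiv (rat_num f) * rat_den f - rat_num f * pderiv (rat_den f)) z / poly (rat_den f) z ^ 2"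

definition fixed_multipliers :: "'k::field_gcd poly fract \<Rightarrow> 'k multiset" where
  "fixed_multipliers f =
     (let f' = rat_conj f (Fraction_Field.Fract 1 [:0, 1:]) in
        image_mset (rat_deriv_at f) (proots (fixed_poly f)) +
        replicate_mset (Polynomial.order 0 (fixed_poly f')) (rat_deriv_at f' 0))"

definition fixed_sigma :: "'k::field_gcd poly fract \<Rightarrow> 'k \<times> 'k" where
  "fixed_sigma f =
     (THE s. \<exists>l1 l2 l3. fixed_multipliers f = {#l1, l2, l3#} \<and>
        s = (l1 + l2 + l3, l1 * l2 + l1 * l3 + l2 * l3))"

text \<open>The value of \<open>fixed_sigma\<close> is constant on each class.\<close>

definition moduli_coords :: "'k::field_gcd poly fract set \<Rightarrow> 'k \<times> 'k" where
  "moduli_coords c = the_elem (fixed_sigma ` c)"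

definition aut_locus :: "('k::field_gcd \<times> 'k) set" where
  "aut_locus = moduli_coords ` A2"

text \<open>
  The property \<open>Q\<close> (meant to be conjugation invariant) holds for the maps \<open>f\<close> with \<open>[f]\<close> equal to \<open>x\<close>,
  under the identification of \<open>M2\<close> with the affine plane by \<open>moduli_coords\<close>. Both the existence of
  such maps and the assertion for all of them are included, so that nothing depends on knowing
  that \<open>moduli_coords\<close> is bijective.
\<close>

definition holds_at :: "'k::field_gcd \<times> 'k \<Rightarrow> ('k poly fract \<Rightarrow> bool) \<Rightarrow> bool" where
  "holds_at x Q \<longleftrightarrow>
     (\<exists>c \<in> M2. moduli_coords c = x) \<and>
     (\<forall>c \<in> M2. moduli_coords c = x \<longrightarrow> (\<forall>f \<in> c. Q f))"


section \<open>Affine plane curves\<close>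

text \<open>The ring \<open>K[x, y]\<close> is represented as \<open>K[x][y]\<close>.\<close>

definition var_x :: "'k::comm_ring_1 poly poly" where
  "var_x = [:[:0, 1:]:]"

definition var_y :: "'k::comm_ring_1 poly poly" where
  "var_y = [:0, 1:]"

definition eval2 :: "'k::comm_ring_1 poly poly \<Rightarrow> 'k \<times> 'k \<Rightarrow> 'k" where
  "eval2 P v = poly (poly P [:snd v:]) (fst v)"

definition plane_curve :: "'k::comm_ring_1 poly poly \<Rightarrow> ('k \<times> 'k) set" where
  "plane_curve P = {v. eval2 P v = 0}"

definition zariski_closure :: "('k::comm_ring_1 \<times> 'k) set \<Rightarrow> ('k \<times> 'k) set" where
  "zariski_closure S = {v. \<forall>P. (\<forall>w \<in> S. eval2 P w = 0) \<longrightarrow> eval2 P v = 0}"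

definition singular_points :: "'k::idom poly poly \<Rightarrow> ('k \<times> 'k) set" where
  "singular_points P =
     {v. eval2 P v = 0 \<and> eval2 (map_poly pderiv P) v = 0 \<and> eval2 (pderiv P) v = 0}"

text \<open>\<open>translate2 (a, b) P\<close> is \<open>P (x + a, y + b)\<close>.\<close>

definition translate2 :: "'k::comm_ring_1 \<times> 'k \<Rightarrow> 'k poly poly \<Rightarrow> 'k poly poly" where
  "translate2 v P = pcompose (map_poly (\<lambda>q. pcompose q [:fst v, 1:]) P) [:[:snd v:], 1:]"

definition coeff2 :: "'k::zero poly poly \<Rightarrow> nat \<Rightarrow> nat \<Rightarrow> 'k" where
  "coeff2 P i j = Polynomial.coeff (Polynomial.coeff P j) i"

definition total_degree2 :: "'k::zero poly poly \<Rightarrow> nat" where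
  "total_degree2 P = Max {i + j | i j. coeff2 P i j \<noteq> 0}"

text \<open>
  At a singular point the tangent lines are given by the quadratic part of the translated equation;
  there is a single one, of multiplicity two, when this part is \<open>k * (u * x + v * y)^2\<close>, not zero.
  Curves are affine; over an algebraically closed field the projective closure of a cuspidal cubic
  as defined here has no further singular point, an irreducible cubic having at most one.
\<close>

definition double_tangent_at :: "'k::idom poly poly \<Rightarrow> 'k \<times> 'k \<Rightarrow> bool" where
  "double_tangent_at P w \<longleftrightarrow>
     (\<exists>k u v. k \<noteq> 0 \<and> (u, v) \<noteq> (0, 0) \<and>
        coeff2 (translate2 w P) 2 0 = k * u ^ 2 \<and>
        coeff2 (translate2 w P) 1 1 = k * (2 * u * v) \<and>
        coeff2 (translate2 w P) 0 2 = k * v ^ 2)"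

definition cuspidal_cubic :: "'k::idom poly poly \<Rightarrow> bool" where
  "cuspidal_cubic P \<longleftrightarrow>
     total_degree2 P = 3 \<and> Factorial_Ring.irreducible P \<and>
     (\<exists>w. singular_points P = {w} \<and> double_tangent_at P w)"


section \<open>Group schemes\<close>

text \<open>
  An affine group scheme over \<open>K\<close> is represented by its functor of points, from commutative
  \<open>K\<close>-algebras to groups. A commutative \<open>K\<close>-algebra is a commutative ring with carrier in \<open>'u\<close> and
  a structure map from \<open>K\<close>. By the Yoneda lemma, isomorphism of functors is isomorphism of
  group schemes as soon as \<open>'u\<close> has room for the coordinate rings; theorems are to be stated for
  an arbitrary type \<open>'u\<close>.
\<close>

definition K_algebra :: "'u ring \<Rightarrow> ('k::field \<Rightarrow> 'u) \<Rightarrow> bool" where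
  "K_algebra R h \<longleftrightarrow> cring R \<and> h \<in> Ring.ring_hom ring_of_type_algebra R"

definition K_algebra_hom ::
  "'u ring \<Rightarrow> ('k::field \<Rightarrow> 'u) \<Rightarrow> 'u ring \<Rightarrow> ('k \<Rightarrow> 'u) \<Rightarrow> ('u \<Rightarrow> 'u) \<Rightarrow> bool" where
  "K_algebra_hom R h R' h' g \<longleftrightarrow> g \<in> Ring.ring_hom R R' \<and> (\<forall>c. g (h c) = h' c)"

record ('k, 'u, 'g) group_functor =
  points :: "'u ring \<Rightarrow> ('k \<Rightarrow> 'u) \<Rightarrow> 'g monoid"
  points_map :: "('u \<Rightarrow> 'u) \<Rightarrow> 'g \<Rightarrow> 'g"

definition group_scheme_iso ::
  "('k::field, 'u, 'g) group_functor \<Rightarrow> ('k, 'u, 'h) group_functor \<Rightarrow> bool" where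
  "group_scheme_iso F G \<longleftrightarrow>
     (\<exists>\<eta>. (\<forall>R h. K_algebra R h \<longrightarrow> \<eta> R h \<in> iso (points F R h) (points G R h)) \<and>
          (\<forall>R h R' h' g. K_algebra R h \<longrightarrow> K_algebra R' h' \<longrightarrow> K_algebra_hom R h R' h' g \<longrightarrow>
             (\<forall>x \<in> carrier (points F R h).
                \<eta> R' h' (points_map F g x) = points_map G g (\<eta> R h x))))"

definition alpha2_scheme :: "('k::field, 'u, 'u) group_functor" where
  "alpha2_scheme =
     \<lparr>points = (\<lambda>R h. \<lparr>carrier = {r \<in> carrier R. r \<otimes>\<^bsub>R\<^esub> r = \<zero>\<^bsub>R\<^esub>},
                       monoid.mult = add R, one = \<zero>\<^bsub>R\<^esub>\<rparr>),
      points_map = (\<lambda>g. g)\<rparr>"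

text \<open>
  The coordinate ring of \<open>PGL2\<close> is the degree-zero part of \<open>K[a, b, c, d, 1/det]\<close>, where \<open>a, b, c, d\<close>
  are the entries of a \<open>2 \<times> 2\<close> matrix. It is generated by the products \<open>m * m' / det\<close> of
  two entries, subject to the relations (of the second Veronese embedding of projective 3-space)
  saying that these come from products, and to \<open>(a * d - b * c) / det = 1\<close>. So an \<open>R\<close>-point is
  a table \<open>e\<close> of values in \<open>R\<close>, where \<open>e s t\<close> stands for (entry \<open>s\<close>) * (entry \<open>t\<close>) / det. Over a general
  ring such a point need not come from an invertible matrix. Positions are pairs (row, column) over
  the two-element type.
\<close>

type_synonym 'u pgl2_point = "2 \<times> 2 \<Rightarrow> 2 \<times> 2 \<Rightarrow> 'u"

definition PGL2_points :: "'u ring \<Rightarrow> 'u pgl2_point monoid" where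
  "PGL2_points R =
     \<lparr>carrier = {e. (\<forall>s t. e s t \<in> carrier R) \<and>
                    (\<forall>s t. e s t = e t s) \<and>
                    (\<forall>s t s' t'. e s t \<otimes>\<^bsub>R\<^esub> e s' t' = e s s' \<otimes>\<^bsub>R\<^esub> e t t') \<and>
                    e (0, 0) (1, 1) \<ominus>\<^bsub>R\<^esub> e (0, 1) (1, 0) = \<one>\<^bsub>R\<^esub>},
      monoid.mult = (\<lambda>e e' (i, j) (k, l).
        \<Oplus>\<^bsub>R\<^esub>m\<in>UNIV. \<Oplus>\<^bsub>R\<^esub>n\<in>UNIV. e (i, m) (k, n) \<otimes>\<^bsub>R\<^esub> e' (m, j) (n, l)),
      one = (\<lambda>(i, j) (k, l). if i = j \<and> k = l then \<one>\<^bsub>R\<^esub> else \<zero>\<^bsub>R\<^esub>)\<rparr>"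

text \<open>
  Let \<open>f = F/G\<close> have degree 2, and let \<open>\<phi>\<close> have rows \<open>L0 = a X + b Y\<close> and \<open>L1 = c X + d Y\<close>.
  In homogeneous coordinates the two compositions are
    \<open>f \<circ> \<phi> = [F(L0, L1) : G(L0, L1)]\<close> and \<open>\<phi> \<circ> f = [a F + b G : c F + d G]\<close>,
  so \<open>f \<circ> \<phi> = \<phi> \<circ> f\<close> is the vanishing of \<open>F(L0, L1) * (c F + d G) - G(L0, L1) * (a F + b G)\<close>,
  whose coefficients are cubic in the entries of \<open>\<phi>\<close>. Multiplying by each of the entries and dividing
  by \<open>det^2\<close> gives generators of the corresponding ideal of the coordinate ring of \<open>PGL2\<close>.
  Forms in \<open>X, Y\<close> are given by the coefficients of the powers of \<open>X\<close>.
\<close>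

text \<open>The form \<open>L\<^sub>i * L\<^sub>j / det\<close>.\<close>

definition row_product :: "'u ring \<Rightarrow> 'u pgl2_point \<Rightarrow> 2 \<Rightarrow> 2 \<Rightarrow> nat \<Rightarrow> 'u" where
  "row_product R e i j n =
     (if n = 2 then e (i, 0) (j, 0)
      else if n = 1 then e (i, 0) (j, 1) \<oplus>\<^bsub>R\<^esub> e (i, 1) (j, 0)
      else if n = 0 then e (i, 1) (j, 1)
      else \<zero>\<^bsub>R\<^esub>)"

text \<open>The form \<open>F(L0, L1) / det\<close>.\<close>

definition subst_form ::
  "'u ring \<Rightarrow> ('k::field \<Rightarrow> 'u) \<Rightarrow> 'k poly \<Rightarrow> 'u pgl2_point \<Rightarrow> nat \<Rightarrow> 'u" where
  "subst_form R h F e n =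
     h (Polynomial.coeff F 2) \<otimes>\<^bsub>R\<^esub> row_product R e 0 0 n \<oplus>\<^bsub>R\<^esub>
     h (Polynomial.coeff F 1) \<otimes>\<^bsub>R\<^esub> row_product R e 0 1 n \<oplus>\<^bsub>R\<^esub>
     h (Polynomial.coeff F 0) \<otimes>\<^bsub>R\<^esub> row_product R e 1 1 n"

text \<open>
  The form (entry \<open>s\<close>) * (\<open>\<phi>\<^sub>i\<^sub>0 F + \<phi>\<^sub>i\<^sub>1 G\<close>) / det.
\<close>

definition row_applied ::
  "'u ring \<Rightarrow> ('k::field \<Rightarrow> 'u) \<Rightarrow> 'k poly \<Rightarrow> 'k poly \<Rightarrow> 'u pgl2_point \<Rightarrow> 2 \<times> 2 \<Rightarrow> 2 \<Rightarrow> nat \<Rightarrow> 'u" where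
  "row_applied R h F G e s i n =
     e s (i, 0) \<otimes>\<^bsub>R\<^esub> h (Polynomial.coeff F n) \<oplus>\<^bsub>R\<^esub>
     e s (i, 1) \<otimes>\<^bsub>R\<^esub> h (Polynomial.coeff G n)"

definition form_mult :: "'u ring \<Rightarrow> (nat \<Rightarrow> 'u) \<Rightarrow> (nat \<Rightarrow> 'u) \<Rightarrow> nat \<Rightarrow> 'u" where
  "form_mult R A B k = (\<Oplus>\<^bsub>R\<^esub>n\<in>{..k}. A n \<otimes>\<^bsub>R\<^esub> B (k - n))"

definition commutes_with ::
  "'u ring \<Rightarrow> ('k::field_gcd \<Rightarrow> 'u) \<Rightarrow> 'k poly fract \<Rightarrow> 'u pgl2_point \<Rightarrow> bool" where
  "commutes_with R h f e \<longleftrightarrow>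
     (let F = rat_num f; G = rat_den f in
      \<forall>s. form_mult R (subst_form R h F e) (row_applied R h F G e s 1) =
          form_mult R (subst_form R h G e) (row_applied R h F G e s 0))"

definition Aut_scheme :: "'k::field_gcd poly fract \<Rightarrow> ('k, 'u, 'u pgl2_point) group_functor" where
  "Aut_scheme f =
     \<lparr>points = (\<lambda>R h. (PGL2_points R)
        \<lparr>carrier := {e \<in> carrier (PGL2_points R). commutes_with R h f e}\<rparr>),
      points_map = (\<lambda>g e s t. g (e s t))\<rparr>"

end

theory Submission
  imports Defs
begin

text \<open>
  Everything is read off from the three fixed points of a map and their multipliers. An
  automorphism of \<open>f\<close> permutes the fixed points and preserves multipliers, and multipliers do not
  change under conjugation. If \<open>f\<close> has two distinct fixed points, they can be moved to \<open>0\<close> and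
  \<open>\<infinity>\<close>, and after scaling \<open>f\<close> becomes \<open>Qmap l m = z (z + l) / (m z + 1)\<close>, where \<open>l\<close> and \<open>m\<close> are the
  multipliers and \<open>l m \<noteq> 1\<close> (\<open>conjugate_Qmap\<close>). If all fixed points coincide, \<open>f\<close> is conjugate to
  \<open>Tmap = z + 1/z\<close> (\<open>conjugate_Tmap\<close>). In both cases the multipliers satisfy
  \<open>l m n = l + m + n - 2\<close>, that is \<open>\<sigma>\<^sub>3 = \<sigma>\<^sub>1 - 2\<close>, so \<open>(\<sigma>\<^sub>1, \<sigma>\<^sub>2)\<close> determines the multipliers; conversely
  every pair occurs (\<open>fixed_sigma_surj\<close>). In each situation below, it is shown directly that the maps
  with given coordinates are conjugate to a normal form with known automorphisms.

  A map \<open>Qmap l m\<close> has a nontrivial automorphism only if two of its multipliers agree and none is 1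
  (\<open>Aut_Qmap_nontrivial\<close>). Conversely, two equal multipliers different from 1 belong to
  distinct fixed points, so the map can be brought to the form \<open>Qmap l l\<close>, which commutes with \<open>1/z\<close>.
  Its third fixed point is \<open>1\<close>, and the automorphism group is of order 2 unless all three multipliers
  agree; then \<open>l = -2\<close> and all six permutations of \<open>0, 1, \<infinity>\<close> occur (\<open>Aut_Qmap_cases\<close>). The map
  \<open>Tmap\<close> commutes with \<open>z\<close> and \<open>-z\<close> only, and these agree in characteristic 2.

  If the characteristic is not 2, the locus is therefore given by the discriminant of the
  polynomial with the multipliers as roots. It is \<open>(1 - l) (1 - m) (1 - n)\<close> times the cubic of the
  theorem (\<open>discriminant_of_multipliers\<close>). The cubic meets the line \<open>\<sigma>\<^sub>2 = 2 \<sigma>\<^sub>1 - 3\<close> of maps with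
  multiplier 1 only in \<open>(3, 3)\<close>, where \<open>Tmap\<close> is the only map up to conjugation. The cusp
  \<open>(-6, 12)\<close> is the point with multipliers \<open>-2, -2, -2\<close>; in characteristic 3 these are 1, the point is
  \<open>(0, 0) = (3, 3)\<close>, and the group is that of \<open>Tmap\<close>, of order 2. As a quadratic polynomial in \<open>\<sigma>\<^sub>2\<close> the
  cubic has the discriminant \<open>(\<sigma>\<^sub>1 + 6)\<^sup>3 (\<sigma>\<^sub>1 - 2)\<close>, which gives irreducibility and the singular point
  (\<open>cuspidal_cubic\<close>).

  In characteristic 2 two equal multipliers \<open>l, l\<close> force the third to be 0, so
  \<open>\<sigma>\<^sub>1 = 0\<close> and \<open>\<sigma>\<^sub>2 = l\<^sup>2\<close>; the case
  \<open>l = 1\<close> is excluded, and \<open>l = 0\<close> is the case of three equal multipliers.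
  The remaining point \<open>(0, 1)\<close> of the line is the class of \<open>z\<^sup>2 +
  z\<close>. An automorphism of it over an algebra has to be a translation \<open>z \<mapsto> z +
  t\<close>, and \<open>(z + t)\<^sup>2 + (z + t) = z\<^sup>2 + z + t\<close> means \<open>t\<^sup>2
  = 0\<close>, the equation of \<open>\<alpha>\<^sub>2\<close> (\<open>aut_scheme_alpha2\<close>). A
  point of the group scheme \<open>PGL\<^sub>2\<close> is given by products of two matrix entries
  divided by the determinant and need not come from a matrix. That a matrix over \<open>K\<close>
  transports the automorphism scheme of a map to that of the conjugate map is shown by testing the
  commutation relation at the points of the projective line over \<open>K\<close>: a substitution
  just replaces such a point by another one (\<open>conj_table_aut_points\<close>).
\<close>

section \<open>Composition of rational functions\<close>

text \<open>Rational functions are treated as elements of the field extension \<open>K(z)\<close> of \<open>K\<close>: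
  composition with \<open>s\<close> is evaluation at \<open>s\<close> of numerator and denominator, a homomorphism as long as
  \<open>s\<close> is transcendental over \<open>K\<close>.\<close>

definition cst :: "'k::field_gcd \<Rightarrow> 'k poly fract" where
  "cst c = Fraction_Field.Fract [:c:] 1"

definition idz :: "'k::field_gcd poly fract" where
  "idz = Fraction_Field.Fract [:0, 1:] 1"

definition peval :: "'k::field_gcd poly \<Rightarrow> 'k poly fract \<Rightarrow> 'k poly fract" where
  "peval F s = poly (map_poly cst F) s"

definition nonconstant :: "'k::field_gcd poly fract \<Rightarrow> bool" where
  "nonconstant s \<longleftrightarrow> (\<forall>c. s \<noteq> cst c)"

lemma Fract_eq_iff:
  "b \<noteq> 0 \<Longrightarrow> d \<noteq> 0 \<Longrightarrow> Fraction_Field.Fract a b = Fraction_Field.Fract c d \<longleftrightarrow> a * d = c * b"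
  by (fact Fraction_Field.eq_fract(1))

lemma cst_hom [simp]:
  "cst 0 = 0" "cst 1 = 1" "cst (a + b) = cst a + cst b" "cst (a * b) = cst a * cst b"
  "cst (- a) = - cst a" "cst (a - b) = cst a - cst b"
  by (simp_all add: cst_def Zero_fract_def One_fract_def one_pCons mult.commute)

lemma cst_eq_iff [simp]: "cst a = cst b \<longleftrightarrow> a = b"
  by (simp add: cst_def Fract_eq_iff)

lemma cst_eq_0_iff [simp]: "cst a = 0 \<longleftrightarrow> a = 0"
  using cst_eq_iff[of a 0] by (simp del: cst_eq_iff)

lemma cst_numeral [simp]: "cst (numeral n) = numeral n"
proof -
  have "cst (of_nat k) = of_nat k" for k by (induction k) simp_all
  from this[of "numeral n"] show ?thesis by simp
qed

lemma peval_simps [simp]: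
  "peval 0 s = 0" "peval 1 s = 1" "peval (pCons a F) s = cst a + s * peval F s"
  subgoal by (simp add: peval_def)
  subgoal by (simp add: peval_def)
  by (cases "a = 0 \<and> F = 0") (auto simp: peval_def map_poly_pCons)

lemma peval_add [simp]: "peval (F + G) s = peval F s + peval G s"
  unfolding peval_def by (subst map_poly_add) (simp_all add: poly_add)

lemma peval_smult [simp]: "peval (Polynomial.smult c F) s = cst c * peval F s"
  unfolding peval_def by (subst map_poly_smult) (simp_all)

lemma peval_mult [simp]: "peval (F * G) s = peval F s * peval G s"
  by (induction F) (simp_all add: algebra_simps)

lemma peval_minus [simp]: "peval (- F) s = - peval F s"
  using peval_smult[of "-1" F s] by simp

lemma peval_diff [simp]: "peval (F - G) s = peval F s - peval G s"
  using peval_add[of F "- G" s] by simp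

lemma fract_eq_divide: "Fraction_Field.Fract F G = Fraction_Field.Fract F 1 / Fraction_Field.Fract G 1"
  by simp

lemma Fract_peval_idz: "Fraction_Field.Fract F 1 = peval F idz"
proof (induction F)
  case 0 then show ?case by (simp add: Zero_fract_def)
next
  case (pCons a F)
  have "Fraction_Field.Fract (pCons a F) 1 = cst a + idz * Fraction_Field.Fract F 1"
    by (simp add: cst_def idz_def)
  then show ?case using pCons by simp
qed

lemma Fract_eq_peval: "Fraction_Field.Fract F G = peval F idz / peval G idz"
  by (subst fract_eq_divide) (simp add: Fract_peval_idz del: divide_fract)

lemma peval_idz_eq_iff [simp]: "peval F idz = peval G idz \<longleftrightarrow> F = G"
  by (simp flip: Fract_peval_idz add: Fract_eq_iff)

lemma peval_idz_eq_0_iff [simp]: "peval F idz = 0 \<longleftrightarrow> F = 0"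
  using peval_idz_eq_iff[of F 0] by (simp del: peval_idz_eq_iff)

text \<open>Over an algebraically closed field a polynomial is a product of linear factors, hence
  a nonconstant rational function is transcendental over \<open>K\<close>.\<close>

lemma peval_eq_0_iff:
  fixes s :: "'k::{alg_closed_field, field_gcd} poly fract"
  assumes "nonconstant s"
  shows "peval F s = 0 \<longleftrightarrow> F = 0"
proof (induction "Polynomial.degree F" arbitrary: F)
  case 0
  then obtain c where "F = [:c:]" by (metis degree_eq_zeroE)
  then show ?case by simp
next
  case (Suc n)
  then have "Polynomial.degree F > 0" by simp
  then obtain r where "poly F r = 0" using alg_closed_imp_poly_has_root by blast
  then obtain G where F: "F = [:-r, 1:] * G" by (auto simp: poly_eq_0_iff_dvd elim: dvdE)
  have "G \<noteq> 0" using F Suc.hyps(2) by auto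
  then have "n = Polynomial.degree G" using Suc.hyps(2) F by (subst (asm) F, subst (asm) degree_mult_eq) auto
  then have IH: "peval G s = 0 \<longleftrightarrow> G = 0" using Suc.hyps(1) by blast
  have "- cst r + s \<noteq> 0" using assms unfolding nonconstant_def
    by (metis add.commute add.right_neutral diff_eq_eq uminus_add_conv_diff)
  then show ?case using IH \<open>G \<noteq> 0\<close> unfolding F peval_mult mult_eq_0_iff by (simp del: mult_pCons_left)
qed

lemma rat_comp_Fract:
  fixes s :: "'k::{alg_closed_field, field_gcd} poly fract"
  assumes "nonconstant s" "G \<noteq> 0"
  shows "rat_comp (Fraction_Field.Fract F G) s = peval F s / peval G s"
proof -
  let ?q = "quot_of_fract (Fraction_Field.Fract F G)"
  have q: "Fraction_Field.Fract (fst ?q) (snd ?q) = Fraction_Field.Fract F G"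
    by (metis quot_to_fract_def quot_to_fract_quot_of_fract prod.collapse case_prod_conv)
  have nz: "snd ?q \<noteq> 0" by simp
  from q have "fst ?q * G = F * snd ?q" using Fract_eq_iff[OF nz assms(2)] by blast
  then have "peval (fst ?q) s * peval G s = peval F s * peval (snd ?q) s"
    by (metis peval_mult)
  moreover have "rat_comp (Fraction_Field.Fract F G) s = peval (fst ?q) s / peval (snd ?q) s"
    unfolding rat_comp_def peval_def by (simp add: cst_def[abs_def])
  ultimately show ?thesis using assms nz by (simp add: peval_eq_0_iff frac_eq_eq)
qed

context
  fixes s :: "'k::{alg_closed_field, field_gcd} poly fract"
  assumes s: "nonconstant s"
begin

lemma rat_comp_cst [simp]: "rat_comp (cst c) s = cst c"
  using rat_comp_Fract[OF s, of 1 "[:c:]"] by (simp flip: cst_def)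

lemma rat_comp_0 [simp]: "rat_comp 0 s = 0" and rat_comp_1 [simp]: "rat_comp 1 s = 1"
  using rat_comp_cst[of 0] rat_comp_cst[of 1] by simp_all

lemma rat_comp_idz [simp]: "rat_comp idz s = s"
  by (simp add: idz_def rat_comp_Fract[OF s])

lemma rat_comp_mult [simp]: "rat_comp (r * r') s = rat_comp r s * rat_comp r' s"
  by (cases r; cases r') (simp add: rat_comp_Fract[OF s])

lemma rat_comp_add [simp]: "rat_comp (r + r') s = rat_comp r s + rat_comp r' s"
  by (cases r; cases r') (simp add: rat_comp_Fract[OF s] peval_eq_0_iff[OF s] field_simps)

lemma rat_comp_inverse [simp]: "rat_comp (inverse r) s = inverse (rat_comp r s)"
proof (cases "r = 0")
  case False
  obtain F G where "r = Fraction_Field.Fract F G" "G \<noteq> 0" by (cases r)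
  with False have "F \<noteq> 0" by (auto simp: Zero_fract_def Fract_eq_iff)
  then show ?thesis using \<open>r = _\<close> \<open>G \<noteq> 0\<close> by (simp add: rat_comp_Fract[OF s])
qed simp

lemma rat_comp_divide [simp]: "rat_comp (r / r') s = rat_comp r s / rat_comp r' s"
  by (simp add: field_class.field_divide_inverse)

lemma rat_comp_uminus [simp]: "rat_comp (- r) s = - rat_comp r s"
  using rat_comp_mult[of "cst (-1)" r] by (simp del: rat_comp_mult add: rat_comp_cst[of "-1", simplified])

lemma rat_comp_diff [simp]: "rat_comp (r - r') s = rat_comp r s - rat_comp r' s"
  using rat_comp_add[of r "- r'"] by (simp del: rat_comp_add)

lemma rat_comp_eq_0_iff [simp]: "rat_comp r s = 0 \<longleftrightarrow> r = 0"
proof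
  assume "rat_comp r s = 0"
  show "r = 0"
  proof (rule ccontr)
    assume "r \<noteq> 0"
    then have "rat_comp (r * inverse r) s = 1" by simp
    with \<open>rat_comp r s = 0\<close> show False by (simp del: right_inverse)
  qed
qed simp

lemma rat_comp_eq_iff [simp]: "rat_comp r s = rat_comp r' s \<longleftrightarrow> r = r'"
  using rat_comp_eq_0_iff[of "r - r'"] by (simp del: rat_comp_eq_0_iff)

lemma nonconstant_rat_comp:
  assumes "nonconstant r"
  shows "nonconstant (rat_comp r s)"
  unfolding nonconstant_def
proof (intro allI notI)
  fix c assume "rat_comp r s = cst c"
  then have "rat_comp r s = rat_comp (cst c) s" by simp
  then show False using assms unfolding nonconstant_def rat_comp_eq_iff by blast
qed

lemma rat_comp_peval: "rat_comp (peval F r) s = peval F (rat_comp r s)"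
  by (induction F) simp_all

end

lemma rat_comp_assoc:
  fixes s t :: "'k::{alg_closed_field, field_gcd} poly fract"
  assumes s: "nonconstant s" and t: "nonconstant t"
  shows "rat_comp (rat_comp r s) t = rat_comp r (rat_comp s t)"
proof -
  obtain F G where r: "r = Fraction_Field.Fract F G" "G \<noteq> 0" by (cases r)
  show ?thesis unfolding r using r(2)
    by (simp add: rat_comp_Fract s t nonconstant_rat_comp rat_comp_peval)
qed

lemma nonconstant_idz [simp]: "nonconstant idz"
  unfolding nonconstant_def idz_def cst_def by (simp add: Fract_eq_iff)

lemma rat_comp_idz_right [simp]: "rat_comp r idz = (r :: 'k::{alg_closed_field, field_gcd} poly fract)"
  by (cases r) (simp add: rat_comp_Fract flip: Fract_eq_peval)

section \<open>Linear fractional transformations\<close>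

definition mob :: "'k::field_gcd \<Rightarrow> 'k \<Rightarrow> 'k \<Rightarrow> 'k \<Rightarrow> 'k poly fract" where
  "mob a b c d = Fraction_Field.Fract [:b, a:] [:d, c:]"

lemma mob_eq: "mob a b c d = (cst a * idz + cst b) / (cst c * idz + cst d)"
  by (simp add: mob_def Fract_eq_peval algebra_simps)

lemma mob_eq_mob_iff:
  assumes "a * d - b * c \<noteq> 0" "a' * d' - b' * c' \<noteq> 0"
  shows "mob a b c d = mob a' b' c' d' \<longleftrightarrow> (\<exists>k. k \<noteq> 0 \<and> a' = k * a \<and> b' = k * b \<and> c' = k * c \<and> d' = k * d)"
proof
  assume "mob a b c d = mob a' b' c' d'"
  moreover have "[:d, c:] \<noteq> 0" "[:d', c':] \<noteq> 0" using assms by auto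
  ultimately have "[:b, a:] * [:d', c':] = [:b', a':] * [:d, c:]"
    using Fract_eq_iff unfolding mob_def by blast
  then have e: "b * d' = b' * d" "b * c' + a * d' = b' * c + a' * d" "a * c' = a' * c"
    by (auto simp: algebra_simps)
  show "\<exists>k. k \<noteq> 0 \<and> a' = k * a \<and> b' = k * b \<and> c' = k * c \<and> d' = k * d"
  proof -
    define D where "D = a * d - b * c"
    define T where "T = a' * d - c' * b"
    have D: "D \<noteq> 0" using assms D_def by simp
    have 1: "D * a' = T * a" "D * b' = T * b" "D * c' = T * c" "D * d' = T * d"
    proof -
      have "D * a' - T * a = b * (a * c' - a' * c)"
        "D * b' - T * b = b * ((b * c' + a * d') - (b' * c + a' * d)) - a * (b * d' - b' * d)"
        "D * c' - T * c = d * (a * c' - a' * c)"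
        "D * d' - T * d = d * ((b * c' + a * d') - (b' * c + a' * d)) - c * (b * d' - b' * d)"
        by (simp_all add: D_def T_def algebra_simps)
      then show "D * a' = T * a" "D * b' = T * b" "D * c' = T * c" "D * d' = T * d"
        using e by simp_all
    qed
    define k where "k = T / D"
    have 2: "a' = k * a" "b' = k * b" "c' = k * c" "d' = k * d"
      using 1 D by (auto simp: k_def field_simps)
    moreover have "k \<noteq> 0" using 2 assms(2) by auto
    ultimately show ?thesis by blast
  qed
next
  assume "\<exists>k. k \<noteq> 0 \<and> a' = k * a \<and> b' = k * b \<and> c' = k * c \<and> d' = k * d"
  then obtain k where k: "k \<noteq> 0" "a' = k * a" "b' = k * b" "c' = k * c" "d' = k * d" by blast
  have "[:d, c:] \<noteq> 0" "[:d', c':] \<noteq> 0" using assms by auto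
  moreover have "[:b, a:] * [:d', c':] = [:b', a':] * [:d, c:]" by (simp add: k algebra_simps)
  ultimately show "mob a b c d = mob a' b' c' d'"
    unfolding mob_def using Fract_eq_iff by blast
qed

lemma nonconstant_mob:
  assumes "a * d - b * c \<noteq> 0" shows "nonconstant (mob a b c d)"
  unfolding nonconstant_def
proof (intro allI notI)
  fix k assume "mob a b c d = cst k"
  moreover have "[:d, c:] \<noteq> 0" using assms by auto
  ultimately have "[:b, a:] * 1 = [:k:] * [:d, c:]"
    using Fract_eq_iff[of "[:d, c:]" 1 "[:b, a:]" "[:k:]"] unfolding mob_def cst_def by simp
  then have "b = k * d" "a = k * c" by simp_all
  then show False using assms by simp
qed

lemma linear_idz_neq_0: "c \<noteq> 0 \<or> d \<noteq> 0 \<Longrightarrow> cst c * idz + cst d \<noteq> 0"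
  using peval_idz_eq_0_iff[of "[:d, c:]"] by (auto simp: algebra_simps)

lemma rat_comp_mob:
  fixes s :: "'k::{alg_closed_field, field_gcd} poly fract"
  assumes "nonconstant s"
  shows "rat_comp (mob a b c d) s = (cst a * s + cst b) / (cst c * s + cst d)"
  using assms by (simp add: mob_eq)

lemma rat_comp_mob_mob:
  fixes a :: "'k::{alg_closed_field, field_gcd}"
  assumes "a' * d' - b' * c' \<noteq> 0"
  shows "rat_comp (mob a b c d) (mob a' b' c' d') =
    mob (a * a' + b * c') (a * b' + b * d') (c * a' + d * c') (c * b' + d * d')"
proof -
  let ?D = "cst c' * idz + cst d'"
  have D: "?D \<noteq> 0" using assms by (intro linear_idz_neq_0) auto
  have e: "cst x * mob a' b' c' d' + cst y = (cst (x * a' + y * c') * idz + cst (x * b' + y * d')) / ?D" for x y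
    using D by (simp add: mob_eq field_simps)
  show ?thesis
    using D by (simp add: rat_comp_mob nonconstant_mob[OF assms] e del: cst_hom) (simp add: mob_eq)
qed

lemma carrier_PGL2: "carrier PGL2 = {mob a b c d | a b c d. a * d - b * c \<noteq> 0}"
  by (simp add: PGL2_def mob_def)

lemma mult_PGL2 [simp]: "monoid.mult PGL2 = rat_comp"
  by (simp add: PGL2_def)

lemma one_PGL2 [simp]: "\<one>\<^bsub>PGL2\<^esub> = idz"
  by (simp add: PGL2_def idz_def)

lemma mob_in_PGL2 [simp]: "a * d - b * c \<noteq> 0 \<Longrightarrow> mob a b c d \<in> carrier PGL2"
  by (auto simp: carrier_PGL2)

lemma PGL2E:
  assumes "\<alpha> \<in> carrier PGL2"
  obtains a b c d where "a * d - b * c \<noteq> 0" "\<alpha> = mob a b c d"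
  using assms by (auto simp: carrier_PGL2)

lemma nonconstant_PGL2: "\<alpha> \<in> carrier PGL2 \<Longrightarrow> nonconstant \<alpha>"
  by (auto simp: carrier_PGL2 nonconstant_mob)

lemma idz_eq_mob: "idz = mob 1 0 0 1"
  by (simp add: mob_eq)

lemma mob_scalar: "k \<noteq> 0 \<Longrightarrow> mob k 0 0 k = idz"
  by (simp add: mob_eq)

lemma mob_adjugate:
  fixes a :: "'k::{alg_closed_field, field_gcd}"
  assumes "a * d - b * c \<noteq> 0"
  shows "rat_comp (mob d (-b) (-c) a) (mob a b c d) = idz"
proof -
  have "rat_comp (mob d (-b) (-c) a) (mob a b c d) = mob (a * d - b * c) 0 0 (a * d - b * c)"
    using rat_comp_mob_mob[OF assms, of d "-b" "-c" a] by (simp add: algebra_simps)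
  then show ?thesis using assms by (simp add: mob_scalar)
qed

lemma group_PGL2: "group (PGL2 :: 'k::{alg_closed_field, field_gcd} poly fract monoid)"
proof (rule groupI)
  fix x y :: "'k poly fract"
  assume "x \<in> carrier PGL2" "y \<in> carrier PGL2"
  then obtain a b c d a' b' c' d' where
    *: "a * d - b * c \<noteq> 0" "x = mob a b c d" "a' * d' - b' * c' \<noteq> 0" "y = mob a' b' c' d'"
    by (metis PGL2E)
  have "(a * a' + b * c') * (c * b' + d * d') - (a * b' + b * d') * (c * a' + d * c')
      = (a * d - b * c) * (a' * d' - b' * c')" by (simp add: algebra_simps)
  with * show "x \<otimes>\<^bsub>PGL2\<^esub> y \<in> carrier PGL2" by (simp add: rat_comp_mob_mob)
next
  fix x :: "'k poly fract"
  assume "x \<in> carrier PGL2"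
  then obtain a b c d where *: "a * d - b * c \<noteq> 0" "x = mob a b c d" by (metis PGL2E)
  show "\<one>\<^bsub>PGL2\<^esub> \<otimes>\<^bsub>PGL2\<^esub> x = x" using * by (simp add: nonconstant_mob)
  show "\<exists>y\<in>carrier PGL2. y \<otimes>\<^bsub>PGL2\<^esub> x = \<one>\<^bsub>PGL2\<^esub>"
    using * by (intro bexI[of _ "mob d (-b) (-c) a"]) (auto simp: mob_adjugate mult.commute)
qed (auto simp: rat_comp_assoc nonconstant_PGL2 idz_eq_mob)

section \<open>Conjugation\<close>

lemma nonconstant_rat_conj:
  fixes f :: "'k::{alg_closed_field, field_gcd} poly fract"
  assumes "nonconstant f" "\<alpha> \<in> carrier PGL2"
  shows "nonconstant (rat_conj f \<alpha>)"
  unfolding rat_conj_def using assms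
  by (meson nonconstant_rat_comp nonconstant_PGL2 group.inv_closed[OF group_PGL2])

text \<open>Rewriting a conjugation as a commutation relation eliminates the inverse.\<close>

lemma rat_conj_eq_iff:
  fixes f :: "'k::{alg_closed_field, field_gcd} poly fract"
  assumes f: "nonconstant f" and g: "nonconstant g" and a: "\<alpha> \<in> carrier PGL2"
  shows "rat_conj f \<alpha> = g \<longleftrightarrow> rat_comp f \<alpha> = rat_comp \<alpha> g"
proof -
  let ?i = "inv\<^bsub>PGL2\<^esub> \<alpha>"
  have i: "?i \<in> carrier PGL2" using a by (rule group.inv_closed[OF group_PGL2])
  have na: "nonconstant \<alpha>" and ni: "nonconstant ?i" using a i nonconstant_PGL2 by auto
  have "rat_comp \<alpha> ?i = idz" "rat_comp ?i \<alpha> = idz"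
    using group.r_inv[OF group_PGL2 a] group.l_inv[OF group_PGL2 a] by auto
  then have 1: "rat_comp \<alpha> (rat_comp ?i h) = h" "rat_comp ?i (rat_comp \<alpha> h) = h" if "nonconstant h" for h
    using that na ni by (simp_all flip: rat_comp_assoc)
  show ?thesis
  proof
    assume "rat_conj f \<alpha> = g"
    then have "rat_comp \<alpha> g = rat_comp \<alpha> (rat_comp ?i (rat_comp f \<alpha>))" by (simp add: rat_conj_def)
    then show "rat_comp f \<alpha> = rat_comp \<alpha> g" using 1(1)[OF nonconstant_rat_comp[OF na f]] by simp
  next
    assume "rat_comp f \<alpha> = rat_comp \<alpha> g"
    then show "rat_conj f \<alpha> = g" using 1(2)[OF g] by (simp add: rat_conj_def)
  qed
qed

lemma rat_comp_rat_conj: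
  fixes f :: "'k::{alg_closed_field, field_gcd} poly fract"
  assumes f: "nonconstant f" and a: "\<alpha> \<in> carrier PGL2"
  shows "rat_comp \<alpha> (rat_conj f \<alpha>) = rat_comp f \<alpha>"
  using rat_conj_eq_iff[OF f nonconstant_rat_conj[OF f a] a] by simp

lemma rat_conj_rat_conj:
  fixes f :: "'k::{alg_closed_field, field_gcd} poly fract"
  assumes f: "nonconstant f" and a: "\<alpha> \<in> carrier PGL2" and b: "\<beta> \<in> carrier PGL2"
  shows "rat_conj (rat_conj f \<alpha>) \<beta> = rat_conj f (rat_comp \<alpha> \<beta>)"
proof -
  let ?g = "rat_conj f \<alpha>" let ?h = "rat_conj ?g \<beta>"
  have ab: "rat_comp \<alpha> \<beta> \<in> carrier PGL2"
    using group.is_monoid[OF group_PGL2] a b monoid.m_closed by (metis mult_PGL2)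
  note nc = f nonconstant_rat_conj[OF f a] nonconstant_rat_conj[OF nonconstant_rat_conj[OF f a] b]
    nonconstant_PGL2[OF a] nonconstant_PGL2[OF b]
  have "rat_comp f (rat_comp \<alpha> \<beta>) = rat_comp (rat_comp f \<alpha>) \<beta>" using nc by (simp add: rat_comp_assoc)
  also have "\<dots> = rat_comp (rat_comp \<alpha> ?g) \<beta>" using f a by (simp add: rat_comp_rat_conj)
  also have "\<dots> = rat_comp \<alpha> (rat_comp \<beta> ?h)" using nc b by (simp add: rat_comp_assoc rat_comp_rat_conj)
  also have "\<dots> = rat_comp (rat_comp \<alpha> \<beta>) ?h" using nc by (simp add: rat_comp_assoc)
  finally show ?thesis using rat_conj_eq_iff[OF f nc(3) ab] by simp
qed

lemma rat_conj_idz [simp]: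
  "nonconstant f \<Longrightarrow> rat_conj f idz = (f :: 'k::{alg_closed_field, field_gcd} poly fract)"
  using rat_conj_eq_iff[of f f idz] mob_in_PGL2[of 1 1 0 0] by (simp flip: idz_eq_mob)

section \<open>Automorphism groups\<close>

lemma carrier_Aut: "carrier (Aut f) = {\<alpha> \<in> carrier PGL2. rat_conj f \<alpha> = f}"
  and mult_Aut [simp]: "monoid.mult (Aut f) = rat_comp"
  and one_Aut [simp]: "\<one>\<^bsub>Aut f\<^esub> = idz"
  by (simp_all add: Aut_def PGL2_def idz_def)

lemma Aut_rat_conj_iso:
  fixes f :: "'k::{alg_closed_field, field_gcd} poly fract"
  assumes f: "nonconstant f" and a: "\<alpha> \<in> carrier PGL2"
  shows "Aut (rat_conj f \<alpha>) \<cong> Aut f"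
proof -
  interpret G: group "PGL2 :: 'k poly fract monoid" by (rule group_PGL2)
  let ?i = "inv\<^bsub>PGL2\<^esub> \<alpha>"
  let ?h = "\<lambda>\<beta>. \<alpha> \<otimes>\<^bsub>PGL2\<^esub> \<beta> \<otimes>\<^bsub>PGL2\<^esub> ?i"
  let ?k = "\<lambda>\<gamma>. ?i \<otimes>\<^bsub>PGL2\<^esub> \<gamma> \<otimes>\<^bsub>PGL2\<^esub> \<alpha>"
  have i: "?i \<in> carrier PGL2" using a by simp
  have act: "rat_conj (rat_conj f x) y = rat_conj f (x \<otimes>\<^bsub>PGL2\<^esub> y)"
    if "x \<in> carrier PGL2" "y \<in> carrier PGL2" for x y
    using rat_conj_rat_conj[OF f that] by simp
  have act1: "rat_conj f \<one>\<^bsub>PGL2\<^esub> = f" using f by simp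
  have h: "?h \<beta> \<in> carrier (Aut f)" if "\<beta> \<in> carrier (Aut (rat_conj f \<alpha>))" for \<beta>
  proof -
    have b: "\<beta> \<in> carrier PGL2" "rat_conj (rat_conj f \<alpha>) \<beta> = rat_conj f \<alpha>"
      using that by (auto simp: carrier_Aut)
    have "\<alpha> \<otimes>\<^bsub>PGL2\<^esub> \<beta> \<in> carrier PGL2" using a b(1) by (rule G.m_closed)
    then have "rat_conj f (?h \<beta>) = rat_conj (rat_conj f (\<alpha> \<otimes>\<^bsub>PGL2\<^esub> \<beta>)) ?i"
      using i by (simp only: act)
    also have "\<dots> = rat_conj (rat_conj (rat_conj f \<alpha>) \<beta>) ?i" using a b(1) by (simp only: act)
    also have "\<dots> = rat_conj f (\<alpha> \<otimes>\<^bsub>PGL2\<^esub> ?i)" using b(2) act[OF a i] by simp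
    finally show ?thesis using a b(1) act1 by (simp add: carrier_Aut del: mult_PGL2 one_PGL2)
  qed
  have k: "?k \<gamma> \<in> carrier (Aut (rat_conj f \<alpha>))" if "\<gamma> \<in> carrier (Aut f)" for \<gamma>
  proof -
    have b: "\<gamma> \<in> carrier PGL2" "rat_conj f \<gamma> = f" using that by (auto simp: carrier_Aut)
    have c: "?k \<gamma> \<in> carrier PGL2" using a b(1) by (simp del: mult_PGL2)
    have e: "\<alpha> \<otimes>\<^bsub>PGL2\<^esub> ?k \<gamma> = \<gamma> \<otimes>\<^bsub>PGL2\<^esub> \<alpha>"
      using a b(1) by (simp add: G.m_assoc[symmetric] del: mult_PGL2 one_PGL2)
    have "rat_conj (rat_conj f \<alpha>) (?k \<gamma>) = rat_conj f (\<alpha> \<otimes>\<^bsub>PGL2\<^esub> ?k \<gamma>)" using a c act by blast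
    also have "\<dots> = rat_conj (rat_conj f \<gamma>) \<alpha>" unfolding e using act a b(1) by simp
    finally show ?thesis using c b(2) by (simp add: carrier_Aut del: mult_PGL2)
  qed
  have hk: "?h (?k \<gamma>) = \<gamma>" "?k (?h \<gamma>) = \<gamma>" if "\<gamma> \<in> carrier PGL2" for \<gamma>
  proof -
    have [simp]: "\<alpha> \<otimes>\<^bsub>PGL2\<^esub> (?i \<otimes>\<^bsub>PGL2\<^esub> y) = y" "?i \<otimes>\<^bsub>PGL2\<^esub> (\<alpha> \<otimes>\<^bsub>PGL2\<^esub> y) = y"
      if "y \<in> carrier PGL2" for y
      using a that by (simp_all add: G.m_assoc[symmetric] del: mult_PGL2 one_PGL2)
    show "?h (?k \<gamma>) = \<gamma>" "?k (?h \<gamma>) = \<gamma>"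
      using a i that by (simp_all add: G.m_assoc del: mult_PGL2 one_PGL2)
  qed
  have "?h \<in> hom (Aut (rat_conj f \<alpha>)) (Aut f)"
  proof (rule homI)
    fix x y assume "x \<in> carrier (Aut (rat_conj f \<alpha>))" "y \<in> carrier (Aut (rat_conj f \<alpha>))"
    then have xy: "x \<in> carrier PGL2" "y \<in> carrier PGL2" by (auto simp: carrier_Aut)
    have [simp]: "?i \<otimes>\<^bsub>PGL2\<^esub> (\<alpha> \<otimes>\<^bsub>PGL2\<^esub> y) = y" if "y \<in> carrier PGL2" for y
      using a that by (simp_all add: G.m_assoc[symmetric] del: mult_PGL2 one_PGL2)
    have "?h (x \<otimes>\<^bsub>PGL2\<^esub> y) = ?h x \<otimes>\<^bsub>PGL2\<^esub> ?h y"
      using a i xy by (simp add: G.m_assoc del: mult_PGL2 one_PGL2)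
    then show "?h (x \<otimes>\<^bsub>Aut (rat_conj f \<alpha>)\<^esub> y) = ?h x \<otimes>\<^bsub>Aut f\<^esub> ?h y" by simp
  qed (rule h)
  moreover have "bij_betw ?h (carrier (Aut (rat_conj f \<alpha>))) (carrier (Aut f))"
    using h k hk by (intro bij_betw_byWitness[where f' = ?k]) (auto simp: carrier_Aut)
  ultimately show ?thesis unfolding is_iso_def iso_def by blast
qed

lemma is_iso_C2:
  assumes "carrier M = {e, a}" "e \<noteq> a"
    and "e \<otimes>\<^bsub>M\<^esub> e = e" "e \<otimes>\<^bsub>M\<^esub> a = a" "a \<otimes>\<^bsub>M\<^esub> e = a" "a \<otimes>\<^bsub>M\<^esub> a = e"
  shows "M \<cong> integer_mod_group 2"
proof -
  have c: "carrier (integer_mod_group 2) = {0, 1}" by (auto simp: carrier_integer_mod_group)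
  let ?h = "\<lambda>x. if x = e then 0 else 1 :: int"
  have "?h \<in> hom M (integer_mod_group 2)" using assms(2-) by (auto simp: hom_def assms(1) c)
  moreover have "bij_betw ?h (carrier M) (carrier (integer_mod_group 2))"
    using assms(2) by (auto simp: bij_betw_def assms(1) c inj_on_def)
  ultimately show ?thesis unfolding is_iso_def iso_def by blast
qed

text \<open>The relations \<open>r\<^sup>3 = 1\<close>, \<open>s\<^sup>2 = 1\<close> and \<open>s r = r\<^sup>2 s\<close> bring every
  product into the form \<open>r\<^sup>i s\<^sup>j\<close>, so a group of six such elements is determined up to
  isomorphism.\<close>

definition S3_table :: "('a, 'b) monoid_scheme \<Rightarrow> 'a \<Rightarrow> 'a \<Rightarrow> bool" where
  "S3_table M r s \<longleftrightarrow> r \<in> carrier M \<and> s \<in> carrier M \<and>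
     r \<otimes>\<^bsub>M\<^esub> (r \<otimes>\<^bsub>M\<^esub> r) = \<one>\<^bsub>M\<^esub> \<and> s \<otimes>\<^bsub>M\<^esub> s = \<one>\<^bsub>M\<^esub> \<and> s \<otimes>\<^bsub>M\<^esub> r = r \<otimes>\<^bsub>M\<^esub> (r \<otimes>\<^bsub>M\<^esub> s) \<and>
     carrier M = {\<one>\<^bsub>M\<^esub>, r, r \<otimes>\<^bsub>M\<^esub> r, s, r \<otimes>\<^bsub>M\<^esub> s, r \<otimes>\<^bsub>M\<^esub> (r \<otimes>\<^bsub>M\<^esub> s)} \<and>
     card (carrier M) = 6"

lemma S3_table_normal_form:
  assumes "group M" "S3_table M r s"
  defines "w \<equiv> \<lambda>(i::nat) (j::nat). (r [^]\<^bsub>M\<^esub> i) \<otimes>\<^bsub>M\<^esub> (s [^]\<^bsub>M\<^esub> j)"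
  shows "bij_betw (\<lambda>(i, j). w i j) ({..<3} \<times> {..<2}) (carrier M)"
    and "\<And>i j k l. i < 3 \<Longrightarrow> j < 2 \<Longrightarrow> k < 3 \<Longrightarrow> l < 2 \<Longrightarrow>
      w i j \<otimes>\<^bsub>M\<^esub> w k l = w ((i + (if j = 0 then k else 3 - k)) mod 3) ((j + l) mod 2)"
proof -
  interpret group M by fact
  have t: "r \<in> carrier M" "s \<in> carrier M" "r \<otimes>\<^bsub>M\<^esub> (r \<otimes>\<^bsub>M\<^esub> r) = \<one>\<^bsub>M\<^esub>" "s \<otimes>\<^bsub>M\<^esub> s = \<one>\<^bsub>M\<^esub>"
     "s \<otimes>\<^bsub>M\<^esub> r = r \<otimes>\<^bsub>M\<^esub> (r \<otimes>\<^bsub>M\<^esub> s)" "card (carrier M) = 6"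
     "carrier M = {\<one>\<^bsub>M\<^esub>, r, r \<otimes>\<^bsub>M\<^esub> r, s, r \<otimes>\<^bsub>M\<^esub> s, r \<otimes>\<^bsub>M\<^esub> (r \<otimes>\<^bsub>M\<^esub> s)}"
    using assms(2) unfolding S3_table_def by - (elim conjE, assumption)+
  have x: "r \<otimes>\<^bsub>M\<^esub> (r \<otimes>\<^bsub>M\<^esub> (r \<otimes>\<^bsub>M\<^esub> y)) = y" "s \<otimes>\<^bsub>M\<^esub> (s \<otimes>\<^bsub>M\<^esub> y) = y"
      "s \<otimes>\<^bsub>M\<^esub> (r \<otimes>\<^bsub>M\<^esub> y) = r \<otimes>\<^bsub>M\<^esub> (r \<otimes>\<^bsub>M\<^esub> (s \<otimes>\<^bsub>M\<^esub> y))" if "y \<in> carrier M" for y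
  proof -
    have "r \<otimes>\<^bsub>M\<^esub> (r \<otimes>\<^bsub>M\<^esub> r) \<otimes>\<^bsub>M\<^esub> y = y" "s \<otimes>\<^bsub>M\<^esub> s \<otimes>\<^bsub>M\<^esub> y = y"
      "s \<otimes>\<^bsub>M\<^esub> r \<otimes>\<^bsub>M\<^esub> y = r \<otimes>\<^bsub>M\<^esub> (r \<otimes>\<^bsub>M\<^esub> s) \<otimes>\<^bsub>M\<^esub> y"
      using that by (simp_all only: t(3-5) l_one)
    then show "r \<otimes>\<^bsub>M\<^esub> (r \<otimes>\<^bsub>M\<^esub> (r \<otimes>\<^bsub>M\<^esub> y)) = y" "s \<otimes>\<^bsub>M\<^esub> (s \<otimes>\<^bsub>M\<^esub> y) = y"
      "s \<otimes>\<^bsub>M\<^esub> (r \<otimes>\<^bsub>M\<^esub> y) = r \<otimes>\<^bsub>M\<^esub> (r \<otimes>\<^bsub>M\<^esub> (s \<otimes>\<^bsub>M\<^esub> y))"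
      using that t(1,2) by (simp_all add: m_assoc)
  qed
  have lt: "n < 3 \<longleftrightarrow> n = 0 \<or> n = Suc 0 \<or> n = Suc (Suc 0)" "n < 2 \<longleftrightarrow> n = 0 \<or> n = Suc 0" for n :: nat
    by auto
  have w: "w 0 0 = \<one>\<^bsub>M\<^esub>" "w (Suc 0) 0 = r" "w (Suc (Suc 0)) 0 = r \<otimes>\<^bsub>M\<^esub> r" "w 0 (Suc 0) = s"
    "w (Suc 0) (Suc 0) = r \<otimes>\<^bsub>M\<^esub> s" "w (Suc (Suc 0)) (Suc 0) = r \<otimes>\<^bsub>M\<^esub> (r \<otimes>\<^bsub>M\<^esub> s)"
    using t(1,2) by (simp_all add: w_def m_assoc)
  have w': "w 2 0 = r \<otimes>\<^bsub>M\<^esub> r" "w 2 (Suc 0) = r \<otimes>\<^bsub>M\<^esub> (r \<otimes>\<^bsub>M\<^esub> s)"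
    using w by (simp_all add: numeral_2_eq_2)
  have lt': "n < 3 \<longleftrightarrow> n = 0 \<or> n = 1 \<or> n = 2" "n < 2 \<longleftrightarrow> n = 0 \<or> n = 1" for n :: nat
    by auto
  have set: "{..<3::nat} \<times> {..<2::nat} = {(0,0),(Suc 0,0),(Suc (Suc 0),0),(0,Suc 0),(Suc 0,Suc 0),(Suc (Suc 0),Suc 0)}"
    by (auto simp: lt)
  have im: "(\<lambda>(i, j). w i j) ` ({..<3} \<times> {..<2}) = carrier M"
    unfolding set by (subst t(7)) (simp add: w)
  then show "bij_betw (\<lambda>(i, j). w i j) ({..<3} \<times> {..<2}) (carrier M)"
    unfolding bij_betw_def using t(6) by (auto intro!: eq_card_imp_inj_on)
  fix i j k l :: nat
  assume "i < 3" "j < 2" "k < 3" "l < 2"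
  then show "w i j \<otimes>\<^bsub>M\<^esub> w k l = w ((i + (if j = 0 then k else 3 - k)) mod 3) ((j + l) mod 2)"
    unfolding lt'
    by (elim disjE; hypsubst) (simp_all add: w w' m_assoc x t(1-5))
qed

lemma S3_table_iso:
  assumes "group M" "S3_table M r s" "group N" "S3_table N r' s'"
  shows "M \<cong> N"
proof -
  define w where "w = (\<lambda>(i::nat) (j::nat). (r [^]\<^bsub>M\<^esub> i) \<otimes>\<^bsub>M\<^esub> (s [^]\<^bsub>M\<^esub> j))"
  define w' where "w' = (\<lambda>(i::nat) (j::nat). (r' [^]\<^bsub>N\<^esub> i) \<otimes>\<^bsub>N\<^esub> (s' [^]\<^bsub>N\<^esub> j))"
  let ?I = "{..<3::nat} \<times> {..<2::nat}" let ?w = "\<lambda>(i, j). w i j" let ?w' = "\<lambda>(i, j). w' i j"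
  note 1 = S3_table_normal_form(1)[OF assms(1,2), folded w_def]
  note 2 = S3_table_normal_form(1)[OF assms(3,4), folded w'_def]
  define h where "h = ?w' \<circ> the_inv_into ?I ?w"
  have h: "h (w i j) = w' i j" if "i < 3" "j < 2" for i j
    using the_inv_into_f_f[OF bij_betw_imp_inj_on[OF 1], of "(i, j)"] that by (simp add: h_def)
  have bij: "bij_betw h (carrier M) (carrier N)"
    unfolding h_def by (rule bij_betw_trans[OF bij_betw_the_inv_into[OF 1] 2])
  have "h (x \<otimes>\<^bsub>M\<^esub> y) = h x \<otimes>\<^bsub>N\<^esub> h y" if xM: "x \<in> carrier M" and yM: "y \<in> carrier M" for x y
  proof -
    have ex: "\<exists>i j. i < 3 \<and> j < 2 \<and> z = w i j" if "z \<in> carrier M" for z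
    proof -
      from that have "z \<in> ?w ` ?I" unfolding bij_betw_imp_surj_on[OF 1] .
      then show ?thesis by auto
    qed
    obtain i j where i: "i < 3" "j < 2" "x = w i j" using ex[OF xM] by blast
    obtain k l where k: "k < 3" "l < 2" "y = w k l" using ex[OF yM] by blast
    note ij = i(1,2) k(1,2) and xy = i(3) k(3)
    have "w i j \<otimes>\<^bsub>M\<^esub> w k l = w ((i + (if j = 0 then k else 3 - k)) mod 3) ((j + l) mod 2)"
      unfolding w_def by (rule S3_table_normal_form(2)[OF assms(1,2) ij])
    moreover have "w' i j \<otimes>\<^bsub>N\<^esub> w' k l = w' ((i + (if j = 0 then k else 3 - k)) mod 3) ((j + l) mod 2)"
      unfolding w'_def by (rule S3_table_normal_form(2)[OF assms(3,4) ij])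
    ultimately show ?thesis unfolding xy h[OF ij(1,2)] h[OF ij(3,4)] by (simp only:) (rule h; simp)
  qed
  moreover have "h \<in> carrier M \<rightarrow> carrier N" using bij_betw_imp_funcset[OF bij] .
  ultimately have "h \<in> iso M N" using bij unfolding iso_def hom_def by blast
  then show ?thesis unfolding is_iso_def by blast
qed

lemma sym_group_3_table: "\<exists>r s. S3_table (sym_group 3) r s"
proof -
  \<comment> \<open>a rotation and a reflection; two values suffice to tell their products apart\<close>
  let ?r = "transpose 1 2 \<circ> transpose 2 (3::nat)" and ?s = "transpose 1 (2::nat)"
  have p: "?r permutes {1..3}" "?s permutes {1..3}"
    by (auto intro!: permutes_compose permutes_swap_id)
  have card: "card (carrier (sym_group 3)) = 6"
    using sym_group_card_carrier[of 3] by (simp add: fact_numeral)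
  let ?C = "{id, ?r, ?r \<circ> ?r, ?s, ?r \<circ> ?s, ?r \<circ> (?r \<circ> ?s)}"
  have "?C \<subseteq> carrier (sym_group 3)"
    using p by (auto simp: sym_group_carrier intro!: permutes_compose permutes_id)
  moreover have "card ?C \<ge> 6"
  proof -
    have "card ((\<lambda>f. (f 1, f 2)) ` ?C) = 6" by (simp add: transpose_def)
    moreover have "card ((\<lambda>f. (f 1, f 2)) ` ?C) \<le> card ?C" by (rule card_image_le) simp
    ultimately show ?thesis by linarith
  qed
  moreover have "finite (carrier (sym_group 3))" using card by (metis card.infinite zero_neq_numeral)
  ultimately have C: "carrier (sym_group 3) = ?C"
    using card card_seteq[of "carrier (sym_group 3)" ?C] by simp
  have "S3_table (sym_group 3) ?r ?s"
    unfolding S3_table_def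
  proof (intro conjI)
    show "?r \<in> carrier (sym_group 3)" "?s \<in> carrier (sym_group 3)" using p by (simp_all add: sym_group_carrier)
    show "carrier (sym_group 3) = {\<one>\<^bsub>sym_group 3\<^esub>, ?r, ?r \<otimes>\<^bsub>sym_group 3\<^esub> ?r, ?s, ?r \<otimes>\<^bsub>sym_group 3\<^esub> ?s,
       ?r \<otimes>\<^bsub>sym_group 3\<^esub> (?r \<otimes>\<^bsub>sym_group 3\<^esub> ?s)}"
      unfolding sym_group_mult sym_group_one by (rule C)
  qed (auto simp: sym_group_mult sym_group_one card fun_eq_iff transpose_def)
  then show ?thesis by blast
qed

lemma S3_table_imp_iso:
  assumes "group M" "S3_table M r s"
  shows "M \<cong> sym_group 3"
  using sym_group_3_table S3_table_iso[OF assms sym_group_is_group] by blast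

section \<open>Pairs of binary quadratic forms\<close>

lemma infinite_UNIV_alg_closed: "infinite (UNIV :: 'k::alg_closed_field set)"
proof
  assume fin: "finite (UNIV :: 'k set)"
  let ?Q = "\<Prod>a\<in>(UNIV :: 'k set). [:-a, 1:]"
  have "Polynomial.degree ?Q = card (UNIV :: 'k set)"
    by (subst degree_prod_eq_sum_degree) auto
  moreover have "card (UNIV :: 'k set) > 0" using fin by (simp add: card_gt_0_iff)
  ultimately have "Polynomial.degree (?Q + 1) > 0" by (simp add: degree_add_eq_left)
  then obtain x where "poly (?Q + 1) x = 0" using alg_closed_imp_poly_has_root by blast
  moreover have "poly ?Q x = 0" using fin by (auto simp: poly_prod prod_zero_iff)
  ultimately show False by simp
qed

lemma poly_eqI_values:
  fixes p q :: "'k::alg_closed_field poly"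
  assumes "\<And>x. poly p x = poly q x"
  shows "p = q"
proof (rule ccontr)
  assume "p \<noteq> q"
  then have "finite {x. poly (p - q) x = 0}" by (intro poly_roots_finite) simp
  then show False using assms infinite_UNIV_alg_closed[where 'k = 'k] by simp
qed

definition qform :: "'k::comm_ring_1 poly \<Rightarrow> 'k \<Rightarrow> 'k \<Rightarrow> 'k" where
  "qform F x y = Polynomial.coeff F 2 * x^2 + Polynomial.coeff F 1 * x * y + Polynomial.coeff F 0 * y^2"

text \<open>A polynomial of degree at most 2 stands for a binary quadratic form, which makes
  infinity a point like any other. Two forms define a map of degree 2 if and only if they have no
  common zero on the projective line.\<close>

definition quad_pair :: "'k::field poly \<Rightarrow> 'k poly \<Rightarrow> bool" where
  "quad_pair F G \<longleftrightarrow> Polynomial.degree F \<le> 2 \<and> Polynomial.degree G \<le> 2 \<and>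
     (\<forall>x y. qform F x y = 0 \<longrightarrow> qform G x y = 0 \<longrightarrow> x = 0 \<and> y = 0)"

text \<open>Half the Jacobian determinant of the two forms, which also makes sense in characteristic 2.\<close>

definition wronskian :: "'k::comm_ring_1 poly \<Rightarrow> 'k poly \<Rightarrow> 'k \<Rightarrow> 'k \<Rightarrow> 'k" where
  "wronskian F G x y =
     (Polynomial.coeff F 2 * Polynomial.coeff G 1 - Polynomial.coeff F 1 * Polynomial.coeff G 2) * x^2 +
     2 * (Polynomial.coeff F 2 * Polynomial.coeff G 0 - Polynomial.coeff F 0 * Polynomial.coeff G 2) * x * y +
     (Polynomial.coeff F 1 * Polynomial.coeff G 0 - Polynomial.coeff F 0 * Polynomial.coeff G 1) * y^2"

lemma quadratic_cases:
  assumes "Polynomial.degree F \<le> 2"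
  obtains f0 f1 f2 where "F = [:f0, f1, f2:]"
proof
  show "F = [:Polynomial.coeff F 0, Polynomial.coeff F 1, Polynomial.coeff F 2:]"
    using assms by (intro poly_eqI) (auto simp: coeff_pCons coeff_eq_0 numeral_2_eq_2 split: nat.splits)
qed

lemma qform_quad [simp]: "qform [:f0, f1, f2:] x y = f2 * x^2 + f1 * x * y + f0 * y^2"
  by (simp add: qform_def numeral_2_eq_2)

lemma wronskian_quad [simp]:
  "wronskian [:f0, f1, f2:] [:g0, g1, g2:] x y =
    (f2 * g1 - f1 * g2) * x^2 + 2 * (f2 * g0 - f0 * g2) * x * y + (f1 * g0 - f0 * g1) * y^2"
  by (simp add: wronskian_def numeral_2_eq_2)

lemma qform_smult [simp]: "qform (Polynomial.smult c F) x y = c * qform F x y"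
  by (simp add: qform_def algebra_simps)

lemma qform_add [simp]: "qform (F + G) x y = qform F x y + qform G x y"
  and qform_diff [simp]: "qform (F - G) x y = qform F x y - qform G x y"
  for F G :: "'k::comm_ring_1 poly"
  by (simp_all add: qform_def algebra_simps)

lemma qform_scale: "qform F (s * x) (s * y) = s^2 * qform F x y"
  by (simp add: qform_def algebra_simps power2_eq_square)

lemma wronskian_scale: "wronskian F G (s * x) (s * y) = s^2 * wronskian F G x y"
  by (simp add: wronskian_def algebra_simps power2_eq_square)

lemma degree_quad_le: "Polynomial.degree [:f0, f1, f2:] \<le> 2"
  by (intro degree_le) (auto simp: coeff_pCons split: nat.splits)

lemma poly_eq_qform: "Polynomial.degree F \<le> 2 \<Longrightarrow> poly F z = qform F z 1"
  by (erule quadratic_cases) (simp add: algebra_simps power2_eq_square)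

lemma poly_eq_qform': "Polynomial.degree F \<le> 2 \<Longrightarrow> y \<noteq> 0 \<Longrightarrow> poly F (x / y) = qform F x y / y^2" for y :: "'k::field"
  by (erule quadratic_cases) (simp add: field_simps power2_eq_square)

lemma quad_pair_coprime:
  fixes F G :: "'k::{alg_closed_field, field_gcd} poly"
  assumes "quad_pair F G" "F \<noteq> 0 \<or> G \<noteq> 0"
  shows "coprime F G"
proof (rule coprimeI)
  fix H assume H: "H dvd F" "H dvd G"
  have "Polynomial.degree H = 0"
  proof (rule ccontr)
    assume "Polynomial.degree H \<noteq> 0"
    then obtain z where "poly H z = 0" using alg_closed_imp_poly_has_root by blast
    then have "poly F z = 0" "poly G z = 0" using H by (auto elim!: dvdE)
    then show False using assms poly_eq_qform unfolding quad_pair_def by (metis zero_neq_one)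
  qed
  moreover have "H \<noteq> 0" using H assms by auto
  ultimately show "is_unit H" by (simp add: is_unit_iff_degree)
qed

lemma qform_has_zero:
  fixes F :: "'k::alg_closed_field poly"
  shows "\<exists>x y. (x \<noteq> 0 \<or> y \<noteq> 0) \<and> qform F x y = 0"
proof (cases "Polynomial.coeff F 2 = 0")
  case True then show ?thesis by (intro exI[of _ 1] exI[of _ 0]) (simp add: qform_def)
next
  case False
  let ?P = "[:Polynomial.coeff F 0, Polynomial.coeff F 1, Polynomial.coeff F 2:]"
  have "Polynomial.degree ?P > 0" using False by simp
  then obtain z where "poly ?P z = 0" using alg_closed_imp_poly_has_root by blast
  then show ?thesis
    by (intro exI[of _ z] exI[of _ 1]) (simp add: qform_def algebra_simps power2_eq_square)
qed

text \<open>If the forms were linearly dependent, a zero of one of them would be a common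
  zero.\<close>

lemma quad_pair_independent:
  fixes F G :: "'k::alg_closed_field poly"
  assumes "quad_pair F G" "u \<noteq> 0 \<or> v \<noteq> 0"
  shows "Polynomial.smult u F + Polynomial.smult v G \<noteq> 0"
proof
  assume "Polynomial.smult u F + Polynomial.smult v G = 0"
  then have e: "u * qform F x y + v * qform G x y = 0" for x y
    by (metis qform_add qform_smult mult_zero_left smult_0_left)
  obtain x y where 1: "x \<noteq> 0 \<or> y \<noteq> 0" "qform (if u = 0 then F else G) x y = 0"
    using qform_has_zero by metis
  then have "qform F x y = 0 \<and> qform G x y = 0" using e[of x y] assms(2) by (auto split: if_splits)
  then show False using 1 assms unfolding quad_pair_def by blast
qed

lemma quad_pair_nonzero:
  fixes F G :: "'k::alg_closed_field poly"
  assumes "quad_pair F G" shows "F \<noteq> 0" "G \<noteq> 0"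
  using quad_pair_independent[OF assms, of 1 0] quad_pair_independent[OF assms, of 0 1] by auto

lemma quad_pair_smult: "k \<noteq> 0 \<Longrightarrow> quad_pair (Polynomial.smult k F) (Polynomial.smult k G) \<longleftrightarrow> quad_pair F G"
  for k :: "'k::field"
  by (auto simp: quad_pair_def)

lemma rat_num_den:
  "f = Fraction_Field.Fract (rat_num f) (rat_den f)" "coprime (rat_num f) (rat_den f)" "rat_den f \<noteq> 0"
proof -
  show "f = Fraction_Field.Fract (rat_num f) (rat_den f)"
    by (metis quot_to_fract_def quot_to_fract_quot_of_fract prod.collapse case_prod_conv)
  show "coprime (rat_num f) (rat_den f)" by (rule coprime_quot_of_fract)
qed simp

lemma rat_num_den_Fract:
  fixes F G :: "'k::{alg_closed_field, field_gcd} poly"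
  assumes "quad_pair F G"
  obtains k where "k \<noteq> 0" "rat_num (Fraction_Field.Fract F G) = Polynomial.smult k F"
    "rat_den (Fraction_Field.Fract F G) = Polynomial.smult k G"
proof -
  have G: "G \<noteq> 0" using quad_pair_nonzero[OF assms] by simp
  have c: "coprime F G" using quad_pair_coprime assms G by blast
  have "quot_of_fract (Fraction_Field.Fract F G) = normalize_quot (F, G)"
    using quot_of_fract_quot_to_fract[of "(F, G)"] by (simp add: quot_to_fract_def)
  then obtain H where H: "F = rat_num (Fraction_Field.Fract F G) * H"
    "G = rat_den (Fraction_Field.Fract F G) * H" "H \<noteq> 0"
    using normalize_quotE[OF G, of F] by (metis)
  then have "H dvd F" "H dvd G" by (metis dvd_triv_right)+
  then have "is_unit H" using c by (rule coprime_common_divisor[rotated 1])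
  then have "Polynomial.degree H = 0" using H(3) by (simp add: is_unit_iff_degree)
  then obtain h where h: "H = [:h:]" "h \<noteq> 0" using H(3) by (metis degree_eq_zeroE pCons_0_0)
  show ?thesis
  proof (rule that[of "inverse h"])
    show "rat_num (Fraction_Field.Fract F G) = Polynomial.smult (inverse h) F"
      by (subst (2) H(1)) (simp add: h)
    show "rat_den (Fraction_Field.Fract F G) = Polynomial.smult (inverse h) G"
      by (subst (2) H(2)) (simp add: h)
  qed (use h in auto)
qed

lemma Rat2_quad_pair:
  fixes f :: "'k::{alg_closed_field, field_gcd} poly fract"
  assumes "f \<in> Rat2"
  shows "quad_pair (rat_num f) (rat_den f)"
proof -
  let ?F = "rat_num f" and ?G = "rat_den f"
  have d: "max (Polynomial.degree ?F) (Polynomial.degree ?G) = 2"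
    using assms by (simp add: Rat2_def rat_degree_def)
  then have F: "Polynomial.degree ?F \<le> 2" and G: "Polynomial.degree ?G \<le> 2" by linarith+
  have "x = 0 \<and> y = 0" if z: "qform ?F x y = 0" "qform ?G x y = 0" for x y
  proof -
    have "y = 0"
    proof (rule ccontr)
      assume y: "y \<noteq> 0"
      then have "poly ?F (x / y) = 0" "poly ?G (x / y) = 0" using z F G by (simp_all add: poly_eq_qform')
      then have "[:-(x / y), 1:] dvd ?F" "[:-(x / y), 1:] dvd ?G" by (simp_all only: poly_eq_0_iff_dvd)
      then have "is_unit [:-(x / y), 1:]" using rat_num_den(2) by (rule coprime_common_divisor[rotated 1])
      then show False by (simp add: is_unit_iff_degree)
    qed
    moreover have "x = 0"
    proof (rule ccontr)
      assume "x \<noteq> 0"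
      with z \<open>y = 0\<close> have c: "Polynomial.coeff ?F 2 = 0" "Polynomial.coeff ?G 2 = 0" by (auto simp: qform_def)
      from d have "Polynomial.degree ?F = 2 \<or> Polynomial.degree ?G = 2" by linarith
      then show False using c by (metis leading_coeff_0_iff degree_0 zero_neq_numeral)
    qed
    ultimately show ?thesis by blast
  qed
  then show ?thesis using F G unfolding quad_pair_def by blast
qed

lemma quad_pair_Rat2:
  fixes F G :: "'k::{alg_closed_field, field_gcd} poly"
  assumes "quad_pair F G"
  shows "Fraction_Field.Fract F G \<in> Rat2"
proof -
  obtain k where k: "k \<noteq> 0" "rat_num (Fraction_Field.Fract F G) = Polynomial.smult k F"
    "rat_den (Fraction_Field.Fract F G) = Polynomial.smult k G"
    using rat_num_den_Fract[OF assms] .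
  have "max (Polynomial.degree F) (Polynomial.degree G) = 2"
  proof (rule ccontr)
    assume "max (Polynomial.degree F) (Polynomial.degree G) \<noteq> 2"
    then have "Polynomial.degree F < 2" "Polynomial.degree G < 2" using assms unfolding quad_pair_def by linarith+
    then have "qform F 1 0 = 0" "qform G 1 0 = 0" by (simp_all add: qform_def coeff_eq_0)
    then show False using assms unfolding quad_pair_def by (metis zero_neq_one)
  qed
  then show ?thesis using k(1) by (simp add: Rat2_def rat_degree_def k(2,3))
qed

lemma Rat2E:
  fixes f :: "'k::{alg_closed_field, field_gcd} poly fract"
  assumes "f \<in> Rat2"
  obtains F G where "f = Fraction_Field.Fract F G" "quad_pair F G"
  using Rat2_quad_pair[OF assms] rat_num_den(1)[of f] by blast

lemma nonconstant_quad_pair: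
  fixes F G :: "'k::{alg_closed_field, field_gcd} poly"
  assumes "quad_pair F G"
  shows "nonconstant (Fraction_Field.Fract F G)"
  unfolding nonconstant_def cst_def
proof (intro allI notI)
  fix c assume "Fraction_Field.Fract F G = Fraction_Field.Fract [:c:] 1"
  then have "F * 1 = [:c:] * G" using Fract_eq_iff quad_pair_nonzero(2)[OF assms] one_neq_zero by blast
  then show False using quad_pair_independent[OF assms, of 1 "-c"] by simp
qed

lemma nonconstant_Rat2: "f \<in> Rat2 \<Longrightarrow> nonconstant f"
  for f :: "'k::{alg_closed_field, field_gcd} poly fract"
  by (erule Rat2E) (simp add: nonconstant_quad_pair)

lemma Fract_quad_pair_eqD:
  fixes F G :: "'k::{alg_closed_field, field_gcd} poly"
  assumes "quad_pair F G" "quad_pair F' G'" "Fraction_Field.Fract F G = Fraction_Field.Fract F' G'"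
  obtains k where "k \<noteq> 0" "F' = Polynomial.smult k F" "G' = Polynomial.smult k G"
proof -
  obtain k where k: "k \<noteq> 0" "rat_num (Fraction_Field.Fract F G) = Polynomial.smult k F"
    "rat_den (Fraction_Field.Fract F G) = Polynomial.smult k G" using rat_num_den_Fract[OF assms(1)] .
  obtain l where l: "l \<noteq> 0" "rat_num (Fraction_Field.Fract F' G') = Polynomial.smult l F'"
    "rat_den (Fraction_Field.Fract F' G') = Polynomial.smult l G'" using rat_num_den_Fract[OF assms(2)] .
  have "Polynomial.smult k F = Polynomial.smult l F'" "Polynomial.smult k G = Polynomial.smult l G'"
    using k l assms(3) by auto
  then have "Polynomial.smult (inverse l) (Polynomial.smult k F) = Polynomial.smult (inverse l) (Polynomial.smult l F')"
     "Polynomial.smult (inverse l) (Polynomial.smult k G) = Polynomial.smult (inverse l) (Polynomial.smult l G')" by simp_all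
  then show ?thesis using k(1) l(1) by (intro that[of "inverse l * k"]) simp_all
qed

section \<open>Conjugation of pairs of forms\<close>

definition qsub :: "'k::comm_ring_1 \<Rightarrow> 'k \<Rightarrow> 'k \<Rightarrow> 'k \<Rightarrow> 'k poly \<Rightarrow> 'k poly" where
  "qsub a b c d F = [:qform F b d,
     2 * Polynomial.coeff F 2 * a * b + Polynomial.coeff F 1 * (a * d + b * c) + 2 * Polynomial.coeff F 0 * c * d,
     qform F a c:]"

text \<open>The adjugate matrix is used for the inverse, to which it is proportional.\<close>

definition conj_num :: "'k::comm_ring_1 \<Rightarrow> 'k \<Rightarrow> 'k \<Rightarrow> 'k \<Rightarrow> 'k poly \<Rightarrow> 'k poly \<Rightarrow> 'k poly" where
  "conj_num a b c d F G = Polynomial.smult d (qsub a b c d F) - Polynomial.smult b (qsub a b c d G)"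

definition conj_den :: "'k::comm_ring_1 \<Rightarrow> 'k \<Rightarrow> 'k \<Rightarrow> 'k \<Rightarrow> 'k poly \<Rightarrow> 'k poly \<Rightarrow> 'k poly" where
  "conj_den a b c d F G = Polynomial.smult a (qsub a b c d G) - Polynomial.smult c (qsub a b c d F)"

lemma qform_qsub [simp]: "qform (qsub a b c d F) x y = qform F (a * x + b * y) (c * x + d * y)"
  by (simp add: qsub_def qform_def[of F] algebra_simps power2_eq_square)

lemma degree_qsub: "Polynomial.degree (qsub a b c d F) \<le> 2"
  unfolding qsub_def by (rule degree_quad_le)

lemma degree_conj: "Polynomial.degree (conj_num a b c d F G) \<le> 2" "Polynomial.degree (conj_den a b c d F G) \<le> 2"
  unfolding conj_num_def conj_den_def
  by (intro degree_diff_le order.trans[OF degree_smult_le degree_qsub])+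

lemma adjugate_zero:
  fixes a :: "'k::field"
  assumes "a * d - b * c \<noteq> 0" "a * x + b * y = 0" "c * x + d * y = 0"
  shows "x = 0 \<and> y = 0"
proof -
  have "(a * d - b * c) * x = d * (a * x + b * y) - b * (c * x + d * y)"
    "(a * d - b * c) * y = a * (c * x + d * y) - c * (a * x + b * y)" by (simp_all add: algebra_simps)
  then have "(a * d - b * c) * x = 0" "(a * d - b * c) * y = 0" using assms(2,3) by simp_all
  then show ?thesis using assms(1) by (simp add: mult_eq_0_iff)
qed

lemma quad_pair_conj:
  assumes "quad_pair F G" "a * d - b * c \<noteq> 0"
  shows "quad_pair (conj_num a b c d F G) (conj_den a b c d F G)"
  unfolding quad_pair_def
proof (intro conjI allI impI degree_conj)
  fix x y
  let ?X = "a * x + b * y" and ?Y = "c * x + d * y"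
  assume z: "qform (conj_num a b c d F G) x y = 0" "qform (conj_den a b c d F G) x y = 0"
  have "qform F ?X ?Y = 0 \<and> qform G ?X ?Y = 0"
    using z by (intro adjugate_zero[of d a "-b" "-c"]) (use assms(2) in \<open>simp_all add: conj_num_def conj_den_def algebra_simps\<close>)
  then have "?X = 0 \<and> ?Y = 0" using assms(1) unfolding quad_pair_def by blast
  then have "x = 0 \<and> y = 0" using adjugate_zero assms(2) by blast
  then show "x = 0" "y = 0" by auto
qed

lemma peval_quad: "Polynomial.degree F \<le> 2 \<Longrightarrow>
   peval F s = cst (Polynomial.coeff F 2) * s^2 + cst (Polynomial.coeff F 1) * s + cst (Polynomial.coeff F 0)"
  by (erule quadratic_cases) (simp add: algebra_simps power2_eq_square numeral_2_eq_2)

lemma rat_conj_Fract: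
  fixes F G :: "'k::{alg_closed_field, field_gcd} poly"
  assumes q: "quad_pair F G" and D: "a * d - b * c \<noteq> 0"
  shows "rat_conj (Fraction_Field.Fract F G) (mob a b c d) =
    Fraction_Field.Fract (conj_num a b c d F G) (conj_den a b c d F G)"
proof -
  let ?F = "conj_num a b c d F G" and ?G = "conj_den a b c d F G"
  let ?m = "mob a b c d" and ?L = "cst c * idz + cst d"
  have q': "quad_pair ?F ?G" using quad_pair_conj[OF q D] .
  have L: "?L \<noteq> 0" using D by (intro linear_idz_neq_0) auto
  have G: "G \<noteq> 0" "?G \<noteq> 0" using quad_pair_nonzero q q' by auto
  have ev: "peval H ?m = peval (qsub a b c d H) idz / ?L^2" if "Polynomial.degree H \<le> 2" for H
  proof -
    let ?N = "cst a * idz + cst b"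
    have "peval H ?m = (cst (Polynomial.coeff H 2) * ?N^2 + cst (Polynomial.coeff H 1) * ?N * ?L + cst (Polynomial.coeff H 0) * ?L^2) / ?L^2"
    proof -
      have "h2 * (N / L)^2 + h1 * (N / L) + h0 = (h2 * N^2 + h1 * N * L + h0 * L^2) / L^2"
        if "L \<noteq> 0" for h0 h1 h2 N L :: "'k poly fract"
        using that by (simp add: field_simps power2_eq_square)
      from this[OF L] show ?thesis unfolding peval_quad[OF that] mob_eq .
    qed
    also have "cst (Polynomial.coeff H 2) * ?N^2 + cst (Polynomial.coeff H 1) * ?N * ?L + cst (Polynomial.coeff H 0) * ?L^2
      = peval (qsub a b c d H) idz"
      by (simp add: qsub_def qform_def algebra_simps power2_eq_square del: One_nat_def)
    finally show ?thesis .
  qed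
  have sG: "qsub a b c d G \<noteq> 0"
  proof
    assume "qsub a b c d G = 0"
    then have "peval G ?m = 0" using ev q by (simp add: quad_pair_def)
    then show False using G(1) peval_eq_0_iff nonconstant_mob[OF D] by blast
  qed
  let ?sF = "peval (qsub a b c d F) idz" and ?sG = "peval (qsub a b c d G) idz"
  have "rat_comp (Fraction_Field.Fract F G) ?m = ?sF / ?sG"
    using L q by (simp add: rat_comp_Fract nonconstant_mob[OF D] G ev quad_pair_def)
  moreover have "rat_comp ?m (Fraction_Field.Fract ?F ?G) = ?sF / ?sG"
  proof -
    have pF: "peval ?F idz = cst d * ?sF - cst b * ?sG" and pG: "peval ?G idz = cst a * ?sG - cst c * ?sF"
      by (simp_all add: conj_num_def conj_den_def)
    have nz: "peval ?G idz \<noteq> 0" using G by simp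
    have "cst a * peval ?F idz + cst b * peval ?G idz = cst (a * d - b * c) * ?sF"
      "cst c * peval ?F idz + cst d * peval ?G idz = cst (a * d - b * c) * ?sG"
      unfolding pF pG by (simp_all add: algebra_simps)
    moreover have "rat_comp ?m (Fraction_Field.Fract ?F ?G) =
      (cst a * peval ?F idz + cst b * peval ?G idz) / (cst c * peval ?F idz + cst d * peval ?G idz)"
    proof -
      have "(x * (N / M) + y) / (u * (N / M) + v) = (x * N + y * M) / (u * N + v * M)"
        if "M \<noteq> 0" for x y u v N M :: "'k poly fract"
      proof -
        have "x * (N / M) + y = (x * N + y * M) / M" "u * (N / M) + v = (u * N + v * M) / M"
          using that by (simp_all add: field_simps)
        then show ?thesis using that by simp
      qed
      from this[OF nz] show ?thesis
        by (subst rat_comp_mob[OF nonconstant_quad_pair[OF q']]) (simp only: Fract_eq_peval)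
    qed
    moreover have "cst (a * d - b * c) \<noteq> 0" using D cst_eq_0_iff by blast
    ultimately show ?thesis by (simp del: cst_hom)
  qed
  ultimately show ?thesis
    by (subst rat_conj_eq_iff) (simp_all add: nonconstant_quad_pair q q' mob_in_PGL2[OF D])
qed

lemma rat_conj_Rat2:
  fixes f :: "'k::{alg_closed_field, field_gcd} poly fract"
  assumes "f \<in> Rat2" "\<alpha> \<in> carrier PGL2"
  shows "rat_conj f \<alpha> \<in> Rat2"
  using assms by (elim Rat2E PGL2E) (simp add: rat_conj_Fract quad_pair_Rat2 quad_pair_conj)

section \<open>Multipliers of fixed points\<close>

text \<open>The factor \<open>k\<close> between a fixed vector and its image is linear in the vector while the
  Wronskian is quadratic, so \<open>l\<close> depends on the point only. For \<open>y = 1\<close> it is the derivative of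
  \<open>F/G\<close> by the quotient rule; at infinity no separate formula is needed.\<close>

definition is_mult :: "'k::field poly \<Rightarrow> 'k poly \<Rightarrow> 'k \<Rightarrow> 'k \<Rightarrow> 'k \<Rightarrow> bool" where
  "is_mult F G x y l \<longleftrightarrow> (x \<noteq> 0 \<or> y \<noteq> 0) \<and>
     (\<exists>k. k \<noteq> 0 \<and> qform F x y = k * x \<and> qform G x y = k * y \<and> wronskian F G x y = l * k^2)"

lemma is_mult_unique:
  assumes "is_mult F G x y l" "is_mult F G x y l'" shows "l = l'"
proof -
  obtain k where k: "k \<noteq> 0" "qform F x y = k * x" "qform G x y = k * y" "wronskian F G x y = l * k^2"
    and xy: "x \<noteq> 0 \<or> y \<noteq> 0" using assms unfolding is_mult_def by blast
  obtain k' where k': "k' \<noteq> 0" "qform F x y = k' * x" "qform G x y = k' * y" "wronskian F G x y = l' * k'^2"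
    using assms unfolding is_mult_def by blast
  have "k = k'" using k k' xy by auto
  then show ?thesis using k k' by simp
qed

lemma is_mult_scale:
  assumes "is_mult F G x y l" "s \<noteq> 0" shows "is_mult F G (s * x) (s * y) l"
proof -
  obtain k where k: "k \<noteq> 0" "qform F x y = k * x" "qform G x y = k * y" "wronskian F G x y = l * k^2"
    and xy: "x \<noteq> 0 \<or> y \<noteq> 0" using assms unfolding is_mult_def by blast
  then show ?thesis unfolding is_mult_def using assms(2)
    by (intro conjI exI[of _ "s * k"]) (simp_all add: qform_scale wronskian_scale power2_eq_square)
qed

lemma wronskian_smult [simp]:
  "wronskian (Polynomial.smult u F) (Polynomial.smult v G) x y = u * v * wronskian F G x y"
  by (simp add: wronskian_def algebra_simps)

lemma is_mult_smult:
  assumes "is_mult F G x y l" "s \<noteq> 0"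
  shows "is_mult (Polynomial.smult s F) (Polynomial.smult s G) x y l"
proof -
  obtain k where k: "k \<noteq> 0" "qform F x y = k * x" "qform G x y = k * y" "wronskian F G x y = l * k^2"
    and xy: "x \<noteq> 0 \<or> y \<noteq> 0" using assms unfolding is_mult_def by blast
  then show ?thesis unfolding is_mult_def using assms(2)
    by (intro conjI exI[of _ "s * k"]) (simp_all add: power2_eq_square)
qed

lemma is_mult_exists:
  assumes q: "quad_pair F G" and xy: "x \<noteq> 0 \<or> y \<noteq> 0" and fixd: "x * qform G x y = y * qform F x y"
  shows "\<exists>l. is_mult F G x y l"
proof -
  obtain k where k: "qform F x y = k * x" "qform G x y = k * y"
  proof (cases "y = 0")
    case True
    then show ?thesis using that[of "qform F x y / x"] xy fixd by (auto simp: field_simps)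
  next
    case False
    then show ?thesis using that[of "qform G x y / y"] fixd by (auto simp: field_simps)
  qed
  have "k \<noteq> 0"
  proof
    assume "k = 0"
    then have "qform F x y = 0" "qform G x y = 0" using k by simp_all
    then show False using q xy unfolding quad_pair_def by blast
  qed
  then show ?thesis unfolding is_mult_def using k xy
    by (intro exI[of _ "wronskian F G x y / k^2"] conjI exI[of _ k]) simp_all
qed

text \<open>The chain rule. Together with its counterpart for linear combinations of the forms,
  which is the multiplicativity of \<open>2 \<times> 2\<close> determinants, it gives the invariance of
  multipliers.\<close>

lemma wronskian_qsub:
  "wronskian (qsub a b c d F) (qsub a b c d G) x y =
    (a * d - b * c) * wronskian F G (a * x + b * y) (c * x + d * y)"
proof -
  define f0 f1 f2 g0 g1 g2 where "f0 = Polynomial.coeff F 0" "f1 = Polynomial.coeff F 1" "f2 = Polynomial.coeff F 2"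
    "g0 = Polynomial.coeff G 0" "g1 = Polynomial.coeff G 1" "g2 = Polynomial.coeff G 2"
  show ?thesis
    by (simp add: qsub_def qform_def wronskian_def[of F] f0_f1_f2_g0_g1_g2_def[symmetric] algebra_simps power2_eq_square)
qed

lemma wronskian_conj:
  "wronskian (conj_num a b c d F G) (conj_den a b c d F G) x y =
    (a * d - b * c)^2 * wronskian F G (a * x + b * y) (c * x + d * y)"
proof -
  have "wronskian (Polynomial.smult d P - Polynomial.smult b Q) (Polynomial.smult a Q - Polynomial.smult c P) x y
    = (a * d - b * c) * wronskian P Q x y" for P Q
    by (simp add: wronskian_def algebra_simps)
  then show ?thesis unfolding conj_num_def conj_den_def by (simp add: wronskian_qsub power2_eq_square)
qed

lemma is_mult_conj:
  assumes m: "is_mult F G (a * x + b * y) (c * x + d * y) l" and D: "a * d - b * c \<noteq> 0"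
  shows "is_mult (conj_num a b c d F G) (conj_den a b c d F G) x y l"
proof -
  let ?X = "a * x + b * y" and ?Y = "c * x + d * y"
  obtain k where k: "k \<noteq> 0" "qform F ?X ?Y = k * ?X" "qform G ?X ?Y = k * ?Y" "wronskian F G ?X ?Y = l * k^2"
    and xy: "?X \<noteq> 0 \<or> ?Y \<noteq> 0" using m unfolding is_mult_def by blast
  have "x \<noteq> 0 \<or> y \<noteq> 0" using xy by auto
  moreover have "qform (conj_num a b c d F G) x y = ((a * d - b * c) * k) * x"
    "qform (conj_den a b c d F G) x y = ((a * d - b * c) * k) * y"
    by (simp_all add: conj_num_def conj_den_def k) (simp_all add: algebra_simps)
  moreover have "wronskian (conj_num a b c d F G) (conj_den a b c d F G) x y = l * ((a * d - b * c) * k)^2"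
    by (simp add: wronskian_conj k power_mult_distrib)
  moreover have "(a * d - b * c) * k \<noteq> 0" using k D by simp
  ultimately show ?thesis unfolding is_mult_def by blast
qed

lemma is_mult_conj_inverse:
  assumes m: "is_mult F G x y l" and D: "a * d - b * c \<noteq> 0"
  shows "is_mult (conj_num a b c d F G) (conj_den a b c d F G) (d * x - b * y) (a * y - c * x) l"
proof (rule is_mult_conj[OF _ D])
  have "a * (d * x - b * y) + b * (a * y - c * x) = (a * d - b * c) * x"
    "c * (d * x - b * y) + d * (a * y - c * x) = (a * d - b * c) * y"
    by (simp_all add: algebra_simps)
  then show "is_mult F G (a * (d * x - b * y) + b * (a * y - c * x)) (c * (d * x - b * y) + d * (a * y - c * x)) l"
    using is_mult_scale[OF m D] by simp
qed

text \<open>Listing the fixed points as the linear factors of the cubic form \<open>x G - y F\<close> accounts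
  for multiplicities and for infinity.\<close>

definition fixed_points :: "'k::field poly \<Rightarrow> 'k poly \<Rightarrow> ('k \<times> 'k \<times> 'k) \<Rightarrow> ('k \<times> 'k \<times> 'k) \<Rightarrow> ('k \<times> 'k \<times> 'k) \<Rightarrow> bool" where
  "fixed_points F G = (\<lambda>(x1, y1, l1) (x2, y2, l2) (x3, y3, l3).
     is_mult F G x1 y1 l1 \<and> is_mult F G x2 y2 l2 \<and> is_mult F G x3 y3 l3 \<and>
     (\<exists>c. c \<noteq> 0 \<and> (\<forall>x y. x * qform G x y - y * qform F x y =
        c * ((y1 * x - x1 * y) * (y2 * x - x2 * y) * (y3 * x - x3 * y)))))"

lemma fixed_pointsE:
  assumes "fixed_points F G (x1, y1, l1) (x2, y2, l2) (x3, y3, l3)"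
  obtains c where "is_mult F G x1 y1 l1" "is_mult F G x2 y2 l2" "is_mult F G x3 y3 l3" "c \<noteq> 0"
    "\<forall>x y. x * qform G x y - y * qform F x y = c * ((y1 * x - x1 * y) * (y2 * x - x2 * y) * (y3 * x - x3 * y))"
  using assms unfolding fixed_points_def split by (elim conjE exE)

lemma fixed_pointsI:
  assumes "is_mult F G x1 y1 l1" "is_mult F G x2 y2 l2" "is_mult F G x3 y3 l3" "c \<noteq> 0"
    "\<And>x y. x * qform G x y - y * qform F x y = c * ((y1 * x - x1 * y) * (y2 * x - x2 * y) * (y3 * x - x3 * y))"
  shows "fixed_points F G (x1, y1, l1) (x2, y2, l2) (x3, y3, l3)"
  unfolding fixed_points_def split by (intro conjI exI[of _ c] allI assms)

lemma fixed_points_conj: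
  assumes m: "fixed_points F G (x1, y1, l1) (x2, y2, l2) (x3, y3, l3)" and D: "a * d - b * c \<noteq> 0"
  shows "fixed_points (conj_num a b c d F G) (conj_den a b c d F G)
    (d * x1 - b * y1, a * y1 - c * x1, l1) (d * x2 - b * y2, a * y2 - c * x2, l2) (d * x3 - b * y3, a * y3 - c * x3, l3)"
proof -
  note im = is_mult_conj_inverse[OF _ D]
  obtain k where m': "is_mult F G x1 y1 l1" "is_mult F G x2 y2 l2" "is_mult F G x3 y3 l3" and k: "k \<noteq> 0"
    "\<forall>x y. x * qform G x y - y * qform F x y = k * ((y1 * x - x1 * y) * (y2 * x - x2 * y) * (y3 * x - x3 * y))"
    using fixed_pointsE[OF m] .
  have "x * qform (conj_den a b c d F G) x y - y * qform (conj_num a b c d F G) x y =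
     k * (((a * y1 - c * x1) * x - (d * x1 - b * y1) * y) * ((a * y2 - c * x2) * x - (d * x2 - b * y2) * y) *
       ((a * y3 - c * x3) * x - (d * x3 - b * y3) * y))" for x y
  proof -
    let ?X = "a * x + b * y" and ?Y = "c * x + d * y"
    have e: "(a * v - c * u) * x - (d * u - b * v) * y = v * ?X - u * ?Y" for u v by (simp add: algebra_simps)
    have "x * qform (conj_den a b c d F G) x y - y * qform (conj_num a b c d F G) x y = ?X * qform G ?X ?Y - ?Y * qform F ?X ?Y"
      by (simp add: conj_num_def conj_den_def algebra_simps)
    then show ?thesis unfolding e k(2)[rule_format] .
  qed
  then show ?thesis by (rule fixed_pointsI[OF im[OF m'(1)] im[OF m'(2)] im[OF m'(3)] k(1)])
qed

text \<open>If \<open>x G = y F\<close>, then both forms are multiples of one linear form and have its zero in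
  common.\<close>

lemma fixed_form_nonzero:
  fixes F G :: "'k::alg_closed_field poly"
  assumes q: "quad_pair F G"
  shows "[:0, 1:] * G - F \<noteq> 0"
proof
  obtain f0 f1 f2 where F: "F = [:f0, f1, f2:]" using q quadratic_cases unfolding quad_pair_def by blast
  obtain g0 g1 g2 where G: "G = [:g0, g1, g2:]" using q quadratic_cases unfolding quad_pair_def by blast
  assume "[:0, 1:] * G - F = 0"
  then have *: "f0 = 0" "f1 = g0" "f2 = g1" "g2 = 0" by (auto simp: F G)
  have qF: "qform F x y = g1 * x^2 + g0 * x * y" and qG: "qform G x y = g1 * x * y + g0 * y^2" for x y
    unfolding F G qform_quad by (simp_all add: *)
  have "qform F (-g0) g1 = 0 \<and> qform G (-g0) g1 = 0" by (simp add: qF qG power2_eq_square algebra_simps)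
  then have "g0 = 0 \<and> g1 = 0" using q unfolding quad_pair_def by (metis neg_equal_0_iff_equal)
  then have "qform F 1 0 = 0 \<and> qform G 1 0 = 0" by (simp add: qF qG)
  then show False using q unfolding quad_pair_def by (metis zero_neq_one)
qed

lemma split_linear_factor:
  fixes P :: "'k::alg_closed_field poly"
  assumes "P \<noteq> 0" "Polynomial.degree P \<le> Suc n"
  shows "\<exists>x y Q. (x \<noteq> 0 \<or> y \<noteq> 0) \<and> P = [:-x, y:] * Q \<and> Q \<noteq> 0 \<and> Polynomial.degree Q \<le> n"
proof (cases "Polynomial.degree P = 0")
  case True
  then show ?thesis using assms(1) by (intro exI[of _ "-1"] exI[of _ 0] exI[of _ P]) simp
next
  case False
  then obtain r where "poly P r = 0" using alg_closed_imp_poly_has_root by blast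
  then obtain Q where Q: "P = [:-r, 1:] * Q" by (auto simp: poly_eq_0_iff_dvd elim: dvdE)
  then have "Q \<noteq> 0" using assms by auto
  moreover have "Polynomial.degree P = Suc (Polynomial.degree Q)"
    unfolding Q using \<open>Q \<noteq> 0\<close> by (subst degree_mult_eq) auto
  ultimately show ?thesis using Q assms(2) by (intro exI[of _ r] exI[of _ 1] exI[of _ Q]) simp
qed

lemma cubic_splits:
  fixes P :: "'k::alg_closed_field poly"
  assumes "P \<noteq> 0" "Polynomial.degree P \<le> 3"
  obtains c x1 y1 x2 y2 x3 y3 where "c \<noteq> 0" "x1 \<noteq> 0 \<or> y1 \<noteq> 0" "x2 \<noteq> 0 \<or> y2 \<noteq> 0" "x3 \<noteq> 0 \<or> y3 \<noteq> 0"
    "P = Polynomial.smult c ([:-x1, y1:] * [:-x2, y2:] * [:-x3, y3:])"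
proof -
  obtain x1 y1 Q where 1: "x1 \<noteq> 0 \<or> y1 \<noteq> 0" "P = [:-x1, y1:] * Q" "Q \<noteq> 0" "Polynomial.degree Q \<le> 2"
    using split_linear_factor[of P 2] assms by auto
  obtain x2 y2 R where 2: "x2 \<noteq> 0 \<or> y2 \<noteq> 0" "Q = [:-x2, y2:] * R" "R \<noteq> 0" "Polynomial.degree R \<le> 1"
    using split_linear_factor[of Q 1] 1 by (auto simp: numeral_2_eq_2)
  obtain x3 y3 S where 3: "x3 \<noteq> 0 \<or> y3 \<noteq> 0" "R = [:-x3, y3:] * S" "S \<noteq> 0" "Polynomial.degree S \<le> 0"
    using split_linear_factor[of R 0] 2 by (auto simp: numeral_2_eq_2)
  obtain c where c: "S = [:c:]" using 3(4) by (metis degree_eq_zeroE le_zero_eq)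
  have "P = Polynomial.smult c ([:-x1, y1:] * [:-x2, y2:] * [:-x3, y3:])"
    unfolding 1(2) 2(2) 3(2) c by (simp add: algebra_simps)
  then show ?thesis using 1 2 3 c that[of c] by auto
qed

lemma cubic_form_eq_iff:
  fixes F G :: "'k::alg_closed_field poly"
  assumes q: "Polynomial.degree F \<le> 2" "Polynomial.degree G \<le> 2"
  shows "(\<forall>x y. x * qform G x y - y * qform F x y =
        c * ((y1 * x - x1 * y) * (y2 * x - x2 * y) * (y3 * x - x3 * y))) \<longleftrightarrow>
    [:0, 1:] * G - F = Polynomial.smult c ([:-x1, y1:] * [:-x2, y2:] * [:-x3, y3:])" (is "?L \<longleftrightarrow> ?R")
proof
  assume L: ?L
  show ?R
  proof (rule poly_eqI_values)
    fix z
    show "poly ([:0, 1:] * G - F) z = poly (Polynomial.smult c ([:-x1, y1:] * [:-x2, y2:] * [:-x3, y3:])) z"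
      using L[rule_format, of z 1] poly_eq_qform[OF q(1), of z] poly_eq_qform[OF q(2), of z]
      by (simp add: algebra_simps)
  qed
next
  assume R: ?R
  obtain f0 f1 f2 where F: "F = [:f0, f1, f2:]" using quadratic_cases[OF q(1)] .
  obtain g0 g1 g2 where G: "G = [:g0, g1, g2:]" using quadratic_cases[OF q(2)] .
  have e: "f0 = c * (x1 * x2 * x3)" "g0 - f1 = c * (y1 * x2 * x3 + x1 * y2 * x3 + x1 * x2 * y3)"
    "g1 - f2 = - c * (x1 * y2 * y3 + y1 * x2 * y3 + y1 * y2 * x3)" "g2 = c * (y1 * y2 * y3)"
    using R by (auto simp: F G algebra_simps)
  have "x * qform G x y - y * qform F x y = g2 * x^3 + (g1 - f2) * x^2 * y + (g0 - f1) * x * y^2 - f0 * y^3" for x y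
    by (simp add: F G algebra_simps power2_eq_square power3_eq_cube)
  then show ?L by (simp add: e algebra_simps power2_eq_square power3_eq_cube)
qed

lemma fixed_points_exist:
  fixes F G :: "'k::alg_closed_field poly"
  assumes q: "quad_pair F G"
  obtains P1 P2 P3 where "fixed_points F G P1 P2 P3"
proof -
  have d: "Polynomial.degree F \<le> 2" "Polynomial.degree G \<le> 2" using q unfolding quad_pair_def by auto
  have "Polynomial.degree ([:0, 1:] * G - F) \<le> 3"
    by (rule degree_diff_le) (use d in \<open>auto intro: order.trans[OF degree_mult_le]\<close>)
  then obtain c x1 y1 x2 y2 x3 y3 where nz: "c \<noteq> 0" "x1 \<noteq> 0 \<or> y1 \<noteq> 0" "x2 \<noteq> 0 \<or> y2 \<noteq> 0" "x3 \<noteq> 0 \<or> y3 \<noteq> 0"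
    and P: "[:0, 1:] * G - F = Polynomial.smult c ([:-x1, y1:] * [:-x2, y2:] * [:-x3, y3:])"
    using cubic_splits[OF fixed_form_nonzero[OF q]] by metis
  have fm: "x * qform G x y - y * qform F x y = c * ((y1 * x - x1 * y) * (y2 * x - x2 * y) * (y3 * x - x3 * y))" for x y
    using P cubic_form_eq_iff[OF d] by blast
  obtain l1 where "is_mult F G x1 y1 l1" using is_mult_exists[OF q nz(2)] fm[of x1 y1] by (auto simp: mult.commute)
  moreover obtain l2 where "is_mult F G x2 y2 l2" using is_mult_exists[OF q nz(3)] fm[of x2 y2] by (auto simp: mult.commute)
  moreover obtain l3 where "is_mult F G x3 y3 l3" using is_mult_exists[OF q nz(4)] fm[of x3 y3] by (auto simp: mult.commute)
  ultimately have "fixed_points F G (x1, y1, l1) (x2, y2, l2) (x3, y3, l3)"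
    using nz(1) fm by (rule fixed_pointsI)
  then show ?thesis by (rule that)
qed

lemma proots_linear: "(x :: 'k::field) \<noteq> 0 \<or> y \<noteq> 0 \<Longrightarrow> proots [:-x, y:] = (if y = 0 then {#} else {#x / y#})"
proof -
  assume a: "x \<noteq> 0 \<or> y \<noteq> 0"
  show ?thesis
  proof (cases "y = 0")
    case False
    then have "[:-x, y:] = Polynomial.smult y [:-(x / y), 1:]" by simp
    then have "proots [:-x, y:] = proots [:-(x / y), 1:]" using False by (metis proots_smult)
    also have "\<dots> = {#x / y#}" by (subst proots_linear_factor) simp
    finally show ?thesis using False by simp
  qed simp
qed

lemma order_0_linear: "(x :: 'k::field) \<noteq> 0 \<or> y \<noteq> 0 \<Longrightarrow> Polynomial.order 0 [:y, -x:] = (if y = 0 then 1 else 0)"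
proof -
  assume a: "x \<noteq> 0 \<or> y \<noteq> 0"
  show ?thesis
  proof (cases "y = 0")
    case True
    then have "[:y, -x:] = monom (-x) 1" by (simp add: monom_Suc monom_0)
    then show ?thesis using a True order_0_monom[of "-x" 1] by simp
  qed (simp add: order_0I)
qed

lemma proots_order_smult_mult3:
  fixes P Q R :: "'k::field poly"
  assumes "P \<noteq> 0" "Q \<noteq> 0" "R \<noteq> 0" "c \<noteq> 0"
  shows "proots (Polynomial.smult c (P * Q * R)) = proots P + proots Q + proots R"
    and "Polynomial.order a (Polynomial.smult c (P * Q * R)) =
      Polynomial.order a P + Polynomial.order a Q + Polynomial.order a R"
  using assms by (simp_all add: proots_mult order_smult order_mult)

lemma rat_deriv_at_Fract:
  fixes F G :: "'k::{alg_closed_field, field_gcd} poly"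
  assumes "quad_pair F G"
  shows "rat_deriv_at (Fraction_Field.Fract F G) z = wronskian F G z 1 / (qform G z 1)^2"
proof -
  obtain k where k: "k \<noteq> 0" "rat_num (Fraction_Field.Fract F G) = Polynomial.smult k F"
    "rat_den (Fraction_Field.Fract F G) = Polynomial.smult k G" using rat_num_den_Fract[OF assms] .
  obtain f0 f1 f2 where F: "F = [:f0, f1, f2:]" using assms quadratic_cases unfolding quad_pair_def by blast
  obtain g0 g1 g2 where G: "G = [:g0, g1, g2:]" using assms quadratic_cases unfolding quad_pair_def by blast
  have "poly (pderiv F * G - F * pderiv G) z = wronskian F G z 1"
    by (simp add: F G pderiv_pCons algebra_simps power2_eq_square)
  moreover have "pderiv (Polynomial.smult k F) * Polynomial.smult k G - Polynomial.smult k F * pderiv (Polynomial.smult k G)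
      = Polynomial.smult (k^2) (pderiv F * G - F * pderiv G)"
    by (simp add: pderiv_smult algebra_simps power2_eq_square smult_diff_right)
  moreover have "poly G z = qform G z 1" using assms by (simp add: poly_eq_qform quad_pair_def)
  ultimately show ?thesis using k(1) by (simp add: rat_deriv_at_def k(2,3) power_mult_distrib)
qed

lemma replicate_mset_add: "replicate_mset (m + n) x = replicate_mset m x + replicate_mset n x"
  by (induction m) simp_all

text \<open>A linear factor of the cubic form belongs to a root of the fixed point polynomial if its
  zero is finite, and to the root \<open>0\<close> of that polynomial for the map conjugated by \<open>1/z\<close> if its zero
  is infinity. So each of the three factors contributes exactly once, with its own
  multiplier.\<close>

lemma fixed_multipliers_eq:
  fixes F G :: "'k::{alg_closed_field, field_gcd} poly"
  assumes q: "quad_pair F G" and m: "fixed_points F G (x1, y1, l1) (x2, y2, l2) (x3, y3, l3)"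
  shows "fixed_multipliers (Fraction_Field.Fract F G) = {#l1, l2, l3#}"
proof -
  let ?f = "Fraction_Field.Fract F G"
  have d: "Polynomial.degree F \<le> 2" "Polynomial.degree G \<le> 2" using q unfolding quad_pair_def by auto
  define F' where "F' = conj_num 0 1 1 0 F G"
  define G' where "G' = conj_den 0 1 1 0 F G"
  have inv: "Fraction_Field.Fract 1 [:0, 1:] = mob 0 1 1 (0 :: 'k)" by (simp add: mob_def one_pCons)
  have f': "rat_conj ?f (Fraction_Field.Fract 1 [:0, 1:]) = Fraction_Field.Fract F' G'"
    unfolding inv F'_def G'_def by (rule rat_conj_Fract[OF q]) simp
  have q': "quad_pair F' G'" unfolding F'_def G'_def by (rule quad_pair_conj[OF q]) simp
  have d': "Polynomial.degree F' \<le> 2" "Polynomial.degree G' \<le> 2" using q' unfolding quad_pair_def by auto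
  obtain k where k: "k \<noteq> 0" "rat_num ?f = Polynomial.smult k F" "rat_den ?f = Polynomial.smult k G"
    using rat_num_den_Fract[OF q] .
  obtain k' where k': "k' \<noteq> 0" "rat_num (Fraction_Field.Fract F' G') = Polynomial.smult k' F'"
    "rat_den (Fraction_Field.Fract F' G') = Polynomial.smult k' G'"
    using rat_num_den_Fract[OF q'] .
  obtain c where c: "c \<noteq> 0" "\<forall>x y. x * qform G x y - y * qform F x y =
        c * ((y1 * x - x1 * y) * (y2 * x - x2 * y) * (y3 * x - x3 * y))"
    and im: "is_mult F G x1 y1 l1" "is_mult F G x2 y2 l2" "is_mult F G x3 y3 l3"
    using fixed_pointsE[OF m] by metis
  have nz: "x1 \<noteq> 0 \<or> y1 \<noteq> 0" "x2 \<noteq> 0 \<or> y2 \<noteq> 0" "x3 \<noteq> 0 \<or> y3 \<noteq> 0" using im unfolding is_mult_def by blast+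
  have P: "[:0, 1:] * G - F = Polynomial.smult c ([:-x1, y1:] * [:-x2, y2:] * [:-x3, y3:])"
    using c(2) cubic_form_eq_iff[OF d] by blast
  have "fixed_points F' G' (- y1, - x1, l1) (- y2, - x2, l2) (- y3, - x3, l3)"
    using fixed_points_conj[OF m, of 0 0 1 1] unfolding F'_def G'_def by simp
  then obtain c' where c': "c' \<noteq> 0" "\<forall>x y. x * qform G' x y - y * qform F' x y =
        c' * (((-x1) * x - (-y1) * y) * ((-x2) * x - (-y2) * y) * ((-x3) * x - (-y3) * y))"
    by (rule fixed_pointsE)
  have P': "[:0, 1:] * G' - F' = Polynomial.smult c' ([:-(-y1), -x1:] * [:-(-y2), -x2:] * [:-(-y3), -x3:])"
    using c'(2) cubic_form_eq_iff[OF d'] by blast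
  have "fixed_poly ?f = Polynomial.smult k ([:0, 1:] * G - F)"
    unfolding fixed_poly_def k by (simp add: smult_diff_right)
  then have pr: "proots (fixed_poly ?f) = proots [:-x1, y1:] + proots [:-x2, y2:] + proots [:-x3, y3:]"
    unfolding P smult_smult using k(1) c(1) nz by (simp only:) (rule proots_order_smult_mult3(1); simp)
  have "fixed_poly (Fraction_Field.Fract F' G') = Polynomial.smult k' ([:0, 1:] * G' - F')"
    unfolding fixed_poly_def k' by (simp add: smult_diff_right)
  then have ord: "Polynomial.order 0 (fixed_poly (Fraction_Field.Fract F' G')) =
    Polynomial.order 0 [:y1, -x1:] + Polynomial.order 0 [:y2, -x2:] + Polynomial.order 0 [:y3, -x3:]"
    unfolding P' smult_smult minus_minus
    by (simp only:) (rule proots_order_smult_mult3(2); use k'(1) c'(1) nz in auto)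
  let ?D = "rat_deriv_at ?f" and ?d = "rat_deriv_at (Fraction_Field.Fract F' G') 0"
  have one: "image_mset ?D (proots [:-x, y:]) + replicate_mset (Polynomial.order 0 [:y, -x:]) ?d = {#l#}"
    if im: "is_mult F G x y l" for x y l
  proof -
    have nz: "x \<noteq> 0 \<or> y \<noteq> 0" using im unfolding is_mult_def by blast
    show ?thesis
    proof (cases "y = 0")
      case False
      obtain k where k: "k \<noteq> 0" "qform G x y = k * y" "wronskian F G x y = l * k^2"
        using im unfolding is_mult_def by blast
      have "wronskian F G x y = y^2 * wronskian F G (x / y) 1" "qform G x y = y^2 * qform G (x / y) 1"
        using wronskian_scale[of F G y "x / y" 1] qform_scale[of G y "x / y" 1] False by simp_all
      then have "wronskian F G (x / y) 1 = l * k^2 / y^2" "qform G (x / y) 1 = k / y"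
        using k False by (simp_all add: field_simps power2_eq_square)
      then have "?D (x / y) = l" unfolding rat_deriv_at_Fract[OF q] using k(1) False by (simp add: power_divide)
      then show ?thesis using False nz by (simp add: proots_linear order_0_linear)
    next
      case True
      with im have "is_mult F G (1 * x) (1 * 0) l" by simp
      from is_mult_scale[OF im, of "1 / x"] have "is_mult F G 1 0 l" using True nz by simp
      then have "is_mult F' G' 0 1 l" unfolding F'_def G'_def by (intro is_mult_conj) simp_all
      then have "?d = l" unfolding rat_deriv_at_Fract[OF q'] is_mult_def by auto
      then show ?thesis using True nz by (simp add: proots_linear order_0_linear)
    qed
  qed
  have "fixed_multipliers ?f = image_mset ?D (proots (fixed_poly ?f)) +
     replicate_mset (Polynomial.order 0 (fixed_poly (Fraction_Field.Fract F' G'))) ?d"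
    unfolding fixed_multipliers_def Let_def f' ..
  also have "\<dots> = (image_mset ?D (proots [:-x1, y1:]) + replicate_mset (Polynomial.order 0 [:y1, -x1:]) ?d) +
     (image_mset ?D (proots [:-x2, y2:]) + replicate_mset (Polynomial.order 0 [:y2, -x2:]) ?d) +
     (image_mset ?D (proots [:-x3, y3:]) + replicate_mset (Polynomial.order 0 [:y3, -x3:]) ?d)"
    unfolding pr ord by (simp add: replicate_mset_add ac_simps)
  also have "\<dots> = {#l1, l2, l3#}" unfolding one[OF im(1)] one[OF im(2)] one[OF im(3)] by simp
  finally show ?thesis .
qed

lemma fixed_sigma_eq:
  assumes "fixed_multipliers f = {#l1, l2, l3#}"
  shows "fixed_sigma f = (l1 + l2 + l3, l1 * l2 + l1 * l3 + l2 * l3)"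
  unfolding fixed_sigma_def
proof (rule the_equality)
  fix s assume "\<exists>k1 k2 k3. fixed_multipliers f = {#k1, k2, k3#} \<and> s = (k1 + k2 + k3, k1 * k2 + k1 * k3 + k2 * k3)"
  then obtain k1 k2 k3 where k: "{#l1, l2, l3#} = {#k1, k2, k3#}" and s: "s = (k1 + k2 + k3, k1 * k2 + k1 * k3 + k2 * k3)"
    using assms by metis
  have "\<Sum>\<^sub># {#l1, l2, l3#} = \<Sum>\<^sub># {#k1, k2, k3#}" using k by (rule arg_cong)
  moreover have "k1 * k2 + k1 * k3 + k2 * k3 = l1 * l2 + l1 * l3 + l2 * l3"
    using k by (auto simp: add_eq_conv_ex add_mset_eq_single algebra_simps)
  ultimately show "s = (l1 + l2 + l3, l1 * l2 + l1 * l3 + l2 * l3)" unfolding s by (simp add: algebra_simps)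
qed (use assms in blast)

lemma fixed_multipliers_rat_conj:
  fixes f :: "'k::{alg_closed_field, field_gcd} poly fract"
  assumes "f \<in> Rat2" "\<alpha> \<in> carrier PGL2"
  shows "fixed_multipliers (rat_conj f \<alpha>) = fixed_multipliers f"
proof -
  obtain F G where f: "f = Fraction_Field.Fract F G" and q: "quad_pair F G" using Rat2E[OF assms(1)] .
  obtain a b c d where D: "a * d - b * c \<noteq> 0" and al: "\<alpha> = mob a b c d" using PGL2E[OF assms(2)] .
  obtain x1 y1 l1 x2 y2 l2 x3 y3 l3 where "fixed_points F G (x1, y1, l1) (x2, y2, l2) (x3, y3, l3)"
    using fixed_points_exist[OF q] by (metis prod_cases3)
  then show ?thesis unfolding f al rat_conj_Fract[OF q D]
    using fixed_multipliers_eq[OF q] fixed_multipliers_eq[OF quad_pair_conj[OF q D]] fixed_points_conj[OF _ D] by metis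
qed

lemma fixed_sigma_rat_conj:
  fixes f :: "'k::{alg_closed_field, field_gcd} poly fract"
  assumes "f \<in> Rat2" "\<alpha> \<in> carrier PGL2"
  shows "fixed_sigma (rat_conj f \<alpha>) = fixed_sigma f"
  unfolding fixed_sigma_def fixed_multipliers_rat_conj[OF assms] ..

section \<open>Normal forms\<close>

lemma qform_linear [simp]: "qform [:g0, g1:] x y = g1 * x * y + g0 * y^2"
  by (simp add: qform_def numeral_2_eq_2)

lemma wronskian_linear [simp]:
  "wronskian [:f0, f1, f2:] [:g0, g1:] x y = f2 * g1 * x^2 + 2 * f2 * g0 * x * y + (f1 * g0 - f0 * g1) * y^2"
  by (simp add: wronskian_def numeral_2_eq_2)

lemma quad_pair_quad_linearI:
  assumes "\<And>x y. f2 * x^2 + f1 * x * y + f0 * y^2 = 0 \<Longrightarrow> g1 * x * y + g0 * y^2 = 0 \<Longrightarrow> x = 0 \<and> y = 0"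
  shows "quad_pair [:f0, f1, f2:] [:g0, g1:]"
  unfolding quad_pair_def
proof (intro conjI allI impI)
  show "Polynomial.degree [:g0, g1:] \<le> 2" using degree_quad_le[of g0 g1 0] by simp
  fix x y assume "qform [:f0, f1, f2:] x y = 0" "qform [:g0, g1:] x y = 0"
  then show "x = 0" "y = 0" using assms[of x y] by simp_all
qed (rule degree_quad_le)

text \<open>The maps with fixed points \<open>0\<close> and \<open>\<infinity>\<close> of multipliers \<open>l\<close> and \<open>m\<close>, up to
  scaling of \<open>z\<close>. The third fixed point is \<open>(1 - l) / (1 - m)\<close>.\<close>

definition Qmap :: "'k::field_gcd \<Rightarrow> 'k \<Rightarrow> 'k poly fract" where
  "Qmap l m = Fraction_Field.Fract [:0, l, 1:] [:1, m:]"

text \<open>The map \<open>z + 1/z\<close>, for which \<open>\<infinity>\<close> is a threefold fixed point.\<close>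

definition Tmap :: "'k::field_gcd poly fract" where
  "Tmap = Fraction_Field.Fract [:1, 0, 1:] [:0, 1:]"

text \<open>The solution for \<open>n\<close> of the relation \<open>l m n = l + m + n - 2\<close> between the three
  multipliers. It is the fixed point formula \<open>1/(1 - l) + 1/(1 - m) + 1/(1 - n) = 1\<close> with cleared
  denominators, and holds for multiplier 1 too.\<close>

definition third_mult :: "'k::field \<Rightarrow> 'k \<Rightarrow> 'k" where
  "third_mult l m = (2 - l - m) / (1 - l * m)"

lemma quad_pair_Qmap: "quad_pair [:0, l, 1:] [:1, m:] \<longleftrightarrow> l * m \<noteq> (1::'k::field)"
proof
  assume q: "quad_pair [:0, l, 1:] [:1, m:]"
  show "l * m \<noteq> 1"
  proof
    assume "l * m = 1"
    then have "qform [:0, l, 1:] (-l) 1 = 0 \<and> qform [:1, m:] (-l) 1 = 0"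
      by (simp add: power2_eq_square mult.commute)
    then show False using q unfolding quad_pair_def by (metis zero_neq_one)
  qed
next
  assume lm: "l * m \<noteq> 1"
  show "quad_pair [:0, l, 1:] [:1, m:]"
  proof (rule quad_pair_quad_linearI)
    fix x y assume "1 * x^2 + l * x * y + 0 * y^2 = 0" "m * x * y + 1 * y^2 = 0"
    then have 1: "x * (x + l * y) = 0" and 2: "y * (m * x + y) = 0"
      by (simp_all add: algebra_simps power2_eq_square)
    show "x = 0 \<and> y = 0"
    proof (cases "x = 0")
      case True then show ?thesis using 2 by simp
    next
      case False
      then have x: "x = - (l * y)" using 1 by (simp add: add_eq_0_iff2)
      then have "y * y * (1 - l * m) = 0" using 2 by (simp add: algebra_simps)
      then show ?thesis using lm x by simp
    qed
  qed
qed

lemma quad_pair_Tmap: "quad_pair [:1, 0, 1:] [:0, 1 :: 'k::field:]"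
  by (rule quad_pair_quad_linearI) auto

lemma fixed_points_Qmap:
  assumes lm: "l * m \<noteq> (1::'k::field)"
  shows "fixed_points [:0, l, 1:] [:1, m:] (0, 1, l) (1, 0, m) (1 - l, 1 - m, third_mult l m)"
proof (rule fixed_pointsI[where c = 1])
  show "is_mult [:0, l, 1:] [:1, m:] 0 1 l" "is_mult [:0, l, 1:] [:1, m:] 1 0 m"
    unfolding is_mult_def by ((intro conjI exI[of _ 1]; simp)+)
  have nz: "1 - l * m \<noteq> 0" using lm by simp
  then have "1 - l \<noteq> 0 \<or> 1 - m \<noteq> 0" by auto
  moreover have "qform [:0, l, 1:] (1 - l) (1 - m) = (1 - l * m) * (1 - l)"
    "qform [:1, m:] (1 - l) (1 - m) = (1 - l * m) * (1 - m)"
    by (simp_all add: algebra_simps power2_eq_square)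
  moreover have "wronskian [:0, l, 1:] [:1, m:] (1 - l) (1 - m) = (2 - l - m) * (1 - l * m)"
    by (simp add: algebra_simps power2_eq_square)
  then have "wronskian [:0, l, 1:] [:1, m:] (1 - l) (1 - m) = third_mult l m * (1 - l * m)^2"
    using nz by (simp add: third_mult_def power2_eq_square)
  ultimately show "is_mult [:0, l, 1:] [:1, m:] (1 - l) (1 - m) (third_mult l m)"
    unfolding is_mult_def using nz by blast
qed (simp_all add: algebra_simps power2_eq_square)

lemma fixed_points_Tmap:
  "fixed_points [:1, 0, 1:] [:0, 1 :: 'k::field:] (1, 0, 1) (1, 0, 1) (1, 0, 1)"
proof -
  have m: "is_mult [:1, 0, 1:] [:0, 1:] 1 0 (1::'k)"
    unfolding is_mult_def by (intro conjI exI[of _ 1]; simp)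
  show ?thesis
    by (rule fixed_pointsI[where c = 1, OF m m m]) (simp_all add: algebra_simps power2_eq_square)
qed

definition conjugate :: "'k::field_gcd poly fract \<Rightarrow> 'k poly fract \<Rightarrow> bool" where
  "conjugate f g \<longleftrightarrow> (\<exists>\<alpha> \<in> carrier PGL2. rat_conj f \<alpha> = g)"

lemma conjugate_trans:
  fixes f :: "'k::{alg_closed_field, field_gcd} poly fract"
  assumes "f \<in> Rat2" "conjugate f g" "conjugate g h"
  shows "conjugate f h"
proof -
  interpret G: group "PGL2 :: 'k poly fract monoid" by (rule group_PGL2)
  obtain \<alpha> \<beta> where "\<alpha> \<in> carrier PGL2" "rat_conj f \<alpha> = g" "\<beta> \<in> carrier PGL2" "rat_conj g \<beta> = h"
    using assms unfolding conjugate_def by blast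
  moreover from this have "rat_comp \<alpha> \<beta> \<in> carrier PGL2" using G.m_closed by (metis mult_PGL2)
  ultimately show ?thesis unfolding conjugate_def
    using rat_conj_rat_conj[OF nonconstant_Rat2[OF assms(1)]] by metis
qed

lemma conjugate_Fract:
  fixes F G :: "'k::{alg_closed_field, field_gcd} poly"
  assumes "quad_pair F G" "a * d - b * c \<noteq> 0" "k \<noteq> 0"
    "conj_num a b c d F G = Polynomial.smult k F'" "conj_den a b c d F G = Polynomial.smult k G'"
  shows "conjugate (Fraction_Field.Fract F G) (Fraction_Field.Fract F' G')"
proof -
  have "G' \<noteq> 0" using quad_pair_nonzero(2)[OF quad_pair_conj[OF assms(1,2)]] assms(5) by auto
  then have "Fraction_Field.Fract (Polynomial.smult k F') (Polynomial.smult k G') = Fraction_Field.Fract F' G'"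
    using assms(3) by (subst Fract_eq_iff) auto
  then show ?thesis unfolding conjugate_def using rat_conj_Fract[OF assms(1,2)] assms(2,4,5) mob_in_PGL2 by metis
qed

lemma is_mult_01D:
  assumes "is_mult F G 0 1 l"
  shows "Polynomial.coeff F 0 = 0 \<and> Polynomial.coeff G 0 \<noteq> 0 \<and> Polynomial.coeff F 1 = l * Polynomial.coeff G 0"
  using assms unfolding is_mult_def qform_def wronskian_def by (auto simp: power2_eq_square)

lemma is_mult_10D:
  assumes "is_mult F G 1 0 l"
  shows "Polynomial.coeff G 2 = 0 \<and> Polynomial.coeff F 2 \<noteq> 0 \<and> Polynomial.coeff G 1 = l * Polynomial.coeff F 2"
  using assms unfolding is_mult_def qform_def wronskian_def by (auto simp: power2_eq_square)

text \<open>Moving the two fixed points to \<open>0\<close> and \<open>\<infinity>\<close> turns the map into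
  \<open>z (u z + l v) / (m u z + v)\<close>; scaling \<open>z\<close> by \<open>v/u\<close> gives the normal form.\<close>

lemma conjugate_Qmap:
  fixes F G :: "'k::{alg_closed_field, field_gcd} poly"
  assumes q: "quad_pair F G" and P: "is_mult F G x1 y1 l" "is_mult F G x2 y2 m" and D: "x2 * y1 - x1 * y2 \<noteq> 0"
  shows "l * m \<noteq> 1 \<and> conjugate (Fraction_Field.Fract F G) (Qmap l m)"
proof -
  define F1 where "F1 = conj_num x2 x1 y2 y1 F G"
  define G1 where "G1 = conj_den x2 x1 y2 y1 F G"
  have q1: "quad_pair F1 G1" unfolding F1_def G1_def by (rule quad_pair_conj[OF q D])
  have "is_mult F1 G1 0 1 l" "is_mult F1 G1 1 0 m" unfolding F1_def G1_def
    by (rule is_mult_conj[OF _ D]; use P in simp)+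
  note z = is_mult_01D[OF this(1)] is_mult_10D[OF this(2)]
  obtain f0 f1 u where F1': "F1 = [:f0, f1, u:]" using q1 quadratic_cases unfolding quad_pair_def by blast
  obtain v g1 g2 where G1': "G1 = [:v, g1, g2:]" using q1 quadratic_cases unfolding quad_pair_def by blast
  have F1: "F1 = [:0, l * v, u:]" and G1: "G1 = [:v, m * u:]" and uv: "u \<noteq> 0" "v \<noteq> 0"
    using z unfolding F1' G1' by (simp_all add: numeral_2_eq_2)
  define s where "s = v / u"
  have s: "s \<noteq> 0" "u * s = v" using uv by (simp_all add: s_def)
  have 1: "conjugate (Fraction_Field.Fract F G) (Fraction_Field.Fract F1 G1)"
    using rat_conj_Fract[OF q D] mob_in_PGL2[OF D] unfolding F1_def G1_def conjugate_def by blast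
  have cs: "conj_num s 0 0 1 F1 G1 = Polynomial.smult (s * v) [:0, l, 1:]"
    "conj_den s 0 0 1 F1 G1 = Polynomial.smult (s * v) [:1, m:]"
    unfolding conj_num_def conj_den_def qsub_def F1 G1
    using s(2) by (auto simp: algebra_simps power2_eq_square numeral_2_eq_2)
  have 2: "conjugate (Fraction_Field.Fract F1 G1) (Qmap l m)"
    unfolding Qmap_def by (rule conjugate_Fract[OF q1 _ _ cs]) (use s uv in auto)
  have "quad_pair (Polynomial.smult (s * v) [:0, l, 1:]) (Polynomial.smult (s * v) [:1, m:])"
    using quad_pair_conj[OF q1, of s 1 0 0] s(1) unfolding cs by simp
  moreover have "s * v \<noteq> 0" using s uv by simp
  ultimately have "l * m \<noteq> 1" using quad_pair_smult quad_pair_Qmap by blast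
  then show ?thesis using conjugate_trans[OF quad_pair_Rat2[OF q] 1 2] by blast
qed

text \<open>If the only fixed point is moved to \<open>\<infinity>\<close>, the polynomial \<open>z G - F\<close> is a
  constant \<open>-e\<close>, so the map is \<open>z + e/G\<close>. Here \<open>G\<close> has degree 1, and an affine substitution takes
  \<open>G\<close> to \<open>z\<close> and \<open>e\<close> to 1.\<close>

lemma conjugate_Tmap:
  fixes F G :: "'k::{alg_closed_field, field_gcd} poly"
  assumes q: "quad_pair F G" and m: "fixed_points F G (x1, y1, l1) (x2, y2, l2) (x3, y3, l3)"
    and par: "x1 * y2 = x2 * y1" "x1 * y3 = x3 * y1"
  shows "conjugate (Fraction_Field.Fract F G) Tmap"
proof -
  have nz: "x1 \<noteq> 0 \<or> y1 \<noteq> 0" "x2 \<noteq> 0 \<or> y2 \<noteq> 0" "x3 \<noteq> 0 \<or> y3 \<noteq> 0" using fixed_pointsE[OF m] unfolding is_mult_def by metis+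
  obtain b d where D: "x1 * d - b * y1 \<noteq> 0"
    using nz(1) that[of 1 0] that[of 0 1] by fastforce
  define F1 where "F1 = conj_num x1 b y1 d F G"
  define G1 where "G1 = conj_den x1 b y1 d F G"
  define u where "u x y = d * x - b * y" for x y :: 'k
  have q1: "quad_pair F1 G1" unfolding F1_def G1_def by (rule quad_pair_conj[OF q D])
  then have deg: "Polynomial.degree F1 \<le> 2" "Polynomial.degree G1 \<le> 2" unfolding quad_pair_def by auto
  have "fixed_points F1 G1 (u x1 y1, 0, l1) (u x2 y2, 0, l2) (u x3 y3, 0, l3)"
    using fixed_points_conj[OF m D] par unfolding F1_def G1_def u_def by (simp add: mult.commute)
  then obtain c where c: "c \<noteq> 0" "\<forall>x y. x * qform G1 x y - y * qform F1 x y =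
      c * ((0 * x - u x1 y1 * y) * (0 * x - u x2 y2 * y) * (0 * x - u x3 y3 * y))"
    and im: "is_mult F1 G1 (u x1 y1) 0 l1" "is_mult F1 G1 (u x2 y2) 0 l2" "is_mult F1 G1 (u x3 y3) 0 l3"
    by (metis fixed_pointsE)
  have u: "u x1 y1 \<noteq> 0" "u x2 y2 \<noteq> 0" "u x3 y3 \<noteq> 0" using im unfolding is_mult_def by auto
  define e where "e = c * (u x1 y1 * u x2 y2 * u x3 y3)"
  have e: "e \<noteq> 0" using u c(1) by (simp add: e_def)
  have "[:0, 1:] * G1 - F1 = Polynomial.smult c ([:-u x1 y1, 0:] * [:-u x2 y2, 0:] * [:-u x3 y3, 0:])"
    using c(2) cubic_form_eq_iff[OF deg] by blast
  also have "\<dots> = [:-e:]" by (simp add: e_def)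
  finally have id: "[:0, 1:] * G1 - F1 = [:-e:]" .
  define g0 g1 where "g0 = Polynomial.coeff G1 0" and "g1 = Polynomial.coeff G1 1"
  obtain f0' f1' f2' where F1': "F1 = [:f0', f1', f2':]" using quadratic_cases[OF deg(1)] .
  obtain g0' g1' g2' where G1': "G1 = [:g0', g1', g2':]" using quadratic_cases[OF deg(2)] .
  have "g2' = 0" "f2' = g1" "f1' = g0" "f0' = e" using id unfolding g0_def g1_def F1' G1' by auto
  then have F1: "F1 = [:e, g0, g1:]" and G1: "G1 = [:g0, g1:]" using F1' G1' by (auto simp: g0_def g1_def)
  have "g1 \<noteq> 0"
  proof
    assume "g1 = 0"
    then have "qform F1 1 0 = 0 \<and> qform G1 1 0 = 0" by (simp add: F1 G1 qform_def numeral_2_eq_2)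
    then show False using q1 unfolding quad_pair_def by (metis zero_neq_one)
  qed
  obtain a where a: "a^2 = e / g1" using nth_root_exists[of 2 "e / g1"] by auto
  then have a0: "a \<noteq> 0" using e \<open>g1 \<noteq> 0\<close> by auto
  define t where "t = - g0 / g1"
  have t: "g1 * t = - g0" using \<open>g1 \<noteq> 0\<close> by (simp add: t_def)
  have a': "g1 * a^2 = e" using a \<open>g1 \<noteq> 0\<close> by simp
  have D1: "a * 1 - t * 0 \<noteq> 0" using a0 by simp
  have "conj_den a t 0 1 F1 G1 = [:a * (g1 * t + g0), g1 * a^2:]"
    unfolding conj_den_def qsub_def F1 G1 by (simp add: algebra_simps power2_eq_square numeral_2_eq_2)
  then have cd: "conj_den a t 0 1 F1 G1 = Polynomial.smult e [:0, 1:]" using t a' by simp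
  have "conj_num a t 0 1 F1 G1 = [:e + (g1 * t + g0) * t - t * (g1 * t + g0), 2 * g1 * a * t + g0 * a - t * (g1 * a), g1 * a^2:]"
    unfolding conj_num_def qsub_def F1 G1 by (simp add: algebra_simps power2_eq_square numeral_2_eq_2)
  moreover have "2 * g1 * a * t + g0 * a - t * (g1 * a) = a * (g1 * t + g0)" by (simp add: algebra_simps)
  ultimately have cn: "conj_num a t 0 1 F1 G1 = Polynomial.smult e [:1, 0, 1:]" using t a' by simp
  have 2: "conjugate (Fraction_Field.Fract F1 G1) Tmap"
    unfolding Tmap_def by (rule conjugate_Fract[OF q1 D1 e cn cd])
  have 1: "conjugate (Fraction_Field.Fract F G) (Fraction_Field.Fract F1 G1)"
    using rat_conj_Fract[OF q D] mob_in_PGL2[OF D] unfolding F1_def G1_def conjugate_def by blast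
  show ?thesis using conjugate_trans[OF quad_pair_Rat2[OF q] 1 2] .
qed

lemma Rat2_normal_form:
  fixes f :: "'k::{alg_closed_field, field_gcd} poly fract"
  assumes "f \<in> Rat2"
  shows "conjugate f Tmap \<or> (\<exists>l m. l * m \<noteq> 1 \<and> conjugate f (Qmap l m))"
proof -
  obtain F G where f: "f = Fraction_Field.Fract F G" and q: "quad_pair F G" using Rat2E[OF assms] .
  obtain x1 y1 l1 x2 y2 l2 x3 y3 l3 where fp: "fixed_points F G (x1, y1, l1) (x2, y2, l2) (x3, y3, l3)"
    using fixed_points_exist[OF q] by (metis prod_cases3)
  then have im: "is_mult F G x1 y1 l1" "is_mult F G x2 y2 l2" "is_mult F G x3 y3 l3" by (metis fixed_pointsE)+
  show ?thesis
  proof (cases "x1 * y2 = x2 * y1 \<and> x1 * y3 = x3 * y1")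
    case True then show ?thesis using conjugate_Tmap[OF q fp] f by simp
  next
    case False
    then have "x2 * y1 - x1 * y2 \<noteq> 0 \<or> x3 * y1 - x1 * y3 \<noteq> 0" by auto
    then show ?thesis using conjugate_Qmap[OF q im(1,2)] conjugate_Qmap[OF q im(1,3)] f by blast
  qed
qed

lemma Qmap_in_Rat2: "l * m \<noteq> 1 \<Longrightarrow> Qmap l m \<in> Rat2" for l :: "'k::{alg_closed_field, field_gcd}"
  unfolding Qmap_def by (rule quad_pair_Rat2) (simp add: quad_pair_Qmap)

lemma Tmap_in_Rat2: "(Tmap :: 'k::{alg_closed_field, field_gcd} poly fract) \<in> Rat2"
  unfolding Tmap_def by (rule quad_pair_Rat2) (rule quad_pair_Tmap)

lemma fixed_sigma_Qmap:
  fixes l :: "'k::{alg_closed_field, field_gcd}"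
  assumes "l * m \<noteq> 1"
  shows "fixed_sigma (Qmap l m) = (l + m + third_mult l m, l * m + l * third_mult l m + m * third_mult l m)"
  using fixed_sigma_eq[OF fixed_multipliers_eq[OF quad_pair_Qmap[THEN iffD2, OF assms] fixed_points_Qmap[OF assms]]]
  unfolding Qmap_def .

lemma fixed_sigma_Tmap: "fixed_sigma (Tmap :: 'k::{alg_closed_field, field_gcd} poly fract) = (3, 3)"
proof -
  have "fixed_sigma (Tmap :: 'k poly fract) = (1 + 1 + 1, 1 * 1 + 1 * 1 + 1 * 1)"
    unfolding Tmap_def by (rule fixed_sigma_eq[OF fixed_multipliers_eq[OF quad_pair_Tmap fixed_points_Tmap]])
  then show ?thesis by simp
qed

lemma conjugate_fixed_sigma:
  "f \<in> Rat2 \<Longrightarrow> conjugate f g \<Longrightarrow> fixed_sigma g = fixed_sigma f" for f :: "'k::{alg_closed_field, field_gcd} poly fract"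
  unfolding conjugate_def using fixed_sigma_rat_conj by blast

lemma conjugate_Rat2:
  "f \<in> Rat2 \<Longrightarrow> conjugate f g \<Longrightarrow> g \<in> Rat2" for f :: "'k::{alg_closed_field, field_gcd} poly fract"
  unfolding conjugate_def using rat_conj_Rat2 by blast

text \<open>Another pair of fixed points is moved to \<open>0\<close> and \<open>\<infinity>\<close>. The third fixed point
  differs from \<open>0\<close> if \<open>l \<noteq> 1\<close>, and from \<open>\<infinity>\<close> if \<open>m \<noteq> 1\<close>.\<close>

lemma Qmap_change_points:
  fixes l :: "'k::{alg_closed_field, field_gcd}"
  assumes lm: "l * m \<noteq> 1"
  defines "n \<equiv> third_mult l m"
  shows "l \<noteq> 1 \<Longrightarrow> l * n \<noteq> 1 \<and> conjugate (Qmap l m) (Qmap l n)"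
    and "m \<noteq> 1 \<Longrightarrow> m * n \<noteq> 1 \<and> conjugate (Qmap l m) (Qmap m n)"
proof -
  have q: "quad_pair [:0, l, 1:] [:1, m:]" using lm by (simp add: quad_pair_Qmap)
  have im: "is_mult [:0, l, 1:] [:1, m:] 0 1 l" "is_mult [:0, l, 1:] [:1, m:] 1 0 m"
    "is_mult [:0, l, 1:] [:1, m:] (1 - l) (1 - m) n"
    using fixed_points_Qmap[OF lm] unfolding n_def by (metis fixed_pointsE)+
  show "l * n \<noteq> 1 \<and> conjugate (Qmap l m) (Qmap l n)" if "l \<noteq> 1"
    using conjugate_Qmap[OF q im(1,3)] that unfolding Qmap_def by simp
  show "m * n \<noteq> 1 \<and> conjugate (Qmap l m) (Qmap m n)" if "m \<noteq> 1"
    using conjugate_Qmap[OF q im(2,3)] that unfolding Qmap_def by simp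
qed

lemma third_mult_relation:
  assumes "l * m \<noteq> (1::'k::field)"
  shows "n = third_mult l m \<longleftrightarrow> l * m * n = l + m + n - 2"
proof -
  have "1 - l * m \<noteq> 0" using assms by simp
  then have "n = third_mult l m \<longleftrightarrow> n * (1 - l * m) = 2 - l - m" by (simp add: third_mult_def field_simps)
  then show ?thesis by (auto simp: algebra_simps)
qed

text \<open>A point \<open>(x, y)\<close> determines the multipliers as the roots of
  \<open>t\<^sup>3 - x t\<^sup>2 + y t - (x - 2)\<close>. If two of them have a product other than 1, they are
  realized by \<open>Qmap\<close>; otherwise the relation between them forces all three to be 1, which is the
  case of \<open>Tmap\<close>.\<close>

lemma fixed_sigma_surj:
  fixes s :: "'k::{alg_closed_field, field_gcd} \<times> 'k"
  shows "\<exists>f \<in> Rat2. fixed_sigma f = s"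
proof -
  obtain x y where s: "s = (x, y)" by fastforce
  let ?P = "[:-(x - 2), y, -x, 1:]"
  obtain A where A: "size A = Polynomial.degree ?P" "?P = Polynomial.smult (lead_coeff ?P) (\<Prod>x\<in>#A. [:-x, 1:])"
    using alg_closed_imp_factorization[of ?P] by auto
  have "size A = Suc (Suc (Suc 0))" using A(1) by simp
  then obtain a B where "A = add_mset a B" "size B = Suc (Suc 0)" by (metis size_eq_Suc_imp_eq_union size_add_mset Suc_inject add_mset_add_single)
  moreover from this obtain b C where "B = add_mset b C" "size C = Suc 0" by (metis size_eq_Suc_imp_eq_union size_add_mset Suc_inject add_mset_add_single)
  moreover from this obtain c where "C = {#c#}" by (metis size_1_singleton_mset One_nat_def)
  ultimately have "A = {#a, b, c#}" by simp
  with A(2) have "2 - x = - (a * b * c)" "y = a * b + a * c + b * c" "- x = - a - b - c"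
    by (simp_all add: algebra_simps)
  then have e: "x = a + b + c" "y = a * b + a * c + b * c" "x - 2 = a * b * c"
    by (simp_all add: eq_neg_iff_add_eq_0 algebra_simps)
  have rel: "a * b * c = a + b + c - 2" using e by simp
  have Q: "\<exists>f \<in> Rat2. fixed_sigma f = (l + m + n, l * m + l * n + m * n)"
    if "l * m \<noteq> 1" "l * m * n = l + m + n - 2" for l m n :: 'k
    using that fixed_sigma_Qmap[OF that(1)] Qmap_in_Rat2[OF that(1)] third_mult_relation[OF that(1), of n] by metis
  consider "a * b \<noteq> 1" | "a * c \<noteq> 1" | "b * c \<noteq> 1" | "a * b = 1" "a * c = 1" "b * c = 1" by blast
  then show ?thesis
  proof cases
    case 1 then show ?thesis using Q[of a b c] rel unfolding s e(1,2) by simp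
  next
    case 2
    then have "\<exists>f \<in> Rat2. fixed_sigma f = (a + c + b, a * c + a * b + c * b)"
      by (rule Q) (use rel in \<open>simp add: algebra_simps\<close>)
    then show ?thesis unfolding s e(1,2) by (simp add: algebra_simps)
  next
    case 3
    then have "\<exists>f \<in> Rat2. fixed_sigma f = (b + c + a, b * c + b * a + c * a)"
      by (rule Q) (use rel in \<open>simp add: algebra_simps\<close>)
    then show ?thesis unfolding s e(1,2) by (simp add: algebra_simps)
  next
    case 4
    \<comment> \<open>the multipliers are equal to one square root \<open>a\<close> of 1, and \<open>a = 3 * a - 2\<close>\<close>
    have "a \<noteq> 0" using 4(1) by auto
    then have "b = c" using 4(1,2) by (metis mult_left_cancel)
    have "a = c" using 4 \<open>b = c\<close> by (metis mult.commute mult_left_cancel mult_zero_left zero_neq_one)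
    have aa: "a * a = 1" using 4 \<open>a = c\<close> by simp
    then have "a = 3 * a - 2" using rel \<open>b = c\<close> \<open>a = c\<close> by simp
    then have "2 * (a - 1) = 0" by (simp add: algebra_simps)
    then have "a = 1 \<or> (2 :: 'k) = 0" by (metis eq_iff_diff_eq_0 mult_eq_0_iff)
    moreover have "a = 1" if "(2 :: 'k) = 0"
    proof -
      have "(a - 1)^2 = a * a + 1 - 2 * a" by (simp add: power2_eq_square algebra_simps)
      also have "\<dots> = 2 - 2 * a" unfolding aa by simp
      also have "\<dots> = 0" using that by simp
      finally show ?thesis by simp
    qed
    ultimately have "a = 1" by blast
    then show ?thesis unfolding s e(1,2) using \<open>b = c\<close> \<open>a = c\<close> fixed_sigma_Tmap Tmap_in_Rat2
      by (intro bexI[of _ Tmap]) auto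
  qed
qed

section \<open>Automorphisms of the normal forms\<close>

lemma group_Aut:
  fixes f :: "'k::{alg_closed_field, field_gcd} poly fract"
  assumes f: "nonconstant f"
  shows "group (Aut f)"
proof -
  interpret G: group "PGL2 :: 'k poly fract monoid" by (rule group_PGL2)
  have act: "rat_conj f (x \<otimes>\<^bsub>PGL2\<^esub> y) = rat_conj (rat_conj f x) y"
    if "x \<in> carrier PGL2" "y \<in> carrier PGL2" for x y
    using rat_conj_rat_conj[OF f that] by simp
  have act1: "rat_conj f \<one>\<^bsub>PGL2\<^esub> = f" using f by simp
  have "subgroup {\<alpha> \<in> carrier PGL2. rat_conj f \<alpha> = f} PGL2"
  proof (rule G.subgroupI)
    show "{\<alpha> \<in> carrier PGL2. rat_conj f \<alpha> = f} \<noteq> {}" using act1 G.one_closed by blast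
  next
    fix x assume x: "x \<in> {\<alpha> \<in> carrier PGL2. rat_conj f \<alpha> = f}"
    then have "rat_conj f (inv\<^bsub>PGL2\<^esub> x) = rat_conj (rat_conj f x) (inv\<^bsub>PGL2\<^esub> x)" by simp
    also have "\<dots> = rat_conj f (x \<otimes>\<^bsub>PGL2\<^esub> inv\<^bsub>PGL2\<^esub> x)" using x by (subst act) auto
    also have "\<dots> = f" using x act1 by (simp del: mult_PGL2 one_PGL2)
    finally show "inv\<^bsub>PGL2\<^esub> x \<in> {\<alpha> \<in> carrier PGL2. rat_conj f \<alpha> = f}" using x by simp
  next
    fix x y assume "x \<in> {\<alpha> \<in> carrier PGL2. rat_conj f \<alpha> = f}" "y \<in> {\<alpha> \<in> carrier PGL2. rat_conj f \<alpha> = f}"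
    then show "x \<otimes>\<^bsub>PGL2\<^esub> y \<in> {\<alpha> \<in> carrier PGL2. rat_conj f \<alpha> = f}" by (simp add: act del: mult_PGL2)
  qed auto
  then show ?thesis unfolding Aut_def by (rule subgroup.subgroup_is_group) (rule group_PGL2)
qed

lemma conjugate_Aut_iso:
  fixes f :: "'k::{alg_closed_field, field_gcd} poly fract"
  assumes "f \<in> Rat2" "conjugate f g"
  shows "Aut f \<cong> Aut g"
proof -
  have "Aut g \<cong> Aut f" using assms Aut_rat_conj_iso[OF nonconstant_Rat2] unfolding conjugate_def by blast
  moreover have "group (Aut g)" using assms by (intro group_Aut nonconstant_Rat2 conjugate_Rat2[of f g])
  ultimately show ?thesis by (rule group.iso_sym[rotated])
qed

lemma idz_in_Aut: "nonconstant f \<Longrightarrow> idz \<in> carrier (Aut f)" for f :: "'k::{alg_closed_field, field_gcd} poly fract"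
  using mob_in_PGL2[of 1 1 0 0] by (simp add: carrier_Aut flip: idz_eq_mob)

lemma conjugate_Aut_trivial:
  fixes f :: "'k::{alg_closed_field, field_gcd} poly fract"
  assumes "f \<in> Rat2" "conjugate f g"
  shows "carrier (Aut f) = {idz} \<longleftrightarrow> carrier (Aut g) = {idz}"
proof -
  obtain h where h: "bij_betw h (carrier (Aut f)) (carrier (Aut g))"
    using conjugate_Aut_iso[OF assms] unfolding is_iso_def iso_def by blast
  have "idz \<in> carrier (Aut f)" "idz \<in> carrier (Aut g)"
    using assms conjugate_Rat2[OF assms] by (simp_all add: idz_in_Aut nonconstant_Rat2)
  moreover have "card (carrier (Aut f)) = card (carrier (Aut g))" using h by (rule bij_betw_same_card)
  ultimately show ?thesis by (metis card_1_singletonE is_singletonI is_singleton_altdef singletonD)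
qed

lemma mob_in_Aut_iff:
  fixes F G :: "'k::{alg_closed_field, field_gcd} poly"
  assumes q: "quad_pair F G" and D: "a * d - b * c \<noteq> 0"
  shows "mob a b c d \<in> carrier (Aut (Fraction_Field.Fract F G)) \<longleftrightarrow>
    (\<exists>k. k \<noteq> 0 \<and> conj_num a b c d F G = Polynomial.smult k F \<and> conj_den a b c d F G = Polynomial.smult k G)"
    (is "_ \<longleftrightarrow> ?R")
proof
  assume "mob a b c d \<in> carrier (Aut (Fraction_Field.Fract F G))"
  then have "Fraction_Field.Fract F G = Fraction_Field.Fract (conj_num a b c d F G) (conj_den a b c d F G)"
    using rat_conj_Fract[OF q D] by (simp add: carrier_Aut)
  from Fract_quad_pair_eqD[OF q quad_pair_conj[OF q D] this] show ?R by blast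
next
  assume ?R
  then obtain k where k: "k \<noteq> 0" "conj_num a b c d F G = Polynomial.smult k F" "conj_den a b c d F G = Polynomial.smult k G"
    by blast
  have "G \<noteq> 0" using quad_pair_nonzero[OF q] by simp
  then have "Fraction_Field.Fract (Polynomial.smult k F) (Polynomial.smult k G) = Fraction_Field.Fract F G"
    using k(1) by (subst Fract_eq_iff) auto
  then show "mob a b c d \<in> carrier (Aut (Fraction_Field.Fract F G))"
    using rat_conj_Fract[OF q D] k mob_in_PGL2[OF D] by (simp add: carrier_Aut)
qed

text \<open>The inverse of an automorphism permutes the fixed points and preserves their
  multipliers.\<close>

lemma Aut_is_mult:
  fixes F G :: "'k::{alg_closed_field, field_gcd} poly"
  assumes q: "quad_pair F G" and D: "a * d - b * c \<noteq> 0"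
    and "mob a b c d \<in> carrier (Aut (Fraction_Field.Fract F G))" and m: "is_mult F G x y l"
  shows "is_mult F G (d * x - b * y) (a * y - c * x) l"
proof -
  obtain k where k: "k \<noteq> 0" "conj_num a b c d F G = Polynomial.smult k F" "conj_den a b c d F G = Polynomial.smult k G"
    using mob_in_Aut_iff[OF q D] assms(3) by blast
  have "is_mult (Polynomial.smult k F) (Polynomial.smult k G) (d * x - b * y) (a * y - c * x) l"
    using is_mult_conj_inverse[OF m D] unfolding k .
  then have "is_mult (Polynomial.smult (inverse k) (Polynomial.smult k F))
     (Polynomial.smult (inverse k) (Polynomial.smult k G)) (d * x - b * y) (a * y - c * x) l"
    by (rule is_mult_smult) (use k(1) in simp)
  then show ?thesis using k(1) by simp
qed

lemma is_mult_Qmap_cases: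
  assumes lm: "l * m \<noteq> (1::'k::field)" and im: "is_mult [:0, l, 1:] [:1, m:] x y t"
  shows "x = 0 \<and> y \<noteq> 0 \<and> t = l \<or> y = 0 \<and> x \<noteq> 0 \<and> t = m \<or>
    x \<noteq> 0 \<and> y \<noteq> 0 \<and> l \<noteq> 1 \<and> m \<noteq> 1 \<and> (1 - m) * x = (1 - l) * y \<and> t = third_mult l m"
proof -
  have P: "is_mult [:0, l, 1:] [:1, m:] 0 1 l" "is_mult [:0, l, 1:] [:1, m:] 1 0 m"
    "is_mult [:0, l, 1:] [:1, m:] (1 - l) (1 - m) (third_mult l m)"
    using fixed_points_Qmap[OF lm] by (metis fixed_pointsE)+
  obtain k where k: "qform [:0, l, 1:] x y = k * x" "qform [:1, m:] x y = k * y" and nz: "x \<noteq> 0 \<or> y \<noteq> 0"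
    using im unfolding is_mult_def by blast
  have "y * qform [:0, l, 1:] x y = x * qform [:1, m:] x y" unfolding k by simp
  then have e: "x * y * ((1 - m) * x - (1 - l) * y) = 0" by (simp add: algebra_simps power2_eq_square)
  consider "x = 0" "y \<noteq> 0" | "y = 0" "x \<noteq> 0" | "x \<noteq> 0" "y \<noteq> 0" using nz by blast
  then show ?thesis
  proof cases
    case 1
    then show ?thesis using is_mult_unique[OF im] is_mult_scale[OF P(1), of y] by simp
  next
    case 2
    then show ?thesis using is_mult_unique[OF im] is_mult_scale[OF P(2), of x] by simp
  next
    case 3
    then have e: "(1 - m) * x = (1 - l) * y" using e by simp
    have "l \<noteq> 1" using e 3 lm by auto
    moreover have "m \<noteq> 1" using e 3 lm by auto
    moreover have "t = third_mult l m"
    proof -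
      define s where "s = x / (1 - l)"
      have "s * (1 - l) = x" "s * (1 - m) = y" using e \<open>l \<noteq> 1\<close> by (simp_all add: s_def field_simps)
      moreover have "s \<noteq> 0" using 3 \<open>l \<noteq> 1\<close> by (simp add: s_def)
      ultimately have "is_mult [:0, l, 1:] [:1, m:] x y (third_mult l m)" using is_mult_scale[OF P(3)] by metis
      then show ?thesis using is_mult_unique[OF im] by simp
    qed
    ultimately show ?thesis using 3 e by blast
  qed
qed

text \<open>An automorphism that fixes \<open>0\<close> and \<open>\<infinity>\<close> is \<open>z \<mapsto> u z\<close>, and comparing
  coefficients gives \<open>u = 1\<close>. Any other one moves \<open>0\<close> or \<open>\<infinity>\<close> to a different fixed point of
  the same multiplier.\<close>

lemma Aut_Qmap_nontrivial:
  fixes l :: "'k::{alg_closed_field, field_gcd}"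
  assumes lm: "l * m \<noteq> 1" and al: "\<alpha> \<in> carrier (Aut (Qmap l m))" "\<alpha> \<noteq> idz"
  defines "n \<equiv> third_mult l m"
  shows "l \<noteq> 1 \<and> m \<noteq> 1 \<and> (l = m \<or> l = n \<or> m = n)"
proof -
  have q: "quad_pair [:0, l, 1:] [:1, m:]" using lm by (simp add: quad_pair_Qmap)
  obtain a b c d where D: "a * d - b * c \<noteq> 0" and a: "\<alpha> = mob a b c d"
    using al by (auto simp: carrier_Aut elim: PGL2E)
  have P: "is_mult [:0, l, 1:] [:1, m:] 0 1 l" "is_mult [:0, l, 1:] [:1, m:] 1 0 m"
    using fixed_points_Qmap[OF lm] by (metis fixed_pointsE)+
  have mA: "mob a b c d \<in> carrier (Aut (Fraction_Field.Fract [:0, l, 1:] [:1, m:]))"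
    using al(1) unfolding a Qmap_def .
  have 1: "is_mult [:0, l, 1:] [:1, m:] (- b) a l" using Aut_is_mult[OF q D mA P(1)] by simp
  have 2: "is_mult [:0, l, 1:] [:1, m:] d (- c) m" using Aut_is_mult[OF q D mA P(2)] by simp
  show ?thesis
  proof (cases "b = 0 \<and> c = 0")
    case True
    obtain k where k: "k \<noteq> 0" "conj_num a b c d [:0, l, 1:] [:1, m:] = Polynomial.smult k [:0, l, 1:]"
      "conj_den a b c d [:0, l, 1:] [:1, m:] = Polynomial.smult k [:1, m:]"
      using mob_in_Aut_iff[OF q D] mA by blast
    then have "d * a^2 = k" "a * d^2 = k"
      using True by (auto simp: conj_num_def conj_den_def qsub_def)
    then have "a = d" using k(1) by (simp add: power2_eq_square) (metis mult.commute mult.assoc mult_left_cancel mult_eq_0_iff)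
    then have "\<alpha> = idz" using True D by (simp add: a mob_scalar)
    then show ?thesis using al(2) by simp
  next
    case False
    have "l \<noteq> 1 \<and> m \<noteq> 1 \<or> l = m"
      using is_mult_Qmap_cases[OF lm 1] is_mult_Qmap_cases[OF lm 2] False by auto
    moreover have "l = m \<or> l = n \<or> m = n"
      using is_mult_Qmap_cases[OF lm 1] is_mult_Qmap_cases[OF lm 2] False n_def by auto
    moreover have "l = m \<Longrightarrow> l \<noteq> 1 \<and> m \<noteq> 1" using lm by auto
    ultimately show ?thesis by blast
  qed
qed

lemma mob_scaled:
  assumes "a * d - b * c \<noteq> 0" "k \<noteq> 0" shows "mob (k * a) (k * b) (k * c) (k * d) = mob a b c d"
proof -
  have "k * a * (k * d) - k * b * (k * c) = k * k * (a * d - b * c)" by (simp add: algebra_simps)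
  then have "k * a * (k * d) - k * b * (k * c) \<noteq> 0" using assms by simp
  then show ?thesis using assms mob_eq_mob_iff[of a d b c "k * a" "k * d" "k * b" "k * c"] by metis
qed

text \<open>The fixed points of \<open>Qmap l l\<close> are \<open>0\<close>, \<open>1\<close> and \<open>\<infinity>\<close>. An automorphism permutes
  them, hence is one of the six anharmonic substitutions; if it does not fix \<open>1\<close>, all three
  multipliers agree.\<close>

lemma Aut_Qmap_cases:
  fixes l :: "'k::{alg_closed_field, field_gcd}"
  assumes ll: "l * l \<noteq> 1" and al: "\<alpha> \<in> carrier (Aut (Qmap l l))"
  shows "\<alpha> \<in> {idz, mob 0 1 1 0} \<or>
    l = third_mult l l \<and> \<alpha> \<in> {mob 0 1 (-1) 1, mob 1 (-1) 1 0, mob 1 0 1 (-1), mob (-1) 1 0 1}"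
proof -
  let ?F = "[:0, l, 1:]" and ?G = "[:1, l:]"
  have q: "quad_pair ?F ?G" using ll by (simp add: quad_pair_Qmap)
  have l1: "l \<noteq> 1" using ll by auto
  obtain a b c d where D: "a * d - b * c \<noteq> 0" and a: "\<alpha> = mob a b c d"
    using al by (auto simp: carrier_Aut elim: PGL2E)
  have P: "is_mult ?F ?G 0 1 l" "is_mult ?F ?G 1 0 l" "is_mult ?F ?G (1 - l) (1 - l) (third_mult l l)"
    using fixed_points_Qmap[OF ll] by (metis fixed_pointsE)+
  have "is_mult ?F ?G (inverse (1 - l) * (1 - l)) (inverse (1 - l) * (1 - l)) (third_mult l l)"
    using l1 by (intro is_mult_scale[OF P(3)]) simp
  then have P3: "is_mult ?F ?G 1 1 (third_mult l l)" using l1 by simp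
  have mA: "mob a b c d \<in> carrier (Aut (Fraction_Field.Fract ?F ?G))" using al unfolding a Qmap_def .
  have 1: "is_mult ?F ?G (- b) a l" using Aut_is_mult[OF q D mA P(1)] by simp
  have 2: "is_mult ?F ?G d (- c) l" using Aut_is_mult[OF q D mA P(2)] by simp
  have 3: "is_mult ?F ?G (d - b) (a - c) (third_mult l l)" using Aut_is_mult[OF q D mA P3] by simp
  have ll_cases: "x = 0 \<and> y \<noteq> 0 \<or> y = 0 \<and> x \<noteq> 0 \<or> x = y \<and> y \<noteq> 0 \<and> t = third_mult l l" if "is_mult ?F ?G x y t" for x y t
    using is_mult_Qmap_cases[OF ll that] l1 by (metis mult_left_cancel right_minus_eq)
  have c1: "b = 0 \<and> a \<noteq> 0 \<or> a = 0 \<and> b \<noteq> 0 \<or> a = - b \<and> b \<noteq> 0 \<and> l = third_mult l l"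
    using ll_cases[OF 1] by auto
  have c2: "d = 0 \<and> c \<noteq> 0 \<or> c = 0 \<and> d \<noteq> 0 \<or> d = - c \<and> c \<noteq> 0 \<and> l = third_mult l l"
    using ll_cases[OF 2] by auto
  have c3: "d = b \<or> a = c \<or> d - b = a - c"
    using ll_cases[OF 3] by auto
  consider (i) "b = 0" "c = 0" | (j) "a = 0" "d = 0" | (rs) "b = 0" "d = - c" "l = third_mult l l"
    | (r) "a = 0" "d = - c" "l = third_mult l l" | (t) "a = - b" "c = 0" "l = third_mult l l"
    | (u) "a = - b" "d = 0" "l = third_mult l l" | (x) "a = - b" "d = - c" | (y) "b = 0" "d = 0" | (z) "a = 0" "c = 0"
    using c1 c2 by blast
  then show ?thesis
  proof cases
    case i
    then have "a = d" using c3 D by auto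
    then show ?thesis using i D mob_scalar[of a] a by auto
  next
    case j
    then have "c = b" using c3 D by auto
    then show ?thesis using j D mob_scaled[of 0 0 1 1 b] a by auto
  next
    case rs
    then have "c = a" using c3 D by auto
    then show ?thesis using rs D mob_scaled[of 1 "-1" 0 1 a] a by auto
  next
    case r
    then have "d = b" using c3 D by auto
    then have "c = - b" using r(2) by (metis minus_minus)
    then show ?thesis using r D mob_scaled[of 0 1 1 "-1" b] a \<open>d = b\<close> by auto
  next
    case t
    then have "d = b" using c3 D by auto
    then show ?thesis using t D mob_scaled[of "-1" 1 1 0 b] a by auto
  next
    case u
    then have "c = a" using c3 D by auto
    then show ?thesis using u D mob_scaled[of 1 0 "-1" 1 a] a by auto
  next
    case x then show ?thesis using D by simp
  next
    case y then show ?thesis using D by simp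
  next
    case z then show ?thesis using D by simp
  qed
qed

lemma inversion_in_Aut_Qmap:
  fixes l :: "'k::{alg_closed_field, field_gcd}"
  assumes "l * l \<noteq> 1"
  shows "mob 0 1 1 0 \<in> carrier (Aut (Qmap l l))"
  unfolding Qmap_def
proof (subst mob_in_Aut_iff)
  show "quad_pair [:0, l, 1:] [:1, l:]" using assms by (simp add: quad_pair_Qmap)
qed (auto intro!: exI[of _ "-1"] simp: conj_num_def conj_den_def qsub_def numeral_2_eq_2)

lemma rotation_in_Aut_Qmap:
  assumes "(-2) * (-2) \<noteq> (1 :: 'k::{alg_closed_field, field_gcd})"
  shows "mob 0 1 (-1) 1 \<in> carrier (Aut (Qmap (-2) (-2 :: 'k)))"
  unfolding Qmap_def
proof (subst mob_in_Aut_iff)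
  show "quad_pair [:0, -2, 1:] [:1, -2::'k:]" using assms by (simp only: quad_pair_Qmap) simp
qed (auto intro!: exI[of _ "-1"] simp: conj_num_def conj_den_def qsub_def numeral_2_eq_2)

text \<open>Three equal multipliers satisfy \<open>l\<^sup>3 = 3 l - 2\<close>, that is,
  \<open>(l - 1)\<^sup>2 (l + 2) = 0\<close>.\<close>

lemma third_mult_eq_self:
  fixes l :: "'k::field"
  assumes "l * l \<noteq> 1"
  shows "third_mult l l = l \<longleftrightarrow> l = -2"
proof -
  have "third_mult l l = l \<longleftrightarrow> l * l * l = l + l + l - 2" using third_mult_relation[OF assms, of l] by auto
  also have "\<dots> \<longleftrightarrow> (l - 1) * ((l - 1) * (l + 2)) = 0" by (simp add: algebra_simps)
  also have "\<dots> \<longleftrightarrow> l = -2" using assms by (auto simp: add_eq_0_iff2)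
  finally show ?thesis .
qed

lemma mob_neq_idz: "mob 0 1 1 0 \<noteq> (idz :: 'k::field_gcd poly fract)"
  unfolding idz_eq_mob by (subst mob_eq_mob_iff) auto

lemma mob_inversion_squared: "rat_comp (mob 0 1 1 0) (mob 0 1 1 0) = (idz :: 'k::{alg_closed_field, field_gcd} poly fract)"
  by (subst rat_comp_mob_mob) (simp_all flip: idz_eq_mob)

lemma Aut_Qmap_C2:
  fixes l :: "'k::{alg_closed_field, field_gcd}"
  assumes "l * l \<noteq> 1" "l \<noteq> -2"
  shows "Aut (Qmap l l) \<cong> integer_mod_group 2"
proof (rule is_iso_C2[of _ idz "mob 0 1 1 0"])
  have nc: "nonconstant (Qmap l l)" using assms by (intro nonconstant_Rat2 Qmap_in_Rat2)
  show "carrier (Aut (Qmap l l)) = {idz, mob 0 1 1 0}"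
    using Aut_Qmap_cases[OF assms(1)] third_mult_eq_self[OF assms(1)] assms(2)
      inversion_in_Aut_Qmap[OF assms(1)] idz_in_Aut[OF nc] by auto
qed (use mob_neq_idz[where 'k = 'k] in \<open>simp_all add: mob_inversion_squared nonconstant_mob\<close>)

lemma Aut_Qmap_S3:
  assumes "(-2) * (-2) \<noteq> (1 :: 'k::{alg_closed_field, field_gcd})"
  shows "Aut (Qmap (-2) (-2 :: 'k)) \<cong> sym_group 3"
proof (rule S3_table_imp_iso)
  let ?f = "Qmap (-2) (-2 :: 'k)"
  let ?r = "mob 0 1 (-1) (1 :: 'k)" and ?s = "mob 0 1 1 (0 :: 'k)"
  have nc: "nonconstant ?f" using assms by (intro nonconstant_Rat2 Qmap_in_Rat2)
  show gr: "group (Aut ?f)" by (rule group_Aut[OF nc])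
  note inA = inversion_in_Aut_Qmap[OF assms] rotation_in_Aut_Qmap[OF assms] idz_in_Aut[OF nc]
  have cl: "rat_comp x y \<in> carrier (Aut ?f)" if "x \<in> carrier (Aut ?f)" "y \<in> carrier (Aut ?f)" for x y
    using monoid.m_closed[OF group.is_monoid[OF gr] that] by simp
  have rr: "rat_comp ?r ?r = mob 1 (-1) 1 0"
    using mob_scaled[of "1" 0 "-1" 1 "-1"] by (subst rat_comp_mob_mob) simp_all
  have rs: "rat_comp ?r ?s = mob 1 0 1 (-1)" by (subst rat_comp_mob_mob) simp_all
  have rrs: "rat_comp ?r (mob 1 0 1 (-1)) = mob (-1) 1 0 1"
    using mob_scaled[of "-1" 1 1 0 "-1"] by (subst rat_comp_mob_mob) simp_all
  have rrr: "rat_comp ?r (mob 1 (-1) 1 0) = idz"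
    using mob_scalar[of "-1 :: 'k"] by (subst rat_comp_mob_mob) (simp_all add: idz_eq_mob)
  have sr: "rat_comp ?s ?r = mob (-1) 1 0 1" by (subst rat_comp_mob_mob) simp_all
  let ?C = "{idz, ?r, mob 1 (-1) 1 0, ?s, mob 1 0 1 (-1), mob (-1) 1 0 1}"
  have sub: "?C \<subseteq> carrier (Aut ?f)"
    using inA cl[OF inA(2) inA(2)] cl[OF inA(2) inA(1)] cl[OF inA(1) inA(2)] unfolding rr rs sr by blast
  have C: "carrier (Aut ?f) = ?C"
  proof
    show "carrier (Aut ?f) \<subseteq> ?C" using Aut_Qmap_cases[OF assms] by blast
  qed (rule sub)
  have "card ?C = 6"
    unfolding idz_eq_mob by (simp add: mob_eq_mob_iff card_insert_if)
  then show "S3_table (Aut ?f) ?r ?s"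
    unfolding S3_table_def using inA
    by (simp add: rr rs rrs rrr sr mob_inversion_squared) (simp add: C)
qed

text \<open>An automorphism fixes \<open>\<infinity>\<close>, so it is affine; comparing coefficients leaves
  \<open>z \<mapsto> z\<close> and \<open>z \<mapsto> - z\<close>.\<close>

lemma Aut_Tmap:
  assumes "\<alpha> \<in> carrier (Aut (Tmap :: 'k::{alg_closed_field, field_gcd} poly fract))"
  shows "\<alpha> = idz \<or> \<alpha> = mob (-1) 0 0 1"
proof -
  note q = quad_pair_Tmap[where 'k = 'k]
  obtain a b c d where D: "a * d - b * c \<noteq> 0" and a: "\<alpha> = mob a b c d"
    using assms by (auto simp: carrier_Aut elim: PGL2E)
  have mA: "mob a b c d \<in> carrier (Aut (Fraction_Field.Fract [:1, 0, 1:] [:0, 1:]))" using assms unfolding a Tmap_def .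
  obtain k where k: "k \<noteq> 0" "conj_num a b c d [:1, 0, 1:] [:0, 1:] = Polynomial.smult k [:1, 0, 1:]"
      "conj_den a b c d [:1, 0, 1:] [:0, 1:] = Polynomial.smult k [:0, 1:]"
    using mob_in_Aut_iff[OF q D] mA by blast
  have P: "is_mult [:1, 0, 1:] [:0, 1 :: 'k:] 1 0 1" using fixed_points_Tmap by (rule fixed_pointsE)
  have "is_mult [:1, 0, 1:] [:0, 1:] d (- c) 1" using Aut_is_mult[OF q D mA P] by simp
  then obtain k' where "qform [:1, 0, 1:] d (- c) = k' * d" "qform [:0, 1:] d (- c) = k' * (- c)"
    unfolding is_mult_def by blast
  then have "d^2 + c^2 = k' * d" "c = 0 \<or> d = k'" by auto
  then have c: "c = 0" by (auto simp: power2_eq_square)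
  have "a * (a * d) = k" "a * (b * d) = 0" "d * a^2 = k" "d * (b^2 + d^2) - b * (b * d) = k"
    using k(2,3) unfolding c by (auto simp: conj_num_def conj_den_def qsub_def numeral_2_eq_2 algebra_simps)
  moreover have ad: "a \<noteq> 0" "d \<noteq> 0" using D c by auto
  ultimately have b: "b = 0" and "d * (d * d) = a * (a * d)" by (auto simp: power2_eq_square)
  then have "d * ((a - d) * (a + d)) = 0" by (auto simp: algebra_simps)
  then have "a = d \<or> a = - d" using ad by (simp add: add_eq_0_iff2)
  then show ?thesis using mob_scalar[OF ad(2)] mob_scaled[of "-1" 1 0 0 d] ad a b c by auto
qed

lemma mob_neg_in_Aut_Tmap: "mob (-1) 0 0 1 \<in> carrier (Aut (Tmap :: 'k::{alg_closed_field, field_gcd} poly fract))"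
  unfolding Tmap_def
  by (subst mob_in_Aut_iff[OF quad_pair_Tmap])
    (auto intro!: exI[of _ 1] simp: conj_num_def conj_den_def qsub_def numeral_2_eq_2)

lemma mob_neg_eq_idz_iff: "mob (-1) 0 0 1 = (idz :: 'k::field_gcd poly fract) \<longleftrightarrow> (2 :: 'k) = 0"
proof -
  have "mob (-1) 0 0 1 = (idz :: 'k poly fract) \<longleftrightarrow> (1 :: 'k) = - 1"
    unfolding idz_eq_mob by (subst mob_eq_mob_iff) auto
  also have "\<dots> \<longleftrightarrow> (1 :: 'k) + 1 = 0" by (simp only: eq_neg_iff_add_eq_0)
  finally show ?thesis by simp
qed

lemma carrier_Aut_Tmap:
  "carrier (Aut (Tmap :: 'k::{alg_closed_field, field_gcd} poly fract)) = {idz, mob (-1) 0 0 1}"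
  using Aut_Tmap mob_neg_in_Aut_Tmap idz_in_Aut nonconstant_Rat2[OF Tmap_in_Rat2] by blast

lemma Aut_Tmap_C2:
  assumes "(2 :: 'k::{alg_closed_field, field_gcd}) \<noteq> 0"
  shows "Aut (Tmap :: 'k poly fract) \<cong> integer_mod_group 2"
proof (rule is_iso_C2[OF carrier_Aut_Tmap])
  have "rat_comp (mob (-1) 0 0 1) (mob (-1) 0 0 1) = (idz :: 'k poly fract)"
    by (subst rat_comp_mob_mob) (simp_all flip: idz_eq_mob)
  then show "mob (-1) 0 0 1 \<otimes>\<^bsub>Aut Tmap\<^esub> mob (-1) 0 0 1 = (idz :: 'k poly fract)" by simp
qed (use assms mob_neg_eq_idz_iff[where 'k = 'k] in \<open>auto simp: nonconstant_mob\<close>)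

section \<open>The moduli space\<close>

lemma M2_class:
  fixes c :: "'k::{alg_closed_field, field_gcd} poly fract set"
  shows "c \<in> M2 \<longleftrightarrow> (\<exists>f \<in> Rat2. c = {g. conjugate f g})"
proof -
  have *: "{(f, g). f \<in> Rat2 \<and> g \<in> Rat2 \<and> (\<exists>\<alpha>\<in>carrier PGL2. g = rat_conj f \<alpha>)} `` {f} = {g. conjugate f g}"
    if "f \<in> Rat2" for f :: "'k poly fract"
    using that rat_conj_Rat2 unfolding conjugate_def by blast
  show ?thesis unfolding M2_def quotient_def using * by auto
qed

lemma conjugate_refl: "f \<in> Rat2 \<Longrightarrow> conjugate f f" for f :: "'k::{alg_closed_field, field_gcd} poly fract"
  unfolding conjugate_def using mob_in_PGL2[of 1 1 0 0] nonconstant_Rat2[of f]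
  by (intro bexI[of _ idz]) (auto simp: idz_eq_mob[symmetric])

lemma moduli_coords_eq:
  fixes f :: "'k::{alg_closed_field, field_gcd} poly fract"
  assumes "f \<in> Rat2"
  shows "moduli_coords {g. conjugate f g} = fixed_sigma f"
proof -
  have "fixed_sigma ` {g. conjugate f g} = {fixed_sigma f}"
  proof (intro equalityI subsetI)
    fix x assume "x \<in> fixed_sigma ` {g. conjugate f g}"
    then obtain g where "conjugate f g" "x = fixed_sigma g" by blast
    then show "x \<in> {fixed_sigma f}" using conjugate_fixed_sigma[OF assms] by blast
  qed (use conjugate_refl[OF assms] in blast)
  then show ?thesis by (simp add: moduli_coords_def)
qed

text \<open>The existence of a class with given coordinates comes from the surjectivity of
  \<open>fixed_sigma\<close>, so only the assertion about its members remains.\<close>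

lemma holds_atI:
  fixes x :: "'k::{alg_closed_field, field_gcd} \<times> 'k"
  assumes "\<And>f. f \<in> Rat2 \<Longrightarrow> fixed_sigma f = x \<Longrightarrow> Q f"
  shows "holds_at x Q"
  unfolding holds_at_def
proof (intro conjI ballI impI)
  obtain f where "f \<in> Rat2" "fixed_sigma f = x" using fixed_sigma_surj by blast
  then show "\<exists>c\<in>M2. moduli_coords c = x" using M2_class moduli_coords_eq by blast
next
  fix c g assume c: "c \<in> M2" "moduli_coords c = x" "g \<in> c"
  then obtain f where f: "f \<in> Rat2" "c = {g. conjugate f g}" using M2_class by blast
  then have g: "conjugate f g" using c(3) by blast
  have "fixed_sigma g = x"
    using conjugate_fixed_sigma[OF f(1) g] moduli_coords_eq[OF f(1)] c(2) f(2) by simp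
  then show "Q g" using assms conjugate_Rat2[OF f(1) g] by blast
qed

lemma aut_locus_eq:
  "(aut_locus :: ('k::{alg_closed_field, field_gcd} \<times> 'k) set) =
    {fixed_sigma f | f. f \<in> Rat2 \<and> carrier (Aut f) \<noteq> {idz}}"
proof (intro equalityI subsetI)
  fix x :: "'k \<times> 'k" assume "x \<in> aut_locus"
  then obtain c f where c: "c \<in> M2" "x = moduli_coords c" and f: "f \<in> c" "carrier (Aut f) \<noteq> {idz}"
    unfolding aut_locus_def A2_def by auto
  then obtain g where g: "g \<in> Rat2" "c = {h. conjugate g h}" using M2_class by blast
  then have gf: "conjugate g f" using f(1) by blast
  have "x = fixed_sigma f"
    using conjugate_fixed_sigma[OF g(1) gf] moduli_coords_eq[OF g(1)] c(2) g(2) by simp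
  then show "x \<in> {fixed_sigma f | f. f \<in> Rat2 \<and> carrier (Aut f) \<noteq> {idz}}"
    using conjugate_Rat2[OF g(1) gf] f(2) by blast
next
  fix x :: "'k \<times> 'k" assume "x \<in> {fixed_sigma f | f. f \<in> Rat2 \<and> carrier (Aut f) \<noteq> {idz}}"
  then obtain f where f: "f \<in> Rat2" "carrier (Aut f) \<noteq> {idz}" "x = fixed_sigma f" by blast
  have "{g. conjugate f g} \<in> M2" using M2_class f(1) by blast
  moreover have "f \<in> {g. conjugate f g}" using conjugate_refl[OF f(1)] by simp
  ultimately have "{g. conjugate f g} \<in> A2" unfolding A2_def using f(2) by auto
  then have "moduli_coords {g. conjugate f g} \<in> aut_locus" unfolding aut_locus_def by (rule imageI)
  then show "x \<in> aut_locus" unfolding moduli_coords_eq[OF f(1)] f(3) .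
qed

section \<open>The discriminant of the multipliers\<close>

definition cubic_at :: "'k::comm_ring_1 \<Rightarrow> 'k \<Rightarrow> 'k" where
  "cubic_at x y = 2 * x^3 + x^2 * y - x^2 - 4 * y^2 - 8 * x * y + 12 * x + 12 * y - 36"

text \<open>The relation between the multipliers makes the third elementary symmetric function
  \<open>\<sigma>\<^sub>1 - 2\<close>. After this substitution the discriminant of the cubic polynomial with the
  multipliers as roots has the factor \<open>1 - \<sigma>\<^sub>1 + \<sigma>\<^sub>2 - \<sigma>\<^sub>3\<close>,
  which is the product of the \<open>1 - \<lambda>\<^sub>i\<close>. The other factor is the equation of the
  automorphism locus.\<close>

lemma discriminant_of_multipliers:
  fixes l m n :: "'k::comm_ring_1"
  assumes "l * m * n = l + m + n - 2"
  shows "((l - m) * (l - n) * (m - n))^2 =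
    (1 - l) * (1 - m) * (1 - n) * cubic_at (l + m + n) (l * m + l * n + m * n)"
proof -
  define s1 s2 s3 where s: "s1 = l + m + n" "s2 = l * m + l * n + m * n" "s3 = l * m * n"
  have "((l - m) * (l - n) * (m - n))^2 = s1^2 * s2^2 - 4 * s2^3 - 4 * s1^3 * s3 + 18 * s1 * s2 * s3 - 27 * s3^2"
    unfolding s by (simp add: algebra_simps power2_eq_square power3_eq_cube)
  also have "s3 = s1 - 2" using assms unfolding s .
  also have "s1^2 * s2^2 - 4 * s2^3 - 4 * s1^3 * (s1 - 2) + 18 * s1 * s2 * (s1 - 2) - 27 * (s1 - 2)^2
    = (1 - s1 + s2 - (s1 - 2)) * cubic_at s1 s2"
    unfolding cubic_at_def by (simp add: algebra_simps power2_eq_square power3_eq_cube)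
  also have "1 - s1 + s2 - (s1 - 2) = 1 - s1 + s2 - l * m * n" using assms unfolding s by simp
  also have "\<dots> = (1 - l) * (1 - m) * (1 - n)" unfolding s by (simp add: algebra_simps power2_eq_square power3_eq_cube)
  finally show ?thesis unfolding s .
qed

lemma third_mult_neq_1:
  assumes "l * m * n = l + m + n - 2" "l \<noteq> 1" "m \<noteq> (1::'k::field)" shows "n \<noteq> 1"
proof
  assume "n = 1"
  then have "(l - 1) * (m - 1) = 0" using assms(1) by (simp add: algebra_simps)
  then show False using assms by simp
qed

text \<open>By the relation between the multipliers, \<open>\<sigma>\<^sub>2 = 2 \<sigma>\<^sub>1 - 3\<close> is
  the line of maps that have 1 as a multiplier.\<close>

lemma cubic_at_line: "cubic_at x (2 * x - 3) = 4 * (x - 3)^3" for x :: "'k::comm_ring_1"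
  unfolding cubic_at_def by (simp add: algebra_simps power2_eq_square power3_eq_cube)

text \<open>On the cubic two multipliers agree. If they are not 1, they belong to distinct fixed
  points, which can be moved to \<open>0\<close> and \<open>\<infinity>\<close>. The remaining case is that of \<open>Tmap\<close>, because
  the line of maps having multiplier 1 meets the cubic in \<open>(3, 3)\<close> only.\<close>

lemma Rat2_on_cubic:
  fixes f :: "'k::{alg_closed_field, field_gcd} poly fract"
  assumes f: "f \<in> Rat2" "fixed_sigma f = (x, y)" and cb: "cubic_at x y = 0" and two: "(2 :: 'k) \<noteq> 0"
  shows "conjugate f Tmap \<and> (x, y) = (3, 3) \<or> (\<exists>l. l * l \<noteq> 1 \<and> conjugate f (Qmap l l))"
  using Rat2_normal_form[OF f(1)]
proof
  assume "conjugate f Tmap"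
  then show ?thesis using conjugate_fixed_sigma[OF f(1), of Tmap] f(2) fixed_sigma_Tmap[where 'k = 'k] by simp
next
  assume "\<exists>l m. l * m \<noteq> 1 \<and> conjugate f (Qmap l m)"
  then obtain l m where lm: "l * m \<noteq> 1" and fQ: "conjugate f (Qmap l m)" by blast
  define n where "n = third_mult l m"
  have rel: "l * m * n = l + m + n - 2" using third_mult_relation[OF lm] n_def by blast
  have xy: "x = l + m + n" "y = l * m + l * n + m * n"
    using conjugate_fixed_sigma[OF f(1) fQ] f(2) fixed_sigma_Qmap[OF lm] unfolding n_def by auto
  have four: "(4 :: 'k) \<noteq> 0" using two by (metis mult_2 mult_eq_0_iff numeral_Bit0)
  \<comment> \<open>at \<open>(3, 3)\<close> all multipliers are 1, which \<open>l * m \<noteq> 1\<close> excludes\<close>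
  have no1: "l \<noteq> 1 \<and> m \<noteq> 1"
  proof (rule ccontr)
    assume "\<not> (l \<noteq> 1 \<and> m \<noteq> 1)"
    then have "(1 - l) * (1 - m) * (1 - n) = 0" by auto
    moreover have "(1 - l) * (1 - m) * (1 - n) = 1 - x + y - (l * m * n)" unfolding xy by (simp add: algebra_simps)
    moreover have "l * m * n = x - 2" using rel xy(1) by simp
    ultimately have "1 - x + y - (x - 2) = 0" by simp
    moreover have "y = 2 * x - 3 + (1 - x + y - (x - 2))" by (simp add: algebra_simps)
    ultimately have "y = 2 * x - 3" by simp
    then have "x = 3" using cb cubic_at_line[of x] four by simp
    then have "l * m = 1" using \<open>\<not> (l \<noteq> 1 \<and> m \<noteq> 1)\<close> \<open>y = 2 * x - 3\<close> xy
    proof -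
      have "l + m + n = 3" "l * m + l * n + m * n = 3" using xy \<open>x = 3\<close> \<open>y = 2 * x - 3\<close> by auto
      moreover from this have "l * m * n = 1" using rel by simp
      ultimately have "(l - 1)^3 = 0" "(m - 1)^3 = 0"
      proof -
        have "(l - 1)^3 = l^3 - (l + m + n) * l^2 + (l * m + l * n + m * n) * l - l * m * n"
          "(m - 1)^3 = m^3 - (l + m + n) * m^2 + (l * m + l * n + m * n) * m - l * m * n"
          unfolding \<open>l + m + n = 3\<close> \<open>l * m + l * n + m * n = 3\<close> \<open>l * m * n = 1\<close>
          by (simp_all add: algebra_simps power3_eq_cube power2_eq_square)
        then show "(l - 1)^3 = 0" "(m - 1)^3 = 0" by (simp_all add: algebra_simps power3_eq_cube power2_eq_square)
      qed
      then show "l * m = 1" by simp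
    qed
    then show False using lm by simp
  qed
  have "((l - m) * (l - n) * (m - n))^2 = 0"
    using discriminant_of_multipliers[OF rel] cb unfolding xy by simp
  then have "l = m \<or> l = n \<or> m = n" by auto
  then show ?thesis
    using lm fQ Qmap_change_points[OF lm] no1 conjugate_trans[OF f(1) fQ] unfolding n_def[symmetric] by metis
qed

lemma Aut_nontrivial_multipliers:
  fixes f :: "'k::{alg_closed_field, field_gcd} poly fract"
  assumes f: "f \<in> Rat2" and "carrier (Aut f) \<noteq> {idz}"
  shows "conjugate f Tmap \<and> (2 :: 'k) \<noteq> 0 \<or>
    (\<exists>l m n. l * m * n = l + m + n - 2 \<and> l \<noteq> 1 \<and> m \<noteq> 1 \<and> n \<noteq> 1 \<and> (l = m \<or> l = n \<or> m = n) \<and>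
      fixed_sigma f = (l + m + n, l * m + l * n + m * n))"
  using Rat2_normal_form[OF f]
proof
  assume c: "conjugate f Tmap"
  then have "carrier (Aut (Tmap :: 'k poly fract)) \<noteq> {idz}" using conjugate_Aut_trivial[OF f] assms(2) by blast
  then show ?thesis using c carrier_Aut_Tmap mob_neg_eq_idz_iff[where 'k = 'k] by auto
next
  assume "\<exists>l m. l * m \<noteq> 1 \<and> conjugate f (Qmap l m)"
  then obtain l m where lm: "l * m \<noteq> 1" and fQ: "conjugate f (Qmap l m)" by blast
  define n where "n = third_mult l m"
  have rel: "l * m * n = l + m + n - 2" using third_mult_relation[OF lm] n_def by blast
  have "carrier (Aut (Qmap l m)) \<noteq> {idz}" using conjugate_Aut_trivial[OF f fQ] assms(2) by blast
  moreover have "idz \<in> carrier (Aut (Qmap l m))" using lm by (intro idz_in_Aut nonconstant_Rat2 Qmap_in_Rat2)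
  ultimately obtain \<alpha> where "\<alpha> \<in> carrier (Aut (Qmap l m))" "\<alpha> \<noteq> idz" by blast
  from Aut_Qmap_nontrivial[OF lm this] have "l \<noteq> 1 \<and> m \<noteq> 1 \<and> (l = m \<or> l = n \<or> m = n)" unfolding n_def .
  moreover have "fixed_sigma f = (l + m + n, l * m + l * n + m * n)"
    using conjugate_fixed_sigma[OF f fQ] fixed_sigma_Qmap[OF lm] unfolding n_def by simp
  ultimately show ?thesis using rel third_mult_neq_1[OF rel] by blast
qed

lemma cubic_at_33: "cubic_at 3 3 = (0 :: 'k::comm_ring_1)"
  by (simp add: cubic_at_def)

lemma Aut_Qmap_not_trivial:
  fixes l :: "'k::{alg_closed_field, field_gcd}"
  assumes "l * l \<noteq> 1" shows "carrier (Aut (Qmap l l)) \<noteq> {idz}"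
  using inversion_in_Aut_Qmap[OF assms] mob_neq_idz by blast

lemma aut_locus_cubic:
  assumes two: "(2 :: 'k::{alg_closed_field, field_gcd}) \<noteq> 0"
  shows "(aut_locus :: ('k \<times> 'k) set) = {(x, y). cubic_at x y = 0}"
proof (intro equalityI subsetI)
  fix s :: "'k \<times> 'k" assume "s \<in> aut_locus"
  then obtain f where f: "f \<in> Rat2" "carrier (Aut f) \<noteq> {idz}" "s = fixed_sigma f" unfolding aut_locus_eq by blast
  from Aut_nontrivial_multipliers[OF f(1,2)] show "s \<in> {(x, y). cubic_at x y = 0}"
  proof
    assume "conjugate f Tmap \<and> (2 :: 'k) \<noteq> 0"
    then have "s = (3, 3)" using conjugate_fixed_sigma[OF f(1), of Tmap] fixed_sigma_Tmap[where 'k = 'k] f(3) by simp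
    then show ?thesis using cubic_at_33 by simp
  next
    assume "\<exists>l m n. l * m * n = l + m + n - 2 \<and> l \<noteq> 1 \<and> m \<noteq> 1 \<and> n \<noteq> 1 \<and> (l = m \<or> l = n \<or> m = n) \<and>
      fixed_sigma f = (l + m + n, l * m + l * n + m * n)"
    then obtain l m n where *: "l * m * n = l + m + n - 2" "l \<noteq> 1" "m \<noteq> 1" "n \<noteq> 1" "l = m \<or> l = n \<or> m = n"
      "fixed_sigma f = (l + m + n, l * m + l * n + m * n)" by blast
    have "((l - m) * (l - n) * (m - n))^2 = 0" using *(5) by auto
    then have "cubic_at (l + m + n) (l * m + l * n + m * n) = 0"
      using discriminant_of_multipliers[OF *(1)] *(2-4) by simp
    then show ?thesis using *(6) f(3) by simp
  qed
next
  fix s :: "'k \<times> 'k" assume s: "s \<in> {(x, y). cubic_at x y = 0}"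
  obtain x y where xy: "s = (x, y)" by fastforce
  obtain f where f: "f \<in> Rat2" "fixed_sigma f = (x, y)" using fixed_sigma_surj by blast
  have "cubic_at x y = 0" using s xy by simp
  from Rat2_on_cubic[OF f this two] have "carrier (Aut f) \<noteq> {idz}"
  proof
    assume "conjugate f Tmap \<and> (x, y) = (3, 3)"
    then show ?thesis using conjugate_Aut_trivial[OF f(1)] carrier_Aut_Tmap mob_neg_eq_idz_iff[where 'k = 'k] two by blast
  next
    assume "\<exists>l. l * l \<noteq> 1 \<and> conjugate f (Qmap l l)"
    then show ?thesis using conjugate_Aut_trivial[OF f(1)] Aut_Qmap_not_trivial by blast
  qed
  then show "s \<in> aut_locus" unfolding aut_locus_eq xy f(2)[symmetric] using f(1) by blast
qed

lemma is_iso_transport: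
  fixes f :: "'k::{alg_closed_field, field_gcd} poly fract"
  assumes "f \<in> Rat2" "conjugate f g" "Aut g \<cong> H"
  shows "Aut f \<cong> H"
  using iso_trans[OF conjugate_Aut_iso[OF assms(1,2)] assms(3)] .

lemma holds_at_cubic_C2:
  assumes two: "(2 :: 'k::{alg_closed_field, field_gcd}) \<noteq> 0"
    and cb: "cubic_at x y = 0" and cusp: "(x, y) \<noteq> (-6, 12) \<or> (3 :: 'k) = 0"
  shows "holds_at (x, y :: 'k) (\<lambda>f. Aut f \<cong> integer_mod_group 2)"
proof (rule holds_atI)
  fix f :: "'k poly fract" assume f: "f \<in> Rat2" "fixed_sigma f = (x, y)"
  from Rat2_on_cubic[OF f cb two] show "Aut f \<cong> integer_mod_group 2"
  proof
    assume "conjugate f Tmap \<and> (x, y) = (3, 3)"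
    then show ?thesis using is_iso_transport[OF f(1)] Aut_Tmap_C2[OF two] by blast
  next
    assume "\<exists>l. l * l \<noteq> 1 \<and> conjugate f (Qmap l l)"
    then obtain l where l: "l * l \<noteq> 1" "conjugate f (Qmap l l)" by blast
    have "l \<noteq> -2"
    proof
      assume l2: "l = -2"
      then have t: "third_mult l l = -2" using third_mult_eq_self[OF l(1)] by simp
      have "fixed_sigma f = (-6, 12)"
        using conjugate_fixed_sigma[OF f(1) l(2)] fixed_sigma_Qmap[OF l(1)] unfolding t unfolding l2 by simp
      moreover have "(3 :: 'k) \<noteq> 0"
      proof
        assume three: "(3 :: 'k) = 0"
        have "l * l = 3 + 1" unfolding l2 by simp
        then show False using l(1) unfolding three by simp
      qed
      ultimately show False using cusp f(2) by simp
    qed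
    then show ?thesis using is_iso_transport[OF f(1) l(2)] Aut_Qmap_C2[OF l(1)] by blast
  qed
qed

lemma holds_at_cusp_S3:
  assumes two: "(2 :: 'k::{alg_closed_field, field_gcd}) \<noteq> 0" and three: "(3 :: 'k) \<noteq> 0"
  shows "holds_at (-6, 12 :: 'k) (\<lambda>f. Aut f \<cong> sym_group 3)"
proof (rule holds_atI)
  fix f :: "'k poly fract" assume f: "f \<in> Rat2" "fixed_sigma f = (-6, 12)"
  have cb: "cubic_at (-6) (12 :: 'k) = 0" by (simp add: cubic_at_def)
  from Rat2_on_cubic[OF f cb two] show "Aut f \<cong> sym_group 3"
  proof
    assume "conjugate f Tmap \<and> (-6 :: 'k, 12 :: 'k) = (3, 3)"
    then have "(12 :: 'k) = 3" by simp
    moreover have "(3 :: 'k) * 3 = 12 - 3" by simp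
    ultimately have "(3 :: 'k) * 3 = 0" by simp
    then have "(3 :: 'k) = 0" unfolding mult_eq_0_iff by blast
    then show ?thesis using three by blast
  next
    assume "\<exists>l. l * l \<noteq> 1 \<and> conjugate f (Qmap l l)"
    then obtain l where l: "l * l \<noteq> 1" "conjugate f (Qmap l l)" by blast
    \<comment> \<open>the multipliers are the roots of \<open>(t + 2)\<^sup>3\<close>\<close>
    define n where "n = third_mult l l"
    have rel: "l * l * n = l + l + n - 2" using third_mult_relation[OF l(1)] n_def by blast
    have s: "l + l + n = -6" "l * l + l * n + l * n = 12"
      using conjugate_fixed_sigma[OF f(1) l(2)] fixed_sigma_Qmap[OF l(1)] f(2) unfolding n_def by auto
    have "(l + 2)^3 = l^3 - (l + l + n) * l^2 + (l * l + l * n + l * n) * l - l * l * n"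
      unfolding rel unfolding s by (simp add: algebra_simps power2_eq_square power3_eq_cube)
    also have "\<dots> = 0" by (simp add: algebra_simps power2_eq_square power3_eq_cube)
    finally have "l = -2" by (simp add: add_eq_0_iff2)
    then have "Aut (Qmap l l) \<cong> sym_group 3" using Aut_Qmap_S3 l(1) by blast
    then show ?thesis by (rule is_iso_transport[OF f(1) l(2)])
  qed
qed

section \<open>Characteristic 2\<close>

lemma char2_neg: "(2 :: 'a::field) = 0 \<Longrightarrow> - x = (x :: 'a)"
proof -
  assume two: "(2 :: 'a) = 0"
  have "x + x = 2 * x" by simp
  also have "\<dots> = 0" using two by simp
  finally have "x + x = 0" .
  then have "x = - x" using eq_neg_iff_add_eq_0[of x x] by blast
  then show "- x = x" by (rule sym)
qed

context
  assumes two: "(2 :: 'k::{alg_closed_field, field_gcd}) = 0"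
begin

lemma char2_add_self: "x + x = (0 :: 'k)"
  using two by (metis mult_2 mult_zero_left)

lemmas char2_minus = char2_neg[OF two]

lemma char2_square_eq_1_iff: "x * x = 1 \<longleftrightarrow> x = (1 :: 'k)"
  by (auto simp: square_eq_1_iff char2_minus)

text \<open>For \<open>\<sigma>\<^sub>1 = 0\<close> in characteristic 2 the relation between the multipliers
  becomes \<open>l m n = 0\<close>. So one multiplier is 0, the other two agree, and \<open>s\<close> is their square. They
  belong to distinct fixed points unless they are 1.\<close>

lemma Rat2_char2:
  fixes f :: "'k poly fract"
  assumes f: "f \<in> Rat2" "fixed_sigma f = (0, s)"
  shows "s \<noteq> 1 \<Longrightarrow> \<exists>l. l * l \<noteq> 1 \<and> s = l * l \<and> conjugate f (Qmap l l)"
    and "s = 1 \<Longrightarrow> conjugate f (Qmap 0 1)"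
proof -
  have "\<not> conjugate f Tmap"
  proof
    assume "conjugate f Tmap"
    then have "(3 :: 'k) = 0" using conjugate_fixed_sigma[OF f(1), of Tmap] f(2) fixed_sigma_Tmap[where 'k = 'k] by simp
    moreover have "(3 :: 'k) = 2 + 1" by simp
    ultimately show False using two by simp
  qed
  then obtain l m where lm: "l * m \<noteq> 1" and fQ: "conjugate f (Qmap l m)" using Rat2_normal_form[OF f(1)] by blast
  define n where "n = third_mult l m"
  have s: "l + m + n = 0" "s = l * m + l * n + m * n"
    using conjugate_fixed_sigma[OF f(1) fQ] f(2) fixed_sigma_Qmap[OF lm] unfolding n_def by auto
  have "l * m * n = l + m + n - 2" using third_mult_relation[OF lm] n_def by blast
  then have "l * m * n = 0" using s two by simp
  moreover have eq: "x = y" if "x + y = 0" for x y :: 'k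
    using that char2_minus[of y] by (metis eq_neg_iff_add_eq_0)
  ultimately consider "l = 0" "m = n" | "m = 0" "l = n" | "n = 0" "l = m"
    using s(1) eq[of m n] eq[of l n] eq[of l m] by auto
  note cases = this
  note chg = Qmap_change_points[OF lm, folded n_def] and tr = conjugate_trans[OF f(1) fQ]
  show "\<exists>l. l * l \<noteq> 1 \<and> s = l * l \<and> conjugate f (Qmap l l)" if "s \<noteq> 1"
    using cases
  proof cases
    case 1
    then have "s = m * m" using s by simp
    moreover from this have "m \<noteq> 1" using that by auto
    ultimately show ?thesis using chg(2) tr 1 by metis
  next
    case 2
    then have "s = l * l" using s by simp
    moreover from this have "l \<noteq> 1" using that by auto
    ultimately show ?thesis using chg(1) tr 2 by metis
  next
    case 3
    then show ?thesis using s lm fQ by auto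
  qed
  show "conjugate f (Qmap 0 1)" if "s = 1"
    using cases
  proof cases
    case 1
    then have "m = 1" using s that char2_square_eq_1_iff by simp
    then show ?thesis using 1 fQ by simp
  next
    case 2
    then have "l = 1" using s that char2_square_eq_1_iff by simp
    then show ?thesis using 2 chg(2) tr by auto
  next
    case 3
    then show ?thesis using s lm that by simp
  qed
qed

lemma aut_locus_char2: "(aut_locus :: ('k \<times> 'k) set) = {(0, s) | s. s \<noteq> 1}"
proof (intro equalityI subsetI)
  fix x :: "'k \<times> 'k" assume "x \<in> aut_locus"
  then obtain f where f: "f \<in> Rat2" "carrier (Aut f) \<noteq> {idz}" "x = fixed_sigma f" unfolding aut_locus_eq by blast
  then obtain l m n where *: "l * m * n = l + m + n - 2" "l \<noteq> 1" "m \<noteq> 1" "n \<noteq> 1" "l = m \<or> l = n \<or> m = n"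
      "fixed_sigma f = (l + m + n, l * m + l * n + m * n)"
    using Aut_nontrivial_multipliers[OF f(1,2)] two by blast
  have main: "c = 0 \<and> b * b \<noteq> 1" if "b * b * c = b + b + c - 2" "b \<noteq> 1" for b c :: 'k
  proof -
    have "c * (b * b - 1) = 0" using that(1) two by (simp add: char2_add_self algebra_simps)
    then show ?thesis using that(2) char2_square_eq_1_iff by auto
  qed
  from *(5) have "\<exists>b. b * b \<noteq> 1 \<and> x = (0, b * b)"
  proof (elim disjE)
    assume "l = m" then show ?thesis using main[of l n] * f(3) by (auto simp: char2_add_self)
  next
    assume "l = n" then show ?thesis using main[of l m] * f(3) by (auto simp: char2_add_self algebra_simps)
  next
    assume "m = n" then show ?thesis using main[of m l] * f(3) by (auto simp: char2_add_self algebra_simps)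
  qed
  then show "x \<in> {(0, s) | s. s \<noteq> 1}" by blast
next
  fix x :: "'k \<times> 'k" assume "x \<in> {(0, s) | s. s \<noteq> 1}"
  then obtain s where s: "x = (0, s)" "s \<noteq> 1" by blast
  obtain f where f: "f \<in> Rat2" "fixed_sigma f = (0, s)" using fixed_sigma_surj by blast
  then have "carrier (Aut f) \<noteq> {idz}"
    using Rat2_char2(1)[OF f s(2)] conjugate_Aut_trivial[OF f(1)] Aut_Qmap_not_trivial by blast
  then show "x \<in> aut_locus" unfolding aut_locus_eq s(1) f(2)[symmetric] using f(1) by blast
qed

lemma holds_at_char2_C2:
  assumes "s \<noteq> 0" "s \<noteq> (1 :: 'k)"
  shows "holds_at (0, s) (\<lambda>f. Aut f \<cong> integer_mod_group 2)"
proof (rule holds_atI)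
  fix f :: "'k poly fract" assume f: "f \<in> Rat2" "fixed_sigma f = (0, s)"
  obtain l where l: "l * l \<noteq> 1" "s = l * l" "conjugate f (Qmap l l)" using Rat2_char2(1)[OF f assms(2)] by blast
  have "l \<noteq> -2" using l(2) assms(1) two by auto
  then show "Aut f \<cong> integer_mod_group 2" using is_iso_transport[OF f(1) l(3)] Aut_Qmap_C2[OF l(1)] by blast
qed

lemma holds_at_char2_S3: "holds_at (0, 0 :: 'k) (\<lambda>f. Aut f \<cong> sym_group 3)"
proof (rule holds_atI)
  fix f :: "'k poly fract" assume f: "f \<in> Rat2" "fixed_sigma f = (0, 0)"
  obtain l where l: "l * l \<noteq> 1" "0 = l * l" "conjugate f (Qmap l l)" using Rat2_char2(1)[OF f] by auto
  have "l = -2" using l(2) two by simp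
  then have "Aut (Qmap l l) \<cong> sym_group 3" using Aut_Qmap_S3 l(1) by blast
  then show "Aut f \<cong> sym_group 3" by (rule is_iso_transport[OF f(1) l(3)])
qed

lemma char2_trivial_Aut:
  fixes f :: "'k poly fract"
  assumes f: "f \<in> Rat2" "fixed_sigma f = (0, 1)"
  shows "carrier (Aut f) = {idz}"
proof -
  have "carrier (Aut (Qmap 0 (1 :: 'k))) = {idz}"
    using Aut_Qmap_nontrivial[of 0 "1 :: 'k"] idz_in_Aut[OF nonconstant_Rat2[OF Qmap_in_Rat2[of 0 "1::'k"]]] by auto
  then show ?thesis using conjugate_Aut_trivial[OF f(1) Rat2_char2(2)[OF f]] by simp
qed

text \<open>A polynomial that vanishes on the line without one point has infinitely many zeros on
  the line.\<close>

lemma zariski_closure_char2: "zariski_closure {(0 :: 'k, s) | s. s \<noteq> 1} = {(0, s) | s. True}"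
proof (intro equalityI subsetI)
  fix v :: "'k \<times> 'k" assume "v \<in> zariski_closure {(0, s) | s. s \<noteq> 1}"
  then have "\<forall>P. (\<forall>w \<in> {(0, s) | s. s \<noteq> 1}. eval2 P w = 0) \<longrightarrow> eval2 P v = 0"
    unfolding zariski_closure_def mem_Collect_eq .
  note this[THEN spec, of var_x]
  then have "fst v = 0" by (auto simp: eval2_def var_x_def)
  then show "v \<in> {(0, s) | s. True}" by (cases v) auto
next
  fix v :: "'k \<times> 'k" assume "v \<in> {(0, s) | s. True}"
  then obtain s where v: "v = (0, s)" by blast
  show "v \<in> zariski_closure {(0, s) | s. s \<noteq> 1}"
    unfolding zariski_closure_def
  proof (intro CollectI allI impI)
    fix P :: "'k poly poly" assume P: "\<forall>w \<in> {(0, s) | s. s \<noteq> 1}. eval2 P w = 0"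
    define p where "p = map_poly (\<lambda>q. poly q 0) P"
    have ev: "eval2 P (0, t) = poly p t" for t
      unfolding eval2_def p_def by (induction P) (auto simp: map_poly_pCons)
    have "p = 0"
    proof (rule ccontr)
      assume "p \<noteq> 0"
      then have "finite {t. poly p t = 0}" by (rule poly_roots_finite)
      moreover have "UNIV - {1} \<subseteq> {t. poly p t = 0}" using P ev by force
      ultimately have "finite (UNIV - {1 :: 'k})" by (rule finite_subset[rotated])
      then show False using infinite_UNIV_alg_closed[where 'k = 'k] by simp
    qed
    then show "eval2 P v = 0" using ev v by simp
  qed
qed

end

section \<open>The cuspidal cubic\<close>

definition cubic :: "'k::comm_ring_1 poly poly" where
  "cubic = [:[:-36, 12, -1, 2:], [:12, -8, 1:], [:-4:]:]"

lemma map_poly_pCons_0: "f 0 = 0 \<Longrightarrow> map_poly f (pCons a p) = pCons (f a) (map_poly f p)"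
  by (cases "a = 0 \<and> p = 0") (auto simp: map_poly_pCons)

lemma numeral_poly_poly: "(numeral n :: 'k::comm_ring_1 poly poly) = [:[:numeral n:]:]"
  by (simp add: numeral_poly)

lemma cubic_eq:
  "2 * var_x ^ 3 + var_x ^ 2 * var_y - var_x ^ 2 - 4 * var_y ^ 2 - 8 * var_x * var_y + 12 * var_x + 12 * var_y - 36
    = (cubic :: 'k::comm_ring_1 poly poly)"
  by (simp add: var_x_def var_y_def cubic_def numeral_poly_poly power2_eq_square power3_eq_cube)

lemma cubic_eq_char3:
  assumes "(3 :: 'k::comm_ring_1) = 0"
  shows "2 * var_x ^ 3 + var_x ^ 2 * var_y - var_x ^ 2 - var_y ^ 2 - 2 * var_x * var_y = (cubic :: 'k poly poly)"
proof -
  have m: "(n :: 'k) + 3 * k = n" for n k using assms by simp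
  have "(36 :: 'k) = 0" "(12 :: 'k) = 0" "(4 :: 'k) = 1" "(8 :: 'k) = 2"
    using m[of 0 12] m[of 0 4] m[of 1 1] m[of 2 2] by simp_all
  then show ?thesis
    by (simp add: var_x_def var_y_def cubic_def numeral_poly_poly power2_eq_square power3_eq_cube one_pCons)
qed

lemma eval2_cubic: "eval2 cubic (x, y) = cubic_at x y"
  by (simp add: eval2_def cubic_def cubic_at_def algebra_simps power2_eq_square power3_eq_cube)

lemma plane_curve_cubic: "plane_curve cubic = {(x, y). cubic_at x y = 0}"
  by (auto simp: plane_curve_def eval2_cubic)

lemma eval2_cubic_dy: "eval2 (pderiv cubic) (x, y) = x^2 - 8 * x + 12 - 8 * y"
  by (simp add: eval2_def cubic_def pderiv_pCons algebra_simps power2_eq_square)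

lemma eval2_cubic_dx:
  "eval2 (map_poly pderiv cubic) (x, y) = 6 * x^2 + 2 * x * y - 2 * x - 8 * y + 12" for x :: "'k::idom"
  by (simp add: eval2_def cubic_def map_poly_pCons_0 pderiv_pCons algebra_simps power2_eq_square)

text \<open>As a quadratic polynomial in \<open>y\<close> the cubic has the discriminant
  \<open>(x + 6)\<^sup>3 (x - 2)\<close>. At a singular point the derivative with respect to \<open>y\<close> vanishes, so
  there \<open>x\<close> is \<open>-6\<close> or \<open>2\<close>.\<close>

lemma cubic_discriminant:
  "(x^2 - 8 * x + 12 - 8 * y)^2 = (x + 6)^3 * (x - 2) - 16 * cubic_at x y" for x y :: "'k::comm_ring_1"
  unfolding cubic_at_def by (simp add: algebra_simps power2_eq_square power3_eq_cube)

lemma singular_points_cubic: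
  assumes two: "(2 :: 'k::field) \<noteq> 0"
  shows "singular_points (cubic :: 'k poly poly) = {(-6, 12)}"
proof (intro equalityI subsetI)
  fix v :: "'k \<times> 'k" assume "v \<in> singular_points cubic"
  then obtain x y where v: "v = (x, y)" and e: "cubic_at x y = 0" "x^2 - 8 * x + 12 - 8 * y = 0"
    "6 * x^2 + 2 * x * y - 2 * x - 8 * y + 12 = 0"
    unfolding singular_points_def by (cases v) (auto simp: eval2_cubic eval2_cubic_dx eval2_cubic_dy)
  have "(8 :: 'k) = 2 * 2 * 2" "(32 :: 'k) = 2 * 2 * 2 * 2 * 2" by simp_all
  then have n: "(8 :: 'k) \<noteq> 0" "(32 :: 'k) \<noteq> 0" using two by (metis mult_eq_0_iff)+
  have "(x + 6)^3 * (x - 2) = 0" using cubic_discriminant[of x y] e by simp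
  then consider "x + 6 = 0" | "x - 2 = 0" by auto
  then show "v \<in> {(-6, 12)}"
  proof cases
    case 1
    then have x: "x = -6" by (simp add: eq_neg_iff_add_eq_0)
    have "8 * (12 - y) = 0" using e(2) unfolding x by (simp add: algebra_simps)
    then have "12 - y = 0" using n(1) mult_eq_0_iff by blast
    then show ?thesis using v x by simp
  next
    case 2
    then have x: "x = 2" by simp
    have "8 * y = 0" using e(2) unfolding x by (simp add: algebra_simps)
    then have "y = 0" using n by simp
    then show ?thesis using e(3) n unfolding x by simp
  qed
next
  fix v :: "'k \<times> 'k" assume "v \<in> {(-6, 12)}"
  then show "v \<in> singular_points cubic"
    by (simp add: singular_points_def eval2_cubic eval2_cubic_dx eval2_cubic_dy cubic_at_def)
qed

lemma total_degree2_cubic: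
  assumes two: "(2 :: 'k::field) \<noteq> 0"
  shows "total_degree2 (cubic :: 'k poly poly) = 3"
proof -
  have c: "coeff2 cubic i j \<noteq> (0 :: 'k) \<Longrightarrow> i + j \<le> 3" for i j
    by (auto simp: coeff2_def cubic_def coeff_pCons split: nat.splits)
  have c3: "coeff2 cubic 3 0 \<noteq> (0 :: 'k)" using two
    by (simp add: coeff2_def cubic_def numeral_3_eq_3)
  have "{i + j | i j. coeff2 cubic i j \<noteq> (0 :: 'k)} \<subseteq> {..3}" using c by auto
  then have "finite {i + j | i j. coeff2 cubic i j \<noteq> (0 :: 'k)}" by (rule finite_subset) simp
  moreover have "3 \<in> {i + j | i j. coeff2 cubic i j \<noteq> (0 :: 'k)}"
    using c3 by (intro CollectI exI[of _ 3] exI[of _ 0]) simp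
  moreover have "n \<le> 3" if "n \<in> {i + j | i j. coeff2 cubic i j \<noteq> (0 :: 'k)}" for n using that c by blast
  ultimately show ?thesis unfolding total_degree2_def by (intro Max_eqI)
qed

lemma double_tangent_cubic:
  assumes two: "(2 :: 'k::field) \<noteq> 0"
  shows "double_tangent_at (cubic :: 'k poly poly) (-6, 12)"
proof -
  have t: "translate2 (-6, 12) cubic = ([:[:0, 0, -25, 2:], [:0, -20, 1:], [:-4:]:] :: 'k poly poly)"
    by (simp add: translate2_def cubic_def map_poly_pCons_0 pcompose_pCons algebra_simps)
  \<comment> \<open>the quadratic part is \<open>- (5 * x + 2 * y)\<^sup>2\<close>\<close>
  show ?thesis unfolding double_tangent_at_def t
    by (rule exI[of _ "-1"], rule exI[of _ 5], rule exI[of _ 2])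
      (use two in \<open>simp add: coeff2_def numeral_2_eq_2\<close>)
qed

text \<open>The leading coefficient with respect to \<open>y\<close> is a unit, so a proper factor would have
  degree 1 in \<open>y\<close> and would make the discriminant a square in \<open>K[x]\<close>. But the discriminant has a
  simple zero at \<open>2\<close>.\<close>

lemma irreducible_cubic:
  assumes two: "(2 :: 'k::{alg_closed_field, field_gcd}) \<noteq> 0"
  shows "Factorial_Ring.irreducible (cubic :: 'k poly poly)"
proof (rule Factorial_Ring.irreducibleI)
  have four: "(4 :: 'k) \<noteq> 0" using two by (metis mult_2 mult_eq_0_iff numeral_Bit0)
  have deg: "Polynomial.degree (cubic :: 'k poly poly) = 2" using four by (simp add: cubic_def)
  show "(cubic :: 'k poly poly) \<noteq> 0" using deg by auto
  show "\<not> is_unit (cubic :: 'k poly poly)" 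
  proof
    assume "is_unit (cubic :: 'k poly poly)"
    then obtain c :: "'k poly" where "cubic = [:c:]" by (auto simp: is_unit_poly_iff)
    then have "Polynomial.degree (cubic :: 'k poly poly) = Polynomial.degree [:c:]" by (rule arg_cong)
    then show False unfolding deg by simp
  qed
  have lead: "Polynomial.lead_coeff cubic = [:-4 :: 'k:]" using deg by (simp add: cubic_def numeral_2_eq_2)
  have unit: "is_unit [:-4 :: 'k:]" using four by (simp add: is_unit_const_poly_iff dvd_field_iff)
  fix A B :: "'k poly poly" assume AB: "cubic = A * B"
  have nz: "A \<noteq> 0" "B \<noteq> 0" using AB deg by auto
  have "Polynomial.lead_coeff A * Polynomial.lead_coeff B = [:-4:]" using lead unfolding AB by (simp add: lead_coeff_mult)
  then have lu: "is_unit (Polynomial.lead_coeff A)" "is_unit (Polynomial.lead_coeff B)" using unit by (metis is_unit_mult_iff)+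
  have const: "is_unit C" if "Polynomial.degree C = 0" "is_unit (Polynomial.lead_coeff C)" for C :: "'k poly poly"
    using that by (metis degree_eq_zeroE is_unit_const_poly_iff lead_coeff_pCons(2) leading_coeff_0_iff coeff_pCons_0)
  have sum: "Polynomial.degree A + Polynomial.degree B = 2" using deg nz unfolding AB by (simp add: degree_mult_eq)
  show "is_unit A \<or> is_unit B"
  proof (cases "Polynomial.degree A = 1")
    case False
    then have "Polynomial.degree A = 0 \<or> Polynomial.degree B = 0" using sum by linarith
    then show ?thesis using const lu by blast
  next
    case True
    \<comment> \<open>the factor has a root \<open>y = r(x)\<close>, and \<open>S\<close> is the square root of the discriminant\<close>
    obtain p q where A: "A = [:p, q:]" 
    proof
      show "A = [:Polynomial.coeff A 0, Polynomial.coeff A 1:]"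
        using True by (intro poly_eqI) (auto simp: coeff_pCons coeff_eq_0 split: nat.splits)
    qed
    have q: "is_unit q" using lu(1) True unfolding A by (auto split: if_splits)
    obtain q' where q': "q * q' = 1" using q by (metis dvdE)
    define r where "r = - (p * q')"
    have "poly A r = p - p * (q * q')" by (simp add: A r_def algebra_simps)
    then have "poly A r = 0" unfolding q' by simp
    then have root: "poly cubic r = 0" unfolding AB by simp
    have on: "cubic_at x (poly r x) = 0" for x
    proof -
      have "cubic_at x (poly r x) = poly (poly cubic r) x"
        by (simp add: cubic_at_def cubic_def algebra_simps power2_eq_square power3_eq_cube)
      then show ?thesis unfolding root by simp
    qed
    define S where "S = [:12, -8, 1:] - Polynomial.smult 8 r"
    have S: "(poly S x)^2 = (x + 6)^3 * (x - 2)" for x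
      using cubic_discriminant[of x "poly r x"] on[of x] by (simp add: S_def algebra_simps power2_eq_square)
    have "S^2 = [:6, 1:]^3 * [:-2, 1:]"
      by (rule poly_eqI_values) (use S in \<open>simp add: algebra_simps\<close>)
    then have "pderiv (S^2) = pderiv ([:6, 1:]^3 * [:-2, 1:])" by simp
    then have "poly (pderiv (S^2)) 2 = poly (pderiv ([:6, 1:]^3 * [:-2, 1:])) 2" by simp
    moreover have "poly S 2 = 0" using S[of 2] by simp
    then have "poly (pderiv (S^2)) 2 = 0" by (simp add: power2_eq_square pderiv_mult)
    moreover have "poly (pderiv (P * [:-2, 1:])) 2 = poly P 2" for P :: "'k poly"
      unfolding pderiv_mult by (simp add: pderiv_pCons)
    then have "poly (pderiv ([:6, 1:]^3 * [:-2, 1:])) 2 = (8 :: 'k)^3" by simp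
    ultimately have "(8 :: 'k)^3 = 0" by simp
    then have "(8 :: 'k) = 0" unfolding power_eq_0_iff by blast
    moreover have "(8 :: 'k) = 2 * 4" by simp
    ultimately show ?thesis using two four by (metis mult_eq_0_iff)
  qed
qed

lemma cuspidal_cubic:
  assumes "(2 :: 'k::{alg_closed_field, field_gcd}) \<noteq> 0"
  shows "cuspidal_cubic (cubic :: 'k poly poly)"
  unfolding cuspidal_cubic_def
  using total_degree2_cubic[OF assms] irreducible_cubic[OF assms] singular_points_cubic[OF assms] double_tangent_cubic[OF assms]
  by blast

section \<open>Tables with values in a ring\<close>

lemma UNIV_two: "(UNIV :: 2 set) = {0, 1}"
proof -
  have "card {0, 1 :: 2} = card (UNIV :: 2 set)" by simp
  then have "{0, 1 :: 2} = UNIV" by (intro card_subset_eq) auto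
  then show ?thesis by simp
qed

lemma two_cases: "(i :: 2) = 0 \<or> i = 1"
  using UNIV_two by blast

locale K_alg = cring R for R :: "'u ring" (structure) +
  fixes h :: "'k::{alg_closed_field, field_gcd} \<Rightarrow> 'u"
  assumes hom_h: "h \<in> Ring.ring_hom ring_of_type_algebra R"
begin

lemma h_closed [simp, intro]: "h x \<in> carrier R"
  using ring_hom_closed[OF hom_h, of x] by (simp add: ring_of_type_algebra_def)

lemma h_add [simp]: "h (x + y) = h x \<oplus> h y"
  using ring_hom_add[OF hom_h, of x y] by (simp add: ring_of_type_algebra_def)

lemma h_mult [simp]: "h (x * y) = h x \<otimes> h y"
  using ring_hom_mult[OF hom_h, of x y] by (simp add: ring_of_type_algebra_def)

lemma h_1 [simp]: "h 1 = \<one>"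
  using ring_hom_one[OF hom_h] by (simp add: ring_of_type_algebra_def)

lemma h_0 [simp]: "h 0 = \<zero>"
  using h_add[of 0 0] by (metis add.l_cancel_one' add_0 h_closed)

lemma h_minus [simp]: "h (- x) = \<ominus> h x"
  using h_add[of "- x" x] by (intro sum_zero_eq_neg) simp_all

lemma h_diff [simp]: "h (x - y) = h x \<ominus> h y"
  using h_add[of x "- y"] by (simp add: minus_eq del: h_add)

definition table :: "'u pgl2_point \<Rightarrow> bool" where
  "table e \<longleftrightarrow> (\<forall>s t. e s t \<in> carrier R)"

lemma tableD [simp]: "table e \<Longrightarrow> e s t \<in> carrier R"
  unfolding table_def by blast

definition sum4 :: "(2 \<Rightarrow> 2 \<Rightarrow> 'u) \<Rightarrow> 'u" where
  "sum4 f = (f 0 0 \<oplus> f 0 1) \<oplus> (f 1 0 \<oplus> f 1 1)"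

lemma sum4_closed [simp]: "(\<And>m n. f m n \<in> carrier R) \<Longrightarrow> sum4 f \<in> carrier R"
  by (simp add: sum4_def)

lemma finsum_two: "(\<And>m. f m \<in> carrier R) \<Longrightarrow> (\<Oplus>m\<in>(UNIV :: 2 set). f m) = f 0 \<oplus> f 1"
  unfolding UNIV_two by (subst finsum_insert) auto

abbreviation pmul :: "'u pgl2_point \<Rightarrow> 'u pgl2_point \<Rightarrow> 'u pgl2_point" where
  "pmul \<equiv> monoid.mult (PGL2_points R)"

lemma pmul_eq:
  assumes "table e" "table e'"
  shows "pmul e e' (i, j) (k, l) = sum4 (\<lambda>m n. e (i, m) (k, n) \<otimes> e' (m, j) (n, l))"
  using assms by (simp add: PGL2_points_def finsum_two sum4_def a_ac)

lemma table_pmul [simp]: "table e \<Longrightarrow> table e' \<Longrightarrow> table (pmul e e')"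
  by (auto simp: table_def[of "pmul e e'"] pmul_eq)

lemma sum4_mult:
  assumes "\<And>m n. f m n \<in> carrier R" "\<And>m n. g m n \<in> carrier R"
  shows "sum4 f \<otimes> sum4 g = sum4 (\<lambda>m n. sum4 (\<lambda>m' n'. f m n \<otimes> g m' n'))"
  using assms by (simp add: sum4_def l_distr r_distr a_ac)

lemma sum4_mult_right:
  assumes "\<And>m n. f m n \<in> carrier R" "x \<in> carrier R"
  shows "sum4 f \<otimes> x = sum4 (\<lambda>m n. f m n \<otimes> x)"
  using assms by (simp add: sum4_def l_distr)

lemma sum4_mult_left:
  assumes "\<And>m n. f m n \<in> carrier R" "x \<in> carrier R"
  shows "x \<otimes> sum4 f = sum4 (\<lambda>m n. x \<otimes> f m n)"
  using assms by (simp add: sum4_def r_distr)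

lemma sum4_swap:
  assumes "\<And>m n m' n'. f m n m' n' \<in> carrier R"
  shows "sum4 (\<lambda>m n. sum4 (f m n)) = sum4 (\<lambda>m m'. sum4 (\<lambda>n n'. f m n m' n'))"
  using assms by (simp add: sum4_def a_ac)

lemma sum4_swap':
  assumes "\<And>m n m' n'. f m n m' n' \<in> carrier R"
  shows "sum4 (\<lambda>m n. sum4 (f m n)) = sum4 (\<lambda>m' n'. sum4 (\<lambda>m n. f m n m' n'))"
  using assms by (simp add: sum4_def a_ac)

lemma pmul_assoc:
  assumes "table a" "table b" "table c"
  shows "pmul (pmul a b) c = pmul a (pmul b c)"
proof (intro ext)
  fix s t :: "2 \<times> 2"
  obtain i j k l where s: "s = (i, j)" and t: "t = (k, l)" by (metis surj_pair)
  have "pmul (pmul a b) c s t = sum4 (\<lambda>m n. sum4 (\<lambda>m' n'. a (i, m') (k, n') \<otimes> b (m', m) (n', n)) \<otimes> c (m, j) (n, l))"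
    unfolding s t using assms by (simp add: pmul_eq)
  also have "\<dots> = sum4 (\<lambda>m n. sum4 (\<lambda>m' n'. a (i, m') (k, n') \<otimes> (b (m', m) (n', n) \<otimes> c (m, j) (n, l))))"
    using assms by (simp add: sum4_mult_right m_assoc)
  also have "\<dots> = sum4 (\<lambda>m' n'. sum4 (\<lambda>m n. a (i, m') (k, n') \<otimes> (b (m', m) (n', n) \<otimes> c (m, j) (n, l))))"
    using assms by (intro sum4_swap') simp
  also have "\<dots> = pmul a (pmul b c) s t"
    unfolding s t using assms by (simp add: pmul_eq sum4_mult_left)
  finally show "pmul (pmul a b) c s t = pmul a (pmul b c) s t" .
qed

lemma carrier_PGL2_points:
  "e \<in> carrier (PGL2_points R) \<longleftrightarrow> table e \<and> (\<forall>s t. e s t = e t s) \<and>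
    (\<forall>s t s' t'. e s t \<otimes> e s' t' = e s s' \<otimes> e t t') \<and> e (0, 0) (1, 1) \<ominus> e (0, 1) (1, 0) = \<one>"
  by (simp only: PGL2_points_def table_def partial_object.select_convs mem_Collect_eq)

lemma pmul_sym:
  assumes t: "table e" "table e'" and sy: "\<And>s t. e s t = e t s" "\<And>s t. e' s t = e' t s"
  shows "pmul e e' s t = pmul e e' t s"
proof -
  obtain i j k l where s: "s = (i, j)" and tt: "t = (k, l)" by (metis surj_pair)
  have "pmul e e' (k, l) (i, j) = sum4 (\<lambda>m n. e (i, n) (k, m) \<otimes> e' (n, j) (m, l))"
    unfolding pmul_eq[OF t] by (subst sy(1), subst sy(2)) (rule refl)
  also have "\<dots> = sum4 (\<lambda>m n. e (i, m) (k, n) \<otimes> e' (m, j) (n, l))"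
    using t by (simp add: sum4_def a_ac)
  finally show ?thesis unfolding s tt pmul_eq[OF t] ..
qed

text \<open>The defining relations are inherited because the entries of a product table are bilinear
  in those of the factors, and the determinant is multiplicative.\<close>

lemma pmul_closed:
  assumes e: "e \<in> carrier (PGL2_points R)" and e': "e' \<in> carrier (PGL2_points R)"
  shows "pmul e e' \<in> carrier (PGL2_points R)"
proof -
  have t: "table e" "table e'" using e e' unfolding carrier_PGL2_points by blast+
  have sy: "e s t = e t s" "e' s t = e' t s" for s t using e e' unfolding carrier_PGL2_points by blast+
  have sg: "e s t \<otimes> e s' t' = e s s' \<otimes> e t t'" "e' s t \<otimes> e' s' t' = e' s s' \<otimes> e' t t'" for s t s' t'
    using e e' unfolding carrier_PGL2_points by blast+
  have dt: "e (0, 0) (1, 1) \<ominus> e (0, 1) (1, 0) = \<one>" "e' (0, 0) (1, 1) \<ominus> e' (0, 1) (1, 0) = \<one>"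
    using e e' unfolding carrier_PGL2_points by blast+
  have "pmul e e' s t = pmul e e' t s" for s t
    by (rule pmul_sym[OF t sy])
  moreover have "pmul e e' s t \<otimes> pmul e e' s' t' = pmul e e' s s' \<otimes> pmul e e' t t'" for s t s' t'
  proof -
    obtain i j k l where s: "s = (i, j)" and tt: "t = (k, l)" by (metis surj_pair)
    obtain i' j' k' l' where s': "s' = (i', j')" and tt': "t' = (k', l')" by (metis surj_pair)
    have r: "(e (i, m) (k, n) \<otimes> e' (m, j) (n, l)) \<otimes> (e (i', m') (k', n') \<otimes> e' (m', j') (n', l'))
      = (e (i, m) (i', m') \<otimes> e' (m, j) (m', j')) \<otimes> (e (k, n) (k', n') \<otimes> e' (n, l) (n', l'))" for m n m' n'
    proof -
      have "(e (i, m) (k, n) \<otimes> e' (m, j) (n, l)) \<otimes> (e (i', m') (k', n') \<otimes> e' (m', j') (n', l'))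
       = (e (i, m) (k, n) \<otimes> e (i', m') (k', n')) \<otimes> (e' (m, j) (n, l) \<otimes> e' (m', j') (n', l'))"
        using t by (simp add: m_ac)
      also have "\<dots> = (e (i, m) (i', m') \<otimes> e (k, n) (k', n')) \<otimes> (e' (m, j) (m', j') \<otimes> e' (n, l) (n', l'))"
        using sg(1)[of "(i, m)" "(k, n)" "(i', m')" "(k', n')"] sg(2)[of "(m, j)" "(n, l)" "(m', j')" "(n', l')"] by simp
      also have "\<dots> = (e (i, m) (i', m') \<otimes> e' (m, j) (m', j')) \<otimes> (e (k, n) (k', n') \<otimes> e' (n, l) (n', l'))"
        using t by (simp add: m_ac)
      finally show ?thesis .
    qed
    have "pmul e e' s t \<otimes> pmul e e' s' t' = sum4 (\<lambda>m n. sum4 (\<lambda>m' n'.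
       (e (i, m) (k, n) \<otimes> e' (m, j) (n, l)) \<otimes> (e (i', m') (k', n') \<otimes> e' (m', j') (n', l'))))"
      unfolding s tt s' tt' pmul_eq[OF t] using t by (simp add: sum4_mult)
    also have "\<dots> = sum4 (\<lambda>m n. sum4 (\<lambda>m' n'.
       (e (i, m) (i', m') \<otimes> e' (m, j) (m', j')) \<otimes> (e (k, n) (k', n') \<otimes> e' (n, l) (n', l'))))"
      unfolding r ..
    also have "\<dots> = sum4 (\<lambda>m m'. sum4 (\<lambda>n n'.
       (e (i, m) (i', m') \<otimes> e' (m, j) (m', j')) \<otimes> (e (k, n) (k', n') \<otimes> e' (n, l) (n', l'))))"
      using t by (intro sum4_swap) simp
    also have "\<dots> = pmul e e' s s' \<otimes> pmul e e' t t'"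
      unfolding s tt s' tt' pmul_eq[OF t] using t by (simp add: sum4_mult)
    finally show ?thesis .
  qed
  moreover have "pmul e e' (0, 0) (1, 1) \<ominus> pmul e e' (0, 1) (1, 0) = \<one>"
  proof -
    have id: "((x0 \<otimes> y0 \<oplus> x1 \<otimes> y1) \<oplus> (x2 \<otimes> z1 \<oplus> x3 \<otimes> y3)) \<ominus> ((x0 \<otimes> y0 \<oplus> x1 \<otimes> z1) \<oplus> (x2 \<otimes> y1 \<oplus> x3 \<otimes> y3))
      = (x1 \<ominus> x2) \<otimes> (y1 \<ominus> z1)"
      if "x0 \<in> carrier R" "x1 \<in> carrier R" "x2 \<in> carrier R" "x3 \<in> carrier R"
         "y0 \<in> carrier R" "y1 \<in> carrier R" "y3 \<in> carrier R" "z1 \<in> carrier R"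
      for x0 x1 x2 x3 y0 y1 y3 z1
      using that by algebra
    have "pmul e e' (0, 0) (1, 1) \<ominus> pmul e e' (0, 1) (1, 0) =
      (e (0, 0) (1, 1) \<ominus> e (0, 1) (1, 0)) \<otimes> (e' (0, 0) (1, 1) \<ominus> e' (0, 1) (1, 0))"
      unfolding pmul_eq[OF t] sum4_def
      using id[of "e (0, 0) (1, 0)" "e (0, 0) (1, 1)" "e (0, 1) (1, 0)" "e (0, 1) (1, 1)"
        "e' (0, 0) (0, 1)" "e' (0, 0) (1, 1)" "e' (1, 0) (1, 1)" "e' (0, 1) (1, 0)"] t
        sy(2)[of "(0, 1)" "(0, 0)"] sy(2)[of "(1, 1)" "(0, 0)"] sy(2)[of "(1, 0)" "(0, 1)"] sy(2)[of "(1, 1)" "(1, 0)"]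
      by simp
    then show ?thesis using dt by simp
  qed
  ultimately show ?thesis using t by (simp add: carrier_PGL2_points)
qed

lemma one_PGL2_points: "\<one>\<^bsub>PGL2_points R\<^esub> (i, j) (k, l) = (if i = j \<and> k = l then \<one> else \<zero>)"
  by (simp add: PGL2_points_def)

lemma table_one [simp]: "table \<one>\<^bsub>PGL2_points R\<^esub>"
  by (auto simp: table_def one_PGL2_points)

lemma pmul_one:
  assumes "table e"
  shows "pmul \<one>\<^bsub>PGL2_points R\<^esub> e = e" "pmul e \<one>\<^bsub>PGL2_points R\<^esub> = e"
proof -
  have "pmul \<one>\<^bsub>PGL2_points R\<^esub> e (i, j) (k, l) = e (i, j) (k, l)" for i j k l
    using two_cases[of i] two_cases[of k] assms
    by (auto simp: pmul_eq[OF table_one assms] sum4_def one_PGL2_points)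
  then show "pmul \<one>\<^bsub>PGL2_points R\<^esub> e = e" by (intro ext) (metis surj_pair)
  have "pmul e \<one>\<^bsub>PGL2_points R\<^esub> (i, j) (k, l) = e (i, j) (k, l)" for i j k l
    using two_cases[of j] two_cases[of l] assms
    by (auto simp: pmul_eq[OF assms table_one] sum4_def one_PGL2_points)
  then show "pmul e \<one>\<^bsub>PGL2_points R\<^esub> = e" by (intro ext) (metis surj_pair)
qed

section \<open>Constant tables\<close>

definition matrix_entry :: "'k \<Rightarrow> 'k \<Rightarrow> 'k \<Rightarrow> 'k \<Rightarrow> 2 \<times> 2 \<Rightarrow> 'k" where
  "matrix_entry a b c d = (\<lambda>(i, j). if i = 0 then (if j = 0 then a else b) else (if j = 0 then c else d))"

lemma matrix_entry_simps [simp]: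
  "matrix_entry a b c d (0, 0) = a" "matrix_entry a b c d (0, 1) = b" "matrix_entry a b c d (1, 0) = c" "matrix_entry a b c d (1, 1) = d"
  by (simp_all add: matrix_entry_def)

text \<open>The point of \<open>PGL2\<close> given by a matrix over \<open>K\<close> of determinant 1.\<close>

definition const_table :: "'k \<Rightarrow> 'k \<Rightarrow> 'k \<Rightarrow> 'k \<Rightarrow> 'u pgl2_point" where
  "const_table a b c d = (\<lambda>s t. h (matrix_entry a b c d s * matrix_entry a b c d t))"

lemma table_const_table [simp]: "table (const_table a b c d)"
  unfolding table_def const_table_def by (intro allI h_closed)

lemma const_table_closed:
  assumes "a * d - b * c = 1"
  shows "const_table a b c d \<in> carrier (PGL2_points R)"
  unfolding carrier_PGL2_points
proof (intro conjI allI)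
  show "table (const_table a b c d)" by (rule table_const_table)
  show "const_table a b c d (0, 0) (1, 1) \<ominus> const_table a b c d (0, 1) (1, 0) = \<one>"
    using h_diff[of "a * d" "b * c"] unfolding assms by (simp add: const_table_def)
qed (simp_all add: const_table_def m_ac)

lemma const_table_inverse:
  assumes "a * d - b * c = 1"
  shows "pmul (const_table d (-b) (-c) a) (const_table a b c d) = \<one>\<^bsub>PGL2_points R\<^esub>"
proof -
  define M N where "M = matrix_entry d (-b) (-c) a" and "N = matrix_entry a b c d"
  have MN: "M (i, 0) * N (0, j) + M (i, 1) * N (1, j) = (if i = j then 1 else 0)" for i j
    using two_cases[of i] two_cases[of j] assms by (auto simp: M_def N_def matrix_entry_def algebra_simps)
  have "pmul (const_table d (-b) (-c) a) (const_table a b c d) (i, j) (k, l) = \<one>\<^bsub>PGL2_points R\<^esub> (i, j) (k, l)" for i j k l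
  proof -
    have "pmul (const_table d (-b) (-c) a) (const_table a b c d) (i, j) (k, l)
      = h ((M (i, 0) * N (0, j) + M (i, 1) * N (1, j)) * (M (k, 0) * N (0, l) + M (k, 1) * N (1, l)))"
      unfolding pmul_eq[OF table_const_table table_const_table] unfolding sum4_def const_table_def M_def[symmetric] N_def[symmetric]
      by (simp add: l_distr r_distr m_ac a_ac)
    then show ?thesis unfolding MN by (auto simp: one_PGL2_points)
  qed
  then show ?thesis by (intro ext) (metis surj_pair)
qed

section \<open>The commutation relation at constant points\<close>

text \<open>Values at constant points \<open>(x, y)\<close> of the forms that occur in the commutation relation.
  Substituting a constant matrix into a form amounts to evaluating it at another constant point,
  which is simpler than transforming coefficients.\<close>

definition row_product_at :: "'u pgl2_point \<Rightarrow> 2 \<Rightarrow> 2 \<Rightarrow> 'k \<Rightarrow> 'k \<Rightarrow> 'u" where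
  "row_product_at e i j x y = (h (x * x) \<otimes> e (i, 0) (j, 0) \<oplus> h (x * y) \<otimes> (e (i, 0) (j, 1) \<oplus> e (i, 1) (j, 0))) \<oplus> h (y * y) \<otimes> e (i, 1) (j, 1)"

definition subst_form_at :: "'k poly \<Rightarrow> 'u pgl2_point \<Rightarrow> 'k \<Rightarrow> 'k \<Rightarrow> 'u" where
  "subst_form_at F e x y = (h (Polynomial.coeff F 2) \<otimes> row_product_at e 0 0 x y \<oplus> h (Polynomial.coeff F 1) \<otimes> row_product_at e 0 1 x y) \<oplus>
     h (Polynomial.coeff F 0) \<otimes> row_product_at e 1 1 x y"

definition row_applied_at :: "'u pgl2_point \<Rightarrow> 2 \<times> 2 \<Rightarrow> 2 \<Rightarrow> 'k \<Rightarrow> 'k \<Rightarrow> 'u" where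
  "row_applied_at e s i v w = e s (i, 0) \<otimes> h v \<oplus> e s (i, 1) \<otimes> h w"

text \<open>The values of the relation \<open>f \<circ> \<phi> = \<phi> \<circ> f'\<close>. Allowing two
  different maps makes it possible to multiply \<open>\<phi>\<close> by a constant matrix from one side at a
  time.\<close>

definition intertwines :: "'u pgl2_point \<Rightarrow> 'k poly \<Rightarrow> 'k poly \<Rightarrow> 'k poly \<Rightarrow> 'k poly \<Rightarrow> bool" where
  "intertwines e F G F' G' \<longleftrightarrow> (\<forall>x y s.
     subst_form_at F e x y \<otimes> row_applied_at e s 1 (qform F' x y) (qform G' x y) =
     subst_form_at G e x y \<otimes> row_applied_at e s 0 (qform F' x y) (qform G' x y))"

lemma row_product_at_closed [simp]: "table e \<Longrightarrow> row_product_at e i j x y \<in> carrier R"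
  by (simp add: row_product_at_def)

lemma subst_form_at_closed [simp]: "table e \<Longrightarrow> subst_form_at F e x y \<in> carrier R"
  by (simp add: subst_form_at_def)

lemma row_applied_at_closed [simp]: "table e \<Longrightarrow> row_applied_at e s i v w \<in> carrier R"
  by (simp add: row_applied_at_def)

lemma subst_form_at_smult: "table e \<Longrightarrow> subst_form_at (Polynomial.smult k F) e x y = h k \<otimes> subst_form_at F e x y"
  by (simp add: subst_form_at_def r_distr m_assoc)

lemma row_applied_at_scale: "table e \<Longrightarrow> row_applied_at e s i (k * v) (k * w) = h k \<otimes> row_applied_at e s i v w"
  by (simp add: row_applied_at_def r_distr m_ac)

lemma intertwines_smult:
  assumes "table e" "k \<noteq> 0" "k' \<noteq> 0"
  shows "intertwines e (Polynomial.smult k F) (Polynomial.smult k G) (Polynomial.smult k' F') (Polynomial.smult k' G')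
    \<longleftrightarrow> intertwines e F G F' G'"
proof -
  have inv: "h (inverse (k * k')) \<otimes> h (k * k') = \<one>"
  proof -
    have "inverse (k * k') * (k * k') = 1" using assms by (simp add: field_simps)
    then show ?thesis using h_mult[of "inverse (k * k')" "k * k'"] by simp
  qed
  have c: "h (k * k') \<otimes> x = h (k * k') \<otimes> y \<longleftrightarrow> x = y" if "x \<in> carrier R" "y \<in> carrier R" for x y
  proof
    assume "h (k * k') \<otimes> x = h (k * k') \<otimes> y"
    then have "h (inverse (k * k')) \<otimes> (h (k * k') \<otimes> x) = h (inverse (k * k')) \<otimes> (h (k * k') \<otimes> y)" by simp
    then show "x = y" using inv that m_assoc[of "h (inverse (k * k'))" "h (k * k')"] by (simp del: h_mult)
  qed simp
  have e: "subst_form_at (Polynomial.smult k H) e x y \<otimes> row_applied_at e s i (qform (Polynomial.smult k' F') x y) (qform (Polynomial.smult k' G') x y)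
    = h (k * k') \<otimes> (subst_form_at H e x y \<otimes> row_applied_at e s i (qform F' x y) (qform G' x y))" for H x y s i
    using assms(1) by (simp add: subst_form_at_smult row_applied_at_scale m_ac)
  show ?thesis unfolding intertwines_def e using assms(1) by (subst c) auto
qed

lemma row_product_at_pmul_const_table:
  assumes "table e"
  shows "row_product_at (pmul e (const_table a b c d)) i j x y = row_product_at e i j (a * x + b * y) (c * x + d * y)"
proof -
  have id: "((x \<otimes> x) \<otimes> ((u0 \<otimes> (a \<otimes> a) \<oplus> u1 \<otimes> (a \<otimes> c)) \<oplus> (u2 \<otimes> (c \<otimes> a) \<oplus> u3 \<otimes> (c \<otimes> c))) \<oplus>
    (x \<otimes> y) \<otimes> (((u0 \<otimes> (a \<otimes> b) \<oplus> u1 \<otimes> (a \<otimes> d)) \<oplus> (u2 \<otimes> (c \<otimes> b) \<oplus> u3 \<otimes> (c \<otimes> d))) \<oplus>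
      ((u0 \<otimes> (b \<otimes> a) \<oplus> u1 \<otimes> (b \<otimes> c)) \<oplus> (u2 \<otimes> (d \<otimes> a) \<oplus> u3 \<otimes> (d \<otimes> c))))) \<oplus>
    (y \<otimes> y) \<otimes> ((u0 \<otimes> (b \<otimes> b) \<oplus> u1 \<otimes> (b \<otimes> d)) \<oplus> (u2 \<otimes> (d \<otimes> b) \<oplus> u3 \<otimes> (d \<otimes> d))) =
    (((a \<otimes> x \<oplus> b \<otimes> y) \<otimes> (a \<otimes> x \<oplus> b \<otimes> y)) \<otimes> u0 \<oplus>
     ((a \<otimes> x \<oplus> b \<otimes> y) \<otimes> (c \<otimes> x \<oplus> d \<otimes> y)) \<otimes> (u1 \<oplus> u2)) \<oplus>
    ((c \<otimes> x \<oplus> d \<otimes> y) \<otimes> (c \<otimes> x \<oplus> d \<otimes> y)) \<otimes> u3"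
    if "x \<in> carrier R" "y \<in> carrier R" "a \<in> carrier R" "b \<in> carrier R" "c \<in> carrier R" "d \<in> carrier R"
      "u0 \<in> carrier R" "u1 \<in> carrier R" "u2 \<in> carrier R" "u3 \<in> carrier R" for x y a b c d u0 u1 u2 u3
    using that by (simp add: l_distr r_distr m_ac a_ac)
  show ?thesis unfolding row_product_at_def pmul_eq[OF assms table_const_table] unfolding sum4_def
    using id[of "h x" "h y" "h a" "h b" "h c" "h d" "e (i, 0) (j, 0)" "e (i, 0) (j, 1)" "e (i, 1) (j, 0)" "e (i, 1) (j, 1)"] assms
    by (simp add: const_table_def)
qed

lemma row_applied_at_pmul_const_table:
  assumes "table e"
  shows "row_applied_at (pmul e (const_table a b c d)) (s, t) i v w =
    h (matrix_entry a b c d (0, t)) \<otimes> row_applied_at e (s, 0) i (a * v + b * w) (c * v + d * w) \<oplus>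
    h (matrix_entry a b c d (1, t)) \<otimes> row_applied_at e (s, 1) i (a * v + b * w) (c * v + d * w)"
proof -
  have id: "((u0 \<otimes> (p \<otimes> a) \<oplus> u1 \<otimes> (p \<otimes> c)) \<oplus> (u2 \<otimes> (q \<otimes> a) \<oplus> u3 \<otimes> (q \<otimes> c))) \<otimes> v \<oplus>
     ((u0 \<otimes> (p \<otimes> b) \<oplus> u1 \<otimes> (p \<otimes> d)) \<oplus> (u2 \<otimes> (q \<otimes> b) \<oplus> u3 \<otimes> (q \<otimes> d))) \<otimes> w =
    p \<otimes> (u0 \<otimes> (a \<otimes> v \<oplus> b \<otimes> w) \<oplus> u1 \<otimes> (c \<otimes> v \<oplus> d \<otimes> w)) \<oplus>
    q \<otimes> (u2 \<otimes> (a \<otimes> v \<oplus> b \<otimes> w) \<oplus> u3 \<otimes> (c \<otimes> v \<oplus> d \<otimes> w))"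
    if "v \<in> carrier R" "w \<in> carrier R" "p \<in> carrier R" "q \<in> carrier R" "a \<in> carrier R" "b \<in> carrier R" "c \<in> carrier R" "d \<in> carrier R"
      "u0 \<in> carrier R" "u1 \<in> carrier R" "u2 \<in> carrier R" "u3 \<in> carrier R" for v w p q a b c d u0 u1 u2 u3
    using that by (simp add: l_distr r_distr m_ac a_ac)
  show ?thesis unfolding row_applied_at_def pmul_eq[OF assms table_const_table] unfolding sum4_def const_table_def h_mult h_add matrix_entry_simps
    using id[of "h v" "h w" "h (matrix_entry a b c d (0, t))" "h (matrix_entry a b c d (1, t))" "h a" "h b" "h c" "h d"
      "e (s, 0) (i, 0)" "e (s, 0) (i, 1)" "e (s, 1) (i, 0)" "e (s, 1) (i, 1)"] assms
    by simp
qed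

text \<open>If \<open>f \<circ> \<phi> = \<phi> \<circ> f'\<close> and \<open>f''\<close> is the conjugate of \<open>f'\<close> by a
  constant \<open>\<alpha>\<close>, then
  \<open>f \<circ> (\<phi> \<circ> \<alpha>) = (\<phi> \<circ> \<alpha>) \<circ> f''\<close>.\<close>

lemma intertwines_pmul_const_table:
  assumes e: "table e" and c: "intertwines e F G F' G'" and D: "a * d - b * c = 1"
  shows "intertwines (pmul e (const_table a b c d)) F G (conj_num a b c d F' G') (conj_den a b c d F' G')"
  unfolding intertwines_def
proof (intro allI)
  fix x y and s :: "2 \<times> 2"
  obtain i j where s: "s = (i, j)" by fastforce
  let ?X = "a * x + b * y" and ?Y = "c * x + d * y"
  let ?F = "qform (conj_num a b c d F' G') x y" and ?G = "qform (conj_den a b c d F' G') x y"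
  have "a * ?F + b * ?G = (a * d - b * c) * qform F' ?X ?Y" "c * ?F + d * ?G = (a * d - b * c) * qform G' ?X ?Y"
    by (simp_all add: conj_num_def conj_den_def algebra_simps)
  then have FG: "a * ?F + b * ?G = qform F' ?X ?Y" "c * ?F + d * ?G = qform G' ?X ?Y" unfolding D by simp_all
  have f: "subst_form_at H (pmul e (const_table a b c d)) x y = subst_form_at H e ?X ?Y" for H
    unfolding subst_form_at_def row_product_at_pmul_const_table[OF e] ..
  let ?r = "\<lambda>t k. row_applied_at e (i, t) k (qform F' ?X ?Y) (qform G' ?X ?Y)"
  have r: "subst_form_at F e ?X ?Y \<otimes> ?r t 1 = subst_form_at G e ?X ?Y \<otimes> ?r t 0" for t
    using c unfolding intertwines_def by blast
  let ?p = "h (matrix_entry a b c d (0, j))" and ?q = "h (matrix_entry a b c d (1, j))"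
  have lin: "subst_form_at H e ?X ?Y \<otimes> (?p \<otimes> ?r 0 k \<oplus> ?q \<otimes> ?r 1 k) =
     ?p \<otimes> (subst_form_at H e ?X ?Y \<otimes> ?r 0 k) \<oplus> ?q \<otimes> (subst_form_at H e ?X ?Y \<otimes> ?r 1 k)" for H k
    using e by (simp add: r_distr m_lcomm)
  show "subst_form_at F (pmul e (const_table a b c d)) x y \<otimes> row_applied_at (pmul e (const_table a b c d)) s 1 ?F ?G =
     subst_form_at G (pmul e (const_table a b c d)) x y \<otimes> row_applied_at (pmul e (const_table a b c d)) s 0 ?F ?G"
    unfolding s f row_applied_at_pmul_const_table[OF e] FG lin r ..
qed

lemma row_product_at_const_table_pmul:
  assumes "table e"
  shows "row_product_at (pmul (const_table a b c d) e) i j x y =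
    sum4 (\<lambda>m n. h (matrix_entry a b c d (i, m) * matrix_entry a b c d (j, n)) \<otimes> row_product_at e m n x y)"
  unfolding row_product_at_def pmul_eq[OF table_const_table assms] unfolding sum4_def const_table_def
  using assms by (simp add: r_distr m_ac a_ac)

lemma row_applied_at_const_table_pmul:
  assumes "table e"
  shows "row_applied_at (pmul (const_table a b c d) e) (s, t) i v w =
    sum4 (\<lambda>m n. h (matrix_entry a b c d (s, m) * matrix_entry a b c d (i, n)) \<otimes> row_applied_at e (m, t) n v w)"
  unfolding row_applied_at_def pmul_eq[OF table_const_table assms] unfolding sum4_def const_table_def
  using assms by (simp add: l_distr r_distr m_ac a_ac)

lemma row_product_at_sym: "table e \<Longrightarrow> (\<And>s t. e s t = e t s) \<Longrightarrow> row_product_at e 1 0 x y = row_product_at e 0 1 x y"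
  unfolding row_product_at_def by (simp add: a_ac)

lemma subst_form_at_qsub:
  assumes e: "table e" and sym: "\<And>s t. e s t = e t s"
  shows "subst_form_at (qsub a b c d F) e x y = subst_form_at F (pmul (const_table a b c d) e) x y"
proof -
  have id: "(((f2 \<otimes> (a \<otimes> a) \<oplus> f1 \<otimes> (a \<otimes> c)) \<oplus> f0 \<otimes> (c \<otimes> c)) \<otimes> u \<oplus>
     (((f2 \<oplus> f2) \<otimes> (a \<otimes> b) \<oplus> f1 \<otimes> (a \<otimes> d \<oplus> b \<otimes> c)) \<oplus> (f0 \<oplus> f0) \<otimes> (c \<otimes> d)) \<otimes> v) \<oplus>
     ((f2 \<otimes> (b \<otimes> b) \<oplus> f1 \<otimes> (b \<otimes> d)) \<oplus> f0 \<otimes> (d \<otimes> d)) \<otimes> w =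
     (f2 \<otimes> ((a \<otimes> a \<otimes> u \<oplus> a \<otimes> b \<otimes> v) \<oplus> (b \<otimes> a \<otimes> v \<oplus> b \<otimes> b \<otimes> w)) \<oplus>
      f1 \<otimes> ((a \<otimes> c \<otimes> u \<oplus> a \<otimes> d \<otimes> v) \<oplus> (b \<otimes> c \<otimes> v \<oplus> b \<otimes> d \<otimes> w))) \<oplus>
      f0 \<otimes> ((c \<otimes> c \<otimes> u \<oplus> c \<otimes> d \<otimes> v) \<oplus> (d \<otimes> c \<otimes> v \<oplus> d \<otimes> d \<otimes> w))"
    if "a \<in> carrier R" "b \<in> carrier R" "c \<in> carrier R" "d \<in> carrier R" "u \<in> carrier R" "v \<in> carrier R" "w \<in> carrier R"
      "f0 \<in> carrier R" "f1 \<in> carrier R" "f2 \<in> carrier R" for a b c d u v w f0 f1 f2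
    using that by (simp add: l_distr r_distr m_ac a_ac)
  define f0 f1 f2 where f: "f0 = Polynomial.coeff F 0" "f1 = Polynomial.coeff F 1" "f2 = Polynomial.coeff F 2"
  have co: "h (Polynomial.coeff (qsub a b c d F) 2) = (h f2 \<otimes> (h a \<otimes> h a) \<oplus> h f1 \<otimes> (h a \<otimes> h c)) \<oplus> h f0 \<otimes> (h c \<otimes> h c)"
    "h (Polynomial.coeff (qsub a b c d F) 1) = ((h f2 \<oplus> h f2) \<otimes> (h a \<otimes> h b) \<oplus> h f1 \<otimes> (h a \<otimes> h d \<oplus> h b \<otimes> h c)) \<oplus> (h f0 \<oplus> h f0) \<otimes> (h c \<otimes> h d)"
    "h (Polynomial.coeff (qsub a b c d F) 0) = (h f2 \<otimes> (h b \<otimes> h b) \<oplus> h f1 \<otimes> (h b \<otimes> h d)) \<oplus> h f0 \<otimes> (h d \<otimes> h d)"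
  proof -
    show "h (Polynomial.coeff (qsub a b c d F) 2) = (h f2 \<otimes> (h a \<otimes> h a) \<oplus> h f1 \<otimes> (h a \<otimes> h c)) \<oplus> h f0 \<otimes> (h c \<otimes> h c)"
      "h (Polynomial.coeff (qsub a b c d F) 0) = (h f2 \<otimes> (h b \<otimes> h b) \<oplus> h f1 \<otimes> (h b \<otimes> h d)) \<oplus> h f0 \<otimes> (h d \<otimes> h d)"
      by (simp_all add: qsub_def qform_def f numeral_2_eq_2 m_assoc)
    show "h (Polynomial.coeff (qsub a b c d F) 1) = ((h f2 \<oplus> h f2) \<otimes> (h a \<otimes> h b) \<oplus> h f1 \<otimes> (h a \<otimes> h d \<oplus> h b \<otimes> h c)) \<oplus> (h f0 \<oplus> h f0) \<otimes> (h c \<otimes> h d)"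
    proof -
      have "Polynomial.coeff (qsub a b c d F) 1 = ((f2 + f2) * (a * b) + f1 * (a * d + b * c)) + (f0 + f0) * (c * d)"
        by (simp add: qsub_def f algebra_simps)
      then show ?thesis by (simp only: h_add h_mult)
    qed
  qed
  note s = row_product_at_sym[OF e sym]
  have rows: "row_product_at (pmul (const_table a b c d) e) 0 0 x y =
      (h a \<otimes> h a \<otimes> row_product_at e 0 0 x y \<oplus> h a \<otimes> h b \<otimes> row_product_at e 0 1 x y) \<oplus> (h b \<otimes> h a \<otimes> row_product_at e 0 1 x y \<oplus> h b \<otimes> h b \<otimes> row_product_at e 1 1 x y)"
    "row_product_at (pmul (const_table a b c d) e) 0 1 x y =
      (h a \<otimes> h c \<otimes> row_product_at e 0 0 x y \<oplus> h a \<otimes> h d \<otimes> row_product_at e 0 1 x y) \<oplus> (h b \<otimes> h c \<otimes> row_product_at e 0 1 x y \<oplus> h b \<otimes> h d \<otimes> row_product_at e 1 1 x y)"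
    "row_product_at (pmul (const_table a b c d) e) 1 1 x y =
      (h c \<otimes> h c \<otimes> row_product_at e 0 0 x y \<oplus> h c \<otimes> h d \<otimes> row_product_at e 0 1 x y) \<oplus> (h d \<otimes> h c \<otimes> row_product_at e 0 1 x y \<oplus> h d \<otimes> h d \<otimes> row_product_at e 1 1 x y)"
    unfolding row_product_at_const_table_pmul[OF e] sum4_def s by (simp_all only: matrix_entry_simps h_mult)
  show ?thesis unfolding subst_form_at_def[of "qsub a b c d F"] subst_form_at_def[of F] co rows f[symmetric]
    by (rule id) (use e in simp_all)
qed

lemma subst_form_at_diff_smult:
  assumes "table e"
  shows "subst_form_at (Polynomial.smult k F - Polynomial.smult l G) e x y = h k \<otimes> subst_form_at F e x y \<ominus> h l \<otimes> subst_form_at G e x y"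
proof -
  have id: "((k \<otimes> f2 \<ominus> l \<otimes> g2) \<otimes> u \<oplus> (k \<otimes> f1 \<ominus> l \<otimes> g1) \<otimes> v) \<oplus> (k \<otimes> f0 \<ominus> l \<otimes> g0) \<otimes> w =
    k \<otimes> ((f2 \<otimes> u \<oplus> f1 \<otimes> v) \<oplus> f0 \<otimes> w) \<ominus> l \<otimes> ((g2 \<otimes> u \<oplus> g1 \<otimes> v) \<oplus> g0 \<otimes> w)"
    if "k \<in> carrier R" "l \<in> carrier R" "u \<in> carrier R" "v \<in> carrier R" "w \<in> carrier R"
      "f0 \<in> carrier R" "f1 \<in> carrier R" "f2 \<in> carrier R" "g0 \<in> carrier R" "g1 \<in> carrier R" "g2 \<in> carrier R"
    for k l u v w f0 f1 f2 g0 g1 g2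
    using that by (simp add: minus_eq l_distr r_distr l_minus r_minus minus_add m_ac a_ac)
  show ?thesis unfolding subst_form_at_def coeff_diff coeff_smult h_diff h_mult
    using assms by (intro id) simp_all
qed

text \<open>If \<open>f \<circ> \<phi> = \<phi> \<circ> f'\<close> and \<open>f''\<close> is the conjugate of \<open>f\<close> by a
  constant \<open>\<alpha>\<close>, then
  \<open>f'' \<circ> (\<alpha>\<^sup>-\<^sup>1 \<circ> \<phi>) = (\<alpha>\<^sup>-\<^sup>1 \<circ> \<phi>) \<circ> f'\<close>.\<close>

lemma intertwines_const_table_pmul:
  assumes e: "table e" and sym: "\<And>s t. e s t = e t s" and c: "intertwines e F G F' G'" and D: "a * d - b * c = 1"
  shows "intertwines (pmul (const_table d (-b) (-c) a) e) (conj_num a b c d F G) (conj_den a b c d F G) F' G'"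
  unfolding intertwines_def
proof (intro allI)
  fix x y and s :: "2 \<times> 2"
  obtain i j where s: "s = (i, j)" by fastforce
  let ?e = "pmul (const_table d (-b) (-c) a) e"
  have te: "table ?e" using e by simp
  let ?F = "subst_form_at F e x y" and ?G = "subst_form_at G e x y"
  have sym': "?e s t = ?e t s" for s t
    by (rule pmul_sym[OF table_const_table e _ sym]) (simp add: const_table_def m_comm)
  have "a * d - (- b) * (- c) = 1" "d * a - (- b) * (- c) = 1" using D by (simp_all add: mult.commute)
  then have undo: "pmul (const_table a b c d) ?e = e"
    using const_table_inverse[of d a "-b" "-c"] e by (simp add: pmul_assoc[symmetric] pmul_one)
  have f: "subst_form_at (conj_num a b c d F G) ?e x y = h d \<otimes> ?F \<ominus> h b \<otimes> ?G"
    "subst_form_at (conj_den a b c d F G) ?e x y = h a \<otimes> ?G \<ominus> h c \<otimes> ?F"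
    unfolding conj_num_def conj_den_def subst_form_at_diff_smult[OF te] subst_form_at_qsub[OF te sym'] undo by (rule refl)+
  let ?r = "\<lambda>m n. row_applied_at e (m, j) n (qform F' x y) (qform G' x y)"
  have r: "?F \<otimes> ?r m 1 = ?G \<otimes> ?r m 0" for m
    using c unfolding intertwines_def by blast
  let ?p = "h (matrix_entry d (-b) (-c) a (i, 0))" and ?q = "h (matrix_entry d (-b) (-c) a (i, 1))"
  let ?s0 = "\<lambda>m. h d \<otimes> ?r m 0 \<oplus> (\<ominus> h b) \<otimes> ?r m 1"
  let ?s1 = "\<lambda>m. (\<ominus> h c) \<otimes> ?r m 0 \<oplus> h a \<otimes> ?r m 1"
  have r0: "row_applied_at ?e (i, j) 0 (qform F' x y) (qform G' x y) = ?p \<otimes> ?s0 0 \<oplus> ?q \<otimes> ?s0 1"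
   and r1: "row_applied_at ?e (i, j) 1 (qform F' x y) (qform G' x y) = ?p \<otimes> ?s1 0 \<oplus> ?q \<otimes> ?s1 1"
    unfolding row_applied_at_const_table_pmul[OF e] sum4_def matrix_entry_simps h_mult h_minus
    using e by (simp_all add: r_distr m_assoc r_minus l_minus)
  have id: "(d \<otimes> F \<ominus> b \<otimes> G) \<otimes> ((\<ominus> c) \<otimes> u \<oplus> a \<otimes> v) = (a \<otimes> d \<otimes> (F \<otimes> v) \<oplus> b \<otimes> c \<otimes> (G \<otimes> u)) \<ominus> (c \<otimes> d \<otimes> (F \<otimes> u) \<oplus> a \<otimes> b \<otimes> (G \<otimes> v))"
    "(a \<otimes> G \<ominus> c \<otimes> F) \<otimes> (d \<otimes> u \<oplus> (\<ominus> b) \<otimes> v) = (a \<otimes> d \<otimes> (G \<otimes> u) \<oplus> b \<otimes> c \<otimes> (F \<otimes> v)) \<ominus> (c \<otimes> d \<otimes> (F \<otimes> u) \<oplus> a \<otimes> b \<otimes> (G \<otimes> v))"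
    if "a \<in> carrier R" "b \<in> carrier R" "c \<in> carrier R" "d \<in> carrier R" "F \<in> carrier R" "G \<in> carrier R"
      "u \<in> carrier R" "v \<in> carrier R" for a b c d F G u v
    using that by (simp_all add: minus_eq l_distr r_distr l_minus r_minus minus_add m_ac a_ac)
  have m: "(h d \<otimes> ?F \<ominus> h b \<otimes> ?G) \<otimes> ?s1 m = (h a \<otimes> ?G \<ominus> h c \<otimes> ?F) \<otimes> ?s0 m" for m
    using e by (simp only: id subst_form_at_closed row_applied_at_closed h_closed r)
  have "(h d \<otimes> ?F \<ominus> h b \<otimes> ?G) \<otimes> row_applied_at ?e (i, j) 1 (qform F' x y) (qform G' x y) =
    (h a \<otimes> ?G \<ominus> h c \<otimes> ?F) \<otimes> row_applied_at ?e (i, j) 0 (qform F' x y) (qform G' x y)"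
  proof -
    have lin: "z \<otimes> (?p \<otimes> u \<oplus> ?q \<otimes> v) = ?p \<otimes> (z \<otimes> u) \<oplus> ?q \<otimes> (z \<otimes> v)"
      if "z \<in> carrier R" "u \<in> carrier R" "v \<in> carrier R" for z u v
      using that by (simp add: r_distr m_lcomm)
    have c: "h d \<otimes> ?F \<ominus> h b \<otimes> ?G \<in> carrier R" "h a \<otimes> ?G \<ominus> h c \<otimes> ?F \<in> carrier R" "?s0 m \<in> carrier R" "?s1 m \<in> carrier R" for m
      using e by simp_all
    show ?thesis unfolding r0 r1 lin[OF c(1) c(4) c(4)] lin[OF c(2) c(3) c(3)] m ..
  qed
  then show "subst_form_at (conj_num a b c d F G) ?e x y \<otimes> row_applied_at ?e s 1 (qform F' x y) (qform G' x y) =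
    subst_form_at (conj_den a b c d F G) ?e x y \<otimes> row_applied_at ?e s 0 (qform F' x y) (qform G' x y)"
    unfolding s f .
qed

end

lemma char2_root_of_unity_relation:
  "(2 :: 'a::field) = 0 \<Longrightarrow> w * w + w + 1 = 0 \<Longrightarrow> w * w = w + (1 :: 'a)"
  using char2_neg[of "w + 1"] by (metis add.assoc eq_neg_iff_add_eq_0)

lemma char2_cube_root:
  assumes two: "(2 :: 'a::field) = 0" and w: "w * w + w + 1 = (0 :: 'a)"
  shows "w^2 = w + 1" "w^3 = 1" "(w + 1)^2 = w" "(w + 1)^3 = 1"
proof -
  have w2: "w * w = w + 1" using char2_root_of_unity_relation[OF two w] .
  then show "w^2 = w + 1" by (simp add: power2_eq_square)
  have "w^3 = w * (w * w)" by (simp add: power3_eq_cube mult.assoc)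
  also have "\<dots> = w * (w + 1)" by (simp only: w2)
  also have "\<dots> = w * w + w" by (simp add: algebra_simps)
  also have "\<dots> = 2 * w + 1" by (simp only: w2) simp
  finally show w3: "w^3 = 1" using two by simp
  have "(w + 1)^2 = w * w + 1 + 2 * w" by (simp add: power2_eq_square algebra_simps)
  also have "\<dots> = w + 2" unfolding w2 using two by simp
  finally show v2: "(w + 1)^2 = w" using two by simp
  have "(w + 1)^3 = (w + 1)^2 * (w + 1)" by (simp add: power3_eq_cube power2_eq_square)
  also have "\<dots> = w * (w + 1)" by (simp only: v2)
  also have "\<dots> = w^3" unfolding \<open>w^3 = w * (w * w)\<close> w2 ..
  finally show "(w + 1)^3 = 1" using w3 by simp
qed

context K_alg
begin

section \<open>Coefficients and values of the commutation relation\<close>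

definition comm_forms :: "'u pgl2_point \<Rightarrow> 'k poly \<Rightarrow> 'k poly \<Rightarrow> bool" where
  "comm_forms e F G \<longleftrightarrow> (\<forall>s. form_mult R (subst_form R h F e) (row_applied R h F G e s 1) =
     form_mult R (subst_form R h G e) (row_applied R h F G e s 0))"

lemma commutes_with_iff: "commutes_with R h f e \<longleftrightarrow> comm_forms e (rat_num f) (rat_den f)"
  by (simp add: commutes_with_def comm_forms_def Let_def)

definition quad_coeffs :: "(nat \<Rightarrow> 'u) \<Rightarrow> bool" where
  "quad_coeffs A \<longleftrightarrow> (\<forall>n. A n \<in> carrier R) \<and> (\<forall>n > 2. A n = \<zero>)"

lemma form_mult_quad:
  assumes "quad_coeffs A" "quad_coeffs B"
  shows "form_mult R A B 0 = A 0 \<otimes> B 0"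
    "form_mult R A B 1 = A 0 \<otimes> B 1 \<oplus> A 1 \<otimes> B 0"
    "form_mult R A B 2 = (A 0 \<otimes> B 2 \<oplus> A 1 \<otimes> B 1) \<oplus> A 2 \<otimes> B 0"
    "form_mult R A B 3 = A 1 \<otimes> B 2 \<oplus> A 2 \<otimes> B 1"
    "form_mult R A B 4 = A 2 \<otimes> B 2"
    "n > 4 \<Longrightarrow> form_mult R A B n = \<zero>"
proof -
  have c [simp]: "A n \<in> carrier R" "B n \<in> carrier R" for n using assms by (auto simp: quad_coeffs_def)
  have z: "n > 2 \<Longrightarrow> A n = \<zero>" "n > 2 \<Longrightarrow> B n = \<zero>" for n using assms by (auto simp: quad_coeffs_def)
  have sets: "{..0} = {0::nat}" "{..1} = {0, 1::nat}" "{..2} = {0, 1, 2::nat}" "{..3} = {0, 1, 2, 3::nat}" "{..4} = {0, 1, 2, 3, 4::nat}"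
    by auto
  show "form_mult R A B 0 = A 0 \<otimes> B 0" "form_mult R A B 1 = A 0 \<otimes> B 1 \<oplus> A 1 \<otimes> B 0"
    "form_mult R A B 2 = (A 0 \<otimes> B 2 \<oplus> A 1 \<otimes> B 1) \<oplus> A 2 \<otimes> B 0"
    "form_mult R A B 3 = A 1 \<otimes> B 2 \<oplus> A 2 \<otimes> B 1" "form_mult R A B 4 = A 2 \<otimes> B 2"
    unfolding form_mult_def sets by (simp_all add: a_assoc z)
  show "form_mult R A B n = \<zero>" if "n > 4"
    unfolding form_mult_def
  proof (rule add.finprod_one_eqI)
    fix i assume "i \<in> {..n}"
    have "i > 2 \<or> n - i > 2" using that by linarith
    then show "A i \<otimes> B (n - i) = \<zero>" using z by auto
  qed
qed

definition quad_at :: "(nat \<Rightarrow> 'u) \<Rightarrow> 'k \<Rightarrow> 'k \<Rightarrow> 'u" where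
  "quad_at A x y = (h (x * x) \<otimes> A 2 \<oplus> h (x * y) \<otimes> A 1) \<oplus> h (y * y) \<otimes> A 0"

lemma quad_at_mult:
  assumes "quad_coeffs A" "quad_coeffs B"
  shows "quad_at A x y \<otimes> quad_at B x y =
    (((h (x^4) \<otimes> form_mult R A B 4 \<oplus> h (x^3 * y) \<otimes> form_mult R A B 3) \<oplus> h (x^2 * y^2) \<otimes> form_mult R A B 2) \<oplus>
      h (x * y^3) \<otimes> form_mult R A B 1) \<oplus> h (y^4) \<otimes> form_mult R A B 0"
proof -
  have id: "(((x \<otimes> x) \<otimes> a2 \<oplus> (x \<otimes> y) \<otimes> a1) \<oplus> (y \<otimes> y) \<otimes> a0) \<otimes> (((x \<otimes> x) \<otimes> b2 \<oplus> (x \<otimes> y) \<otimes> b1) \<oplus> (y \<otimes> y) \<otimes> b0) =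
    ((((x \<otimes> (x \<otimes> (x \<otimes> x))) \<otimes> (a2 \<otimes> b2) \<oplus> ((x \<otimes> (x \<otimes> x)) \<otimes> y) \<otimes> (a1 \<otimes> b2 \<oplus> a2 \<otimes> b1)) \<oplus>
      ((x \<otimes> x) \<otimes> (y \<otimes> y)) \<otimes> ((a0 \<otimes> b2 \<oplus> a1 \<otimes> b1) \<oplus> a2 \<otimes> b0)) \<oplus>
      (x \<otimes> (y \<otimes> (y \<otimes> y))) \<otimes> (a0 \<otimes> b1 \<oplus> a1 \<otimes> b0)) \<oplus> (y \<otimes> (y \<otimes> (y \<otimes> y))) \<otimes> (a0 \<otimes> b0)"
    if "x \<in> carrier R" "y \<in> carrier R" "a0 \<in> carrier R" "a1 \<in> carrier R" "a2 \<in> carrier R"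
      "b0 \<in> carrier R" "b1 \<in> carrier R" "b2 \<in> carrier R" for x y a0 a1 a2 b0 b1 b2
    using that by (simp add: l_distr r_distr m_ac a_ac)
  have p: "z^4 = z * (z * (z * z))" "z^3 = z * (z * z)" "z^2 = z * z" for z :: 'k
    by (simp_all add: power4_eq_xxxx power3_eq_cube power2_eq_square mult.assoc)
  show ?thesis unfolding quad_at_def form_mult_quad[OF assms] p h_mult
    by (rule id) (use assms in \<open>simp_all add: quad_coeffs_def\<close>)
qed

lemma quad_coeffs_subst_form: "table e \<Longrightarrow> quad_coeffs (subst_form R h F e)"
  by (auto simp: quad_coeffs_def subst_form_def row_product_def)

lemma quad_coeffs_row_applied:
  "table e \<Longrightarrow> Polynomial.degree F \<le> 2 \<Longrightarrow> Polynomial.degree G \<le> 2 \<Longrightarrow> quad_coeffs (row_applied R h F G e s i)"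
  by (auto simp: quad_coeffs_def row_applied_def coeff_eq_0)

lemma quad_at_subst_form:
  assumes "table e" shows "quad_at (subst_form R h F e) x y = subst_form_at F e x y"
proof -
  have id: "(xx \<otimes> ((f2 \<otimes> u2 \<oplus> f1 \<otimes> v2) \<oplus> f0 \<otimes> w2) \<oplus> xy \<otimes> ((f2 \<otimes> u1 \<oplus> f1 \<otimes> v1) \<oplus> f0 \<otimes> w1)) \<oplus> yy \<otimes> ((f2 \<otimes> u0 \<oplus> f1 \<otimes> v0) \<oplus> f0 \<otimes> w0)
    = (f2 \<otimes> ((xx \<otimes> u2 \<oplus> xy \<otimes> u1) \<oplus> yy \<otimes> u0) \<oplus> f1 \<otimes> ((xx \<otimes> v2 \<oplus> xy \<otimes> v1) \<oplus> yy \<otimes> v0)) \<oplus> f0 \<otimes> ((xx \<otimes> w2 \<oplus> xy \<otimes> w1) \<oplus> yy \<otimes> w0)"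
    if "xx \<in> carrier R" "xy \<in> carrier R" "yy \<in> carrier R" "f0 \<in> carrier R" "f1 \<in> carrier R" "f2 \<in> carrier R"
      "u0 \<in> carrier R" "u1 \<in> carrier R" "u2 \<in> carrier R" "v0 \<in> carrier R" "v1 \<in> carrier R" "v2 \<in> carrier R"
      "w0 \<in> carrier R" "w1 \<in> carrier R" "w2 \<in> carrier R"
    for xx xy yy f0 f1 f2 u0 u1 u2 v0 v1 v2 w0 w1 w2
    using that by (simp add: l_distr r_distr m_ac a_ac)
  have rp: "row_product R e i j 2 = e (i, 0) (j, 0)" "row_product R e i j 1 = e (i, 0) (j, 1) \<oplus> e (i, 1) (j, 0)"
    "row_product R e i j 0 = e (i, 1) (j, 1)" for i j
    by (simp_all add: row_product_def)
  show ?thesis unfolding quad_at_def subst_form_def subst_form_at_def row_product_at_def rp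
    by (rule id) (use assms in simp_all)
qed

lemma quad_at_row_applied:
  assumes "table e" shows "quad_at (row_applied R h F G e s i) x y = row_applied_at e s i (qform F x y) (qform G x y)"
proof -
  have id: "((x \<otimes> x) \<otimes> (u \<otimes> f2 \<oplus> v \<otimes> g2) \<oplus> (x \<otimes> y) \<otimes> (u \<otimes> f1 \<oplus> v \<otimes> g1)) \<oplus> (y \<otimes> y) \<otimes> (u \<otimes> f0 \<oplus> v \<otimes> g0) =
    u \<otimes> ((f2 \<otimes> (x \<otimes> x) \<oplus> (f1 \<otimes> x) \<otimes> y) \<oplus> f0 \<otimes> (y \<otimes> y)) \<oplus> v \<otimes> ((g2 \<otimes> (x \<otimes> x) \<oplus> (g1 \<otimes> x) \<otimes> y) \<oplus> g0 \<otimes> (y \<otimes> y))"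
    if "x \<in> carrier R" "y \<in> carrier R" "u \<in> carrier R" "v \<in> carrier R" "f0 \<in> carrier R" "f1 \<in> carrier R" "f2 \<in> carrier R"
     "g0 \<in> carrier R" "g1 \<in> carrier R" "g2 \<in> carrier R" for x y u v f0 f1 f2 g0 g1 g2
    using that by (simp add: l_distr r_distr m_ac a_ac)
  show ?thesis unfolding quad_at_def row_applied_def row_applied_at_def qform_def power2_eq_square h_mult h_add
    by (rule id) (use assms in simp_all)
qed

lemma char2_self_add:
  assumes two: "(2 :: 'k) = 0" and x: "x \<in> carrier R"
  shows "x \<oplus> x = \<zero>"
proof -
  have "(1 :: 'k) + 1 = 0" using two by simp
  then have "\<one> \<oplus> \<one> = \<zero>" using h_add[of 1 1] by simp
  moreover have "x \<oplus> x = (\<one> \<oplus> \<one>) \<otimes> x" using x by (simp add: l_distr)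
  ultimately show ?thesis using x by simp
qed

text \<open>The points \<open>0\<close>, \<open>\<infinity>\<close> and the three cube roots of unity are the projective line
  over the field with four elements. Five distinct points determine a quartic form, also one with
  values in a \<open>K\<close>-algebra, since the linear system for its coefficients has an invertible
  determinant in \<open>K\<close>.\<close>

lemma quartic_zero:
  assumes two: "(2 :: 'k) = 0"
    and c: "d0 \<in> carrier R" "d1 \<in> carrier R" "d2 \<in> carrier R" "d3 \<in> carrier R" "d4 \<in> carrier R"
    and z: "\<And>x y. (((h (x^4) \<otimes> d4 \<oplus> h (x^3 * y) \<otimes> d3) \<oplus> h (x^2 * y^2) \<otimes> d2) \<oplus> h (x * y^3) \<otimes> d1) \<oplus> h (y^4) \<otimes> d0 = \<zero>"
  shows "d0 = \<zero> \<and> d1 = \<zero> \<and> d2 = \<zero> \<and> d3 = \<zero> \<and> d4 = \<zero>"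
proof -
  have d0: "d0 = \<zero>" using z[of 0 1] c by (simp add: zero_power)
  have d4: "d4 = \<zero>" using z[of 1 0] c by (simp add: zero_power)
  have "\<exists>w :: 'k. poly [:1, 1, 1:] w = 0" by (rule alg_closed_imp_poly_has_root) simp
  then obtain w :: 'k where "1 + w * (1 + w) = 0" by auto
  then have w: "w * w + w + 1 = 0" by (simp add: algebra_simps)
  note w3 = char2_cube_root(1,2)[OF two w] and w1' = char2_cube_root(3,4)[OF two w]
  note dd = char2_self_add[OF two]
  have e1: "(d3 \<oplus> d2) \<oplus> d1 = \<zero>" using z[of 1 1] c unfolding d0 d4 by simp
  have e2: "(d3 \<oplus> h (w + 1) \<otimes> d2) \<oplus> h w \<otimes> d1 = \<zero>"
    using z[of w 1] c unfolding d0 d4 w3 by (simp del: h_add)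
  have h1: "h (w + 1) \<otimes> x = h w \<otimes> x \<oplus> x" if "x \<in> carrier R" for x
    using that by (simp add: l_distr)
  have e3: "(d3 \<oplus> h w \<otimes> d2) \<oplus> h (w + 1) \<otimes> d1 = \<zero>"
    using z[of "w + 1" 1] c unfolding d0 d4 w1' by (simp del: h_add)
  have "((d3 \<oplus> h (w + 1) \<otimes> d2) \<oplus> h w \<otimes> d1) \<oplus> ((d3 \<oplus> h w \<otimes> d2) \<oplus> h (w + 1) \<otimes> d1) =
     ((d3 \<oplus> d3) \<oplus> (h w \<otimes> d2 \<oplus> h w \<otimes> d2)) \<oplus> ((h w \<otimes> d1 \<oplus> h w \<otimes> d1) \<oplus> (d2 \<oplus> d1))"
    using c by (simp add: h1 a_ac del: h_add)
  then have e4: "d2 \<oplus> d1 = \<zero>" unfolding e2 e3 using c dd by simp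
  then have d3: "d3 = \<zero>" using e1 c by (simp add: a_assoc)
  have d21: "d2 = d1"
  proof -
    have "d2 = d2 \<oplus> (d1 \<oplus> d1)" using c dd by simp
    also have "\<dots> = (d2 \<oplus> d1) \<oplus> d1" using c by (simp add: a_assoc)
    finally show ?thesis using e4 c by simp
  qed
  have "(h w \<otimes> d1 \<oplus> d1) \<oplus> h w \<otimes> d1 = \<zero>" using e2 c unfolding d3 d21 by (simp add: h1 del: h_add)
  moreover have "(h w \<otimes> d1 \<oplus> d1) \<oplus> h w \<otimes> d1 = (h w \<otimes> d1 \<oplus> h w \<otimes> d1) \<oplus> d1" using c by (simp add: a_ac)
  ultimately have "d1 = \<zero>" using dd[of "h w \<otimes> d1"] c by simp
  then show ?thesis using d0 d4 d3 d21 by simp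
qed

text \<open>Both sides of the commutation relation are quartic forms, so comparing coefficients is
  the same as comparing values at constant points.\<close>

lemma comm_forms_iff_intertwines:
  assumes e: "table e" and d: "Polynomial.degree F \<le> 2" "Polynomial.degree G \<le> 2" and two: "(2 :: 'k) = 0"
  shows "comm_forms e F G \<longleftrightarrow> intertwines e F G F G"
proof
  assume c: "comm_forms e F G"
  show "intertwines e F G F G"
    unfolding intertwines_def
  proof (intro allI)
    fix x y s
    have "form_mult R (subst_form R h F e) (row_applied R h F G e s 1) =
      form_mult R (subst_form R h G e) (row_applied R h F G e s 0)" using c unfolding comm_forms_def by blast
    then show "subst_form_at F e x y \<otimes> row_applied_at e s 1 (qform F x y) (qform G x y) = subst_form_at G e x y \<otimes> row_applied_at e s 0 (qform F x y) (qform G x y)"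
      unfolding quad_at_subst_form[OF e, symmetric] quad_at_row_applied[OF e, symmetric]
        quad_at_mult[OF quad_coeffs_subst_form[OF e] quad_coeffs_row_applied[OF e d]] by simp
  qed
next
  assume i: "intertwines e F G F G"
  show "comm_forms e F G"
    unfolding comm_forms_def
  proof (intro allI)
    fix s
    let ?A = "subst_form R h F e" and ?B = "row_applied R h F G e s 1"
    let ?A' = "subst_form R h G e" and ?B' = "row_applied R h F G e s 0"
    note q = quad_coeffs_subst_form[OF e, of F] quad_coeffs_row_applied[OF e d, of s 1]
      quad_coeffs_subst_form[OF e, of G] quad_coeffs_row_applied[OF e d, of s 0]
    have cl: "form_mult R ?A ?B n \<in> carrier R" "form_mult R ?A' ?B' n \<in> carrier R" for n
      using q unfolding form_mult_def quad_coeffs_def by (auto intro!: finsum_closed)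
    define D where "D n = form_mult R ?A ?B n \<ominus> form_mult R ?A' ?B' n" for n
    have Dc: "D n \<in> carrier R" for n using cl by (simp add: D_def)
    have id: "((((a4 \<otimes> (u4 \<ominus> v4) \<oplus> a3 \<otimes> (u3 \<ominus> v3)) \<oplus> a2 \<otimes> (u2 \<ominus> v2)) \<oplus> a1 \<otimes> (u1 \<ominus> v1)) \<oplus> a0 \<otimes> (u0 \<ominus> v0)) =
      ((((a4 \<otimes> u4 \<oplus> a3 \<otimes> u3) \<oplus> a2 \<otimes> u2) \<oplus> a1 \<otimes> u1) \<oplus> a0 \<otimes> u0) \<ominus> ((((a4 \<otimes> v4 \<oplus> a3 \<otimes> v3) \<oplus> a2 \<otimes> v2) \<oplus> a1 \<otimes> v1) \<oplus> a0 \<otimes> v0)"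
      if "a0 \<in> carrier R" "a1 \<in> carrier R" "a2 \<in> carrier R" "a3 \<in> carrier R" "a4 \<in> carrier R"
        "u0 \<in> carrier R" "u1 \<in> carrier R" "u2 \<in> carrier R" "u3 \<in> carrier R" "u4 \<in> carrier R"
        "v0 \<in> carrier R" "v1 \<in> carrier R" "v2 \<in> carrier R" "v3 \<in> carrier R" "v4 \<in> carrier R"
      for a0 a1 a2 a3 a4 u0 u1 u2 u3 u4 v0 v1 v2 v3 v4
      using that by (simp add: minus_eq l_distr r_distr l_minus r_minus minus_add m_ac a_ac)
    have "(((h (x^4) \<otimes> D 4 \<oplus> h (x^3 * y) \<otimes> D 3) \<oplus> h (x^2 * y^2) \<otimes> D 2) \<oplus> h (x * y^3) \<otimes> D 1) \<oplus> h (y^4) \<otimes> D 0 = \<zero>" for x y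
    proof -
      have "(((h (x^4) \<otimes> D 4 \<oplus> h (x^3 * y) \<otimes> D 3) \<oplus> h (x^2 * y^2) \<otimes> D 2) \<oplus> h (x * y^3) \<otimes> D 1) \<oplus> h (y^4) \<otimes> D 0
        = quad_at ?A x y \<otimes> quad_at ?B x y \<ominus> quad_at ?A' x y \<otimes> quad_at ?B' x y"
        unfolding quad_at_mult[OF q(1,2)] quad_at_mult[OF q(3,4)] D_def by (rule id; (rule h_closed cl)?)
      also have "quad_at ?A x y \<otimes> quad_at ?B x y = quad_at ?A' x y \<otimes> quad_at ?B' x y"
        using i unfolding quad_at_subst_form[OF e] quad_at_row_applied[OF e] intertwines_def by blast
      also have "quad_at ?A' x y \<otimes> quad_at ?B' x y \<ominus> quad_at ?A' x y \<otimes> quad_at ?B' x y = \<zero>"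
        unfolding quad_at_subst_form[OF e] quad_at_row_applied[OF e] using e by (simp add: minus_eq r_neg)
      finally show ?thesis .
    qed
    from quartic_zero[OF two Dc Dc Dc Dc Dc this] have z: "D 0 = \<zero> \<and> D 1 = \<zero> \<and> D 2 = \<zero> \<and> D 3 = \<zero> \<and> D 4 = \<zero>" .
    have small: "form_mult R ?A ?B n = form_mult R ?A' ?B' n" if "n \<in> {0, 1, 2, 3, 4}" for n
    proof -
      have "D n = \<zero>" using that z by blast
      then show ?thesis using cl by (simp add: D_def)
    qed
    show "form_mult R ?A ?B = form_mult R ?A' ?B'"
    proof
      fix n
      show "form_mult R ?A ?B n = form_mult R ?A' ?B' n"
      proof (cases "n > 4")
        case True
        then show ?thesis using form_mult_quad(6)[OF q(1,2)] form_mult_quad(6)[OF q(3,4)] by simp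
      next
        case False
        then have "n \<in> {0, 1, 2, 3, 4}" by auto
        then show ?thesis by (rule small)
      qed
    qed
  qed
qed

section \<open>The automorphism scheme of \<open>z\<^sup>2 + z\<close> in characteristic 2\<close>

text \<open>The entries of the matrix of \<open>z \<mapsto> z + t\<close>.\<close>

definition unipotent_entry :: "'u \<Rightarrow> 2 \<times> 2 \<Rightarrow> 'u" where
  "unipotent_entry t = (\<lambda>(i, j). if i = j then \<one> else if i = 0 then t else \<zero>)"

definition unipotent_table :: "'u \<Rightarrow> 'u pgl2_point" where
  "unipotent_table t s u = unipotent_entry t s \<otimes> unipotent_entry t u"

lemma unipotent_entry_simps [simp]: "unipotent_entry t (0, 0) = \<one>" "unipotent_entry t (0, 1) = t" "unipotent_entry t (1, 0) = \<zero>" "unipotent_entry t (1, 1) = \<one>"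
  by (simp_all add: unipotent_entry_def)

lemma unipotent_entry_closed [simp]: "t \<in> carrier R \<Longrightarrow> unipotent_entry t s \<in> carrier R"
  by (cases s) (simp add: unipotent_entry_def)

lemma table_unipotent_table [simp]: "t \<in> carrier R \<Longrightarrow> table (unipotent_table t)"
  unfolding table_def unipotent_table_def by (intro allI m_closed unipotent_entry_closed)

lemma unipotent_table_closed:
  assumes "t \<in> carrier R"
  shows "unipotent_table t \<in> carrier (PGL2_points R)"
  unfolding carrier_PGL2_points
proof (intro conjI allI)
  show "unipotent_table t (0, 0) (1, 1) \<ominus> unipotent_table t (0, 1) (1, 0) = \<one>" using assms by (simp add: unipotent_table_def minus_eq)
  show "table (unipotent_table t)" using assms by simp
  fix s u s' u'
  show "unipotent_table t s u = unipotent_table t u s" unfolding unipotent_table_def using assms by (intro m_comm unipotent_entry_closed)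
  show "unipotent_table t s u \<otimes> unipotent_table t s' u' = unipotent_table t s s' \<otimes> unipotent_table t u u'"
  proof -
    have "(x \<otimes> y) \<otimes> (z \<otimes> w) = (x \<otimes> z) \<otimes> (y \<otimes> w)"
      if "x \<in> carrier R" "y \<in> carrier R" "z \<in> carrier R" "w \<in> carrier R" for x y z w using that by (simp add: m_ac)
    then show ?thesis unfolding unipotent_table_def using assms by (simp only: unipotent_entry_closed)
  qed
qed

lemma form_values:
  assumes "table e"
  shows "subst_form R h [:0, 1, 1:] e 2 = e (0, 0) (0, 0) \<oplus> e (0, 0) (1, 0)"
    "subst_form R h [:0, 1, 1:] e 1 = (e (0, 0) (0, 1) \<oplus> e (0, 1) (0, 0)) \<oplus> (e (0, 0) (1, 1) \<oplus> e (0, 1) (1, 0))"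
    "subst_form R h [:0, 1, 1:] e 0 = e (0, 1) (0, 1) \<oplus> e (0, 1) (1, 1)"
    "subst_form R h [:1:] e 2 = e (1, 0) (1, 0)"
    "subst_form R h [:1:] e 1 = e (1, 0) (1, 1) \<oplus> e (1, 1) (1, 0)"
    "subst_form R h [:1:] e 0 = e (1, 1) (1, 1)"
    "row_applied R h [:0, 1, 1:] [:1:] e s i 2 = e s (i, 0)"
    "row_applied R h [:0, 1, 1:] [:1:] e s i 1 = e s (i, 0)"
    "row_applied R h [:0, 1, 1:] [:1:] e s i 0 = e s (i, 1)"
  using assms by (simp_all add: subst_form_def row_product_def row_applied_def numeral_2_eq_2)

context
  assumes two: "(2 :: 'k) = 0"
begin

lemmas self_add = char2_self_add[OF two]

lemma minus_self: "x \<in> carrier R \<Longrightarrow> \<ominus> x = x"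
  using self_add minus_equality by blast

lemma form_mult_standard:
  assumes "table e"
  shows "quad_coeffs (subst_form R h [:0, 1, 1:] e)" "quad_coeffs (subst_form R h [:1:] e)"
    "quad_coeffs (row_applied R h [:0, 1, 1:] [:1:] e s i)"
  using assms by (auto intro!: quad_coeffs_subst_form quad_coeffs_row_applied)

lemma add_eq_right_imp_zero: "x \<in> carrier R \<Longrightarrow> y \<in> carrier R \<Longrightarrow> x \<oplus> y = y \<Longrightarrow> x = \<zero>"
proof -
  assume c: "x \<in> carrier R" "y \<in> carrier R" and e: "x \<oplus> y = y"
  have "x = (x \<oplus> y) \<oplus> \<ominus> y" using c by (simp add: a_assoc r_neg)
  then show "x = \<zero>" unfolding e using c by (simp add: r_neg)
qed

text \<open>For a matrix with rows \<open>(a, b)\<close> and \<open>(c, d)\<close> the coefficient of \<open>X\<^sup>3 Y\<close> in the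
  commutation relation gives \<open>c = 0\<close>, that of \<open>X\<^sup>2 Y\<^sup>2\<close> then gives \<open>a = d\<close>, and that of
  \<open>Y\<^sup>4\<close> gives \<open>b\<^sup>2 = 0\<close>. This is carried out with the products of two entries divided by
  the determinant, which are the available coordinates.\<close>

lemma comm_forms_standard_imp:
  assumes e: "e \<in> carrier (PGL2_points R)" and c: "comm_forms e [:0, 1, 1:] [:1:]"
  shows "e = unipotent_table (e (0, 0) (0, 1))" "e (0, 0) (0, 1) \<otimes> e (0, 0) (0, 1) = \<zero>"
proof -
  have te: "table e" and sy: "\<And>s t. e s t = e t s"
    and sg: "\<And>s t s' t'. e s t \<otimes> e s' t' = e s s' \<otimes> e t t'"
    and dt: "e (0, 0) (1, 1) \<ominus> e (0, 1) (1, 0) = \<one>"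
    using e unfolding carrier_PGL2_points by blast+
  have cl [simp]: "e s t \<in> carrier R" for s t using te by simp
  note qc = form_mult_standard[OF te]
  have cf: "form_mult R (subst_form R h [:0, 1, 1:] e) (row_applied R h [:0, 1, 1:] [:1:] e s 1) n =
     form_mult R (subst_form R h [:1:] e) (row_applied R h [:0, 1, 1:] [:1:] e s 0) n" for s n
    by (rule fun_cong[OF c[unfolded comm_forms_def, rule_format]])
  have k4: "(e (0,0) (0,0) \<oplus> e (0,0) (1,0)) \<otimes> e s (1,0) = e (1,0) (1,0) \<otimes> e s (0,0)" for s
    using cf[of s 4] unfolding form_mult_quad[OF qc(1) qc(3)] form_mult_quad[OF qc(2) qc(3)] form_values[OF te] .
  have k3: "((e (0,0) (0,1) \<oplus> e (0,1) (0,0)) \<oplus> (e (0,0) (1,1) \<oplus> e (0,1) (1,0))) \<otimes> e s (1,0) \<oplus> (e (0,0) (0,0) \<oplus> e (0,0) (1,0)) \<otimes> e s (1,0) =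
     (e (1,0) (1,1) \<oplus> e (1,1) (1,0)) \<otimes> e s (0,0) \<oplus> e (1,0) (1,0) \<otimes> e s (0,0)" for s
    using cf[of s 3] unfolding form_mult_quad[OF qc(1) qc(3)] form_mult_quad[OF qc(2) qc(3)] form_values[OF te] .
  have k2: "((e (0,1) (0,1) \<oplus> e (0,1) (1,1)) \<otimes> e s (1,0) \<oplus> ((e (0,0) (0,1) \<oplus> e (0,1) (0,0)) \<oplus> (e (0,0) (1,1) \<oplus> e (0,1) (1,0))) \<otimes> e s (1,0)) \<oplus>
      (e (0,0) (0,0) \<oplus> e (0,0) (1,0)) \<otimes> e s (1,1) =
     (e (1,1) (1,1) \<otimes> e s (0,0) \<oplus> (e (1,0) (1,1) \<oplus> e (1,1) (1,0)) \<otimes> e s (0,0)) \<oplus> e (1,0) (1,0) \<otimes> e s (0,1)" for s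
    using cf[of s 2] unfolding form_mult_quad[OF qc(1) qc(3)] form_mult_quad[OF qc(2) qc(3)] form_values[OF te] .
  have k0: "(e (0,1) (0,1) \<oplus> e (0,1) (1,1)) \<otimes> e s (1,1) = e (1,1) (1,1) \<otimes> e s (0,1)" for s
    using cf[of s 0] unfolding form_mult_quad[OF qc(1) qc(3)] form_mult_quad[OF qc(2) qc(3)] form_values[OF te] .
  have ab: "e (0,0) (0,1) \<oplus> e (0,1) (0,0) = \<zero>" using self_add sy[of "(0,1)" "(0,0)"] by simp
  have cd: "e (1,0) (1,1) \<oplus> e (1,1) (1,0) = \<zero>" using self_add sy[of "(1,1)" "(1,0)"] by simp
  have adbc: "e (0,0) (1,1) \<oplus> e (0,1) (1,0) = \<one>" using dt minus_self[of "e (0,1) (1,0)"] by (simp add: minus_eq)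
  have c0: "e s (1,0) = \<zero>" for s
  proof -
    have "e s (1,0) \<oplus> e (1,0) (1,0) \<otimes> e s (0,0) = e (1,0) (1,0) \<otimes> e s (0,0)"
      using k3[of s] unfolding ab cd adbc k4 by simp
    then show ?thesis by (rule add_eq_right_imp_zero[OF cl m_closed[OF cl cl]])
  qed
  have c0': "e (1,0) s = \<zero>" for s using c0[of s] sy[of "(1,0)" s] by simp
  have ad: "e (0,0) (1,1) = \<one>" using adbc unfolding c0 by simp
  then have da: "e (1,1) (0,0) = \<one>" using sy[of "(1,1)" "(0,0)"] by simp
  have aadd: "e (0,0) (0,0) \<otimes> e (1,1) (1,1) = \<one>" using sg[of "(0,0)" "(1,1)" "(0,0)" "(1,1)"] unfolding ad by simp
  have "e (0,0) (0,0) = e (1,1) (1,1) \<otimes> e (0,0) (0,0)"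
    using k2[of "(0,0)"] unfolding c0 c0' ad by simp
  then have aa: "e (0,0) (0,0) = \<one>" using aadd m_comm[of "e (0,0) (0,0)" "e (1,1) (1,1)"] by simp
  have dd: "e (1,1) (1,1) = \<one>" using aadd unfolding aa by simp
  have "e (0,1) (0,1) \<oplus> e (0,1) (1,1) = e (0,1) (1,1)"
    using k0[of "(1,1)"] unfolding dd using sy[of "(1,1)" "(0,1)"] by simp
  then have bb: "e (0,1) (0,1) = \<zero>" by (rule add_eq_right_imp_zero[OF cl cl])
  have bd: "e (0,1) (1,1) = e (0,0) (0,1)"
    using sg[of "(0,0)" "(0,1)" "(1,1)" "(1,1)"] unfolding dd ad by simp
  show tt: "e (0,0) (0,1) \<otimes> e (0,0) (0,1) = \<zero>"
    using sg[of "(0,0)" "(0,1)" "(0,0)" "(0,1)"] unfolding bb by simp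
  have ba: "e (0,1) (0,0) = e (0,0) (0,1)" "e (1,1) (0,1) = e (0,0) (0,1)"
    using sy[of "(0,1)" "(0,0)"] sy[of "(1,1)" "(0,1)"] bd by simp_all
  have "e (i, j) (k, l) = unipotent_table (e (0,0) (0,1)) (i, j) (k, l)" for i j k l
    using two_cases[of i] two_cases[of j] two_cases[of k] two_cases[of l]
    by (elim disjE; hypsubst) (simp_all only: unipotent_table_def unipotent_entry_simps aa ba bb bd c0 c0' ad da dd tt l_one r_one l_null r_null cl one_closed zero_closed)
  then show "e = unipotent_table (e (0,0) (0,1))" by (intro ext) (metis surj_pair)
qed

lemma comm_forms_standard_unipotent_table:
  assumes t: "t \<in> carrier R" "t \<otimes> t = \<zero>"
  shows "comm_forms (unipotent_table t) [:0, 1, 1:] [:1:]"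
  unfolding comm_forms_def
proof (intro allI ext)
  fix s :: "2 \<times> 2" and n :: nat
  have te: "table (unipotent_table t)" using t by simp
  note qc = form_mult_standard[OF te]
  have v: "unipotent_table t (0,0) (0,0) = \<one>" "unipotent_table t (0,0) (1,0) = \<zero>" "unipotent_table t (0,0) (0,1) = t" "unipotent_table t (0,1) (0,0) = t"
    "unipotent_table t (0,0) (1,1) = \<one>" "unipotent_table t (0,1) (1,0) = \<zero>" "unipotent_table t (0,1) (0,1) = \<zero>" "unipotent_table t (0,1) (1,1) = t"
    "unipotent_table t (1,0) (1,0) = \<zero>" "unipotent_table t (1,0) (1,1) = \<zero>" "unipotent_table t (1,1) (1,0) = \<zero>" "unipotent_table t (1,1) (1,1) = \<one>"
    "unipotent_table t s (0,0) = unipotent_entry t s" "unipotent_table t s (0,1) = unipotent_entry t s \<otimes> t" "unipotent_table t s (1,0) = \<zero>" "unipotent_table t s (1,1) = unipotent_entry t s"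
    using t by (simp_all add: unipotent_table_def)
  consider "n = 0" | "n = 1" | "n = 2" | "n = 3" | "n = 4" | "n > 4" by linarith
  then show "form_mult R (subst_form R h [:0, 1, 1:] (unipotent_table t)) (row_applied R h [:0, 1, 1:] [:1:] (unipotent_table t) s 1) n =
     form_mult R (subst_form R h [:1:] (unipotent_table t)) (row_applied R h [:0, 1, 1:] [:1:] (unipotent_table t) s 0) n"
  proof cases
    case 6
    then show ?thesis using form_mult_quad(6)[OF qc(1) qc(3)] form_mult_quad(6)[OF qc(2) qc(3)] by simp
  qed (simp_all only: form_mult_quad[OF qc(1) qc(3)] form_mult_quad[OF qc(2) qc(3)] form_values[OF te] v,
      use t self_add[OF t(1)] in \<open>simp_all add: m_comm\<close>)
qed

end

lemma unipotent_table_mult_entry: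
  assumes "t \<in> carrier R" "u \<in> carrier R" "t \<otimes> t = \<zero>"
  shows "pmul (unipotent_table t) (unipotent_table u) (0, 0) (0, 1) = t \<oplus> u"
  using assms by (simp add: pmul_eq sum4_def unipotent_table_def a_comm)

section \<open>Conjugation of automorphism schemes\<close>

definition conj_table :: "'k \<Rightarrow> 'k \<Rightarrow> 'k \<Rightarrow> 'k \<Rightarrow> 'u pgl2_point \<Rightarrow> 'u pgl2_point" where
  "conj_table a b c d e = pmul (const_table d (-b) (-c) a) (pmul e (const_table a b c d))"

lemma conj_table_closed:
  assumes "a * d - b * c = 1" "e \<in> carrier (PGL2_points R)"
  shows "conj_table a b c d e \<in> carrier (PGL2_points R)"
proof -
  have "a * d - (- b) * (- c) = 1" "d * a - (- b) * (- c) = 1" using assms(1) by (simp_all add: mult.commute)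
  then show ?thesis unfolding conj_table_def using assms by (intro pmul_closed const_table_closed)
qed

lemma conj_table_conj_table:
  assumes D: "a * d - b * c = 1" and e: "table e"
  shows "conj_table d (-b) (-c) a (conj_table a b c d e) = e"
proof -
  have D': "d * a - (- b) * (- c) = 1" using D by (simp add: mult.commute)
  have i2: "pmul (const_table a b c d) (const_table d (-b) (-c) a) = \<one>\<^bsub>PGL2_points R\<^esub>"
    using const_table_inverse[OF D'] by simp
  have "conj_table d (-b) (-c) a (conj_table a b c d e) =
    pmul (pmul (const_table a b c d) (const_table d (-b) (-c) a)) (pmul e (pmul (const_table a b c d) (const_table d (-b) (-c) a)))"
    unfolding conj_table_def using e by (simp add: pmul_assoc)
  then show ?thesis unfolding i2 using e by (simp add: pmul_one)
qed

lemma conj_table_pmul: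
  assumes D: "a * d - b * c = 1" and e: "table e" "table e'"
  shows "conj_table a b c d (pmul e e') = pmul (conj_table a b c d e) (conj_table a b c d e')"
proof -
  have D': "d * a - (- b) * (- c) = 1" using D by (simp add: mult.commute)
  have i2: "pmul (const_table a b c d) (const_table d (-b) (-c) a) = \<one>\<^bsub>PGL2_points R\<^esub>"
    using const_table_inverse[OF D'] by simp
  have "pmul (const_table a b c d) (pmul (const_table d (-b) (-c) a) x) = x" if "table x" for x
    using that i2 by (simp add: pmul_assoc[symmetric] pmul_one)
  then show ?thesis unfolding conj_table_def using e by (simp add: pmul_assoc)
qed

definition aut_points :: "'k poly fract \<Rightarrow> 'u pgl2_point set" where
  "aut_points f = {e \<in> carrier (PGL2_points R). commutes_with R h f e}"

lemma aut_points_Fract: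
  assumes two: "(2 :: 'k) = 0" and q: "quad_pair F G"
  shows "e \<in> aut_points (Fraction_Field.Fract F G) \<longleftrightarrow> e \<in> carrier (PGL2_points R) \<and> intertwines e F G F G"
proof -
  obtain k where k: "k \<noteq> 0" "rat_num (Fraction_Field.Fract F G) = Polynomial.smult k F"
    "rat_den (Fraction_Field.Fract F G) = Polynomial.smult k G" using rat_num_den_Fract[OF q] .
  have d: "Polynomial.degree (Polynomial.smult k F) \<le> 2" "Polynomial.degree (Polynomial.smult k G) \<le> 2"
    using q degree_smult_le order.trans unfolding quad_pair_def by blast+
  show ?thesis
  proof (cases "e \<in> carrier (PGL2_points R)")
    case True
    then have te: "table e" unfolding carrier_PGL2_points by blast
    show ?thesis
      unfolding aut_points_def mem_Collect_eq commutes_with_iff k comm_forms_iff_intertwines[OF te d two]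
        intertwines_smult[OF te k(1) k(1)] by (rule refl)
  qed (simp add: aut_points_def)
qed

lemma conj_table_aut_points:
  assumes two: "(2 :: 'k) = 0" and q: "quad_pair F G" and D: "a * d - b * c = 1"
    and e: "e \<in> aut_points (Fraction_Field.Fract F G)"
  shows "conj_table a b c d e \<in> aut_points (rat_conj (Fraction_Field.Fract F G) (mob a b c d))"
proof -
  have D0: "a * d - b * c \<noteq> 0" using D by simp
  have ec: "e \<in> carrier (PGL2_points R)" and i: "intertwines e F G F G" using e aut_points_Fract[OF two q] by blast+
  have te: "table e" using ec unfolding carrier_PGL2_points by blast
  have "pmul e (const_table a b c d) \<in> carrier (PGL2_points R)" using ec const_table_closed[OF D] by (rule pmul_closed)
  then have sy: "pmul e (const_table a b c d) s t = pmul e (const_table a b c d) t s" for s t unfolding carrier_PGL2_points by blast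
  have tp: "table (pmul e (const_table a b c d))" using te by simp
  have "intertwines (conj_table a b c d e) (conj_num a b c d F G) (conj_den a b c d F G) (conj_num a b c d F G) (conj_den a b c d F G)"
    unfolding conj_table_def by (rule intertwines_const_table_pmul[OF tp sy intertwines_pmul_const_table[OF te i D] D])
  then show ?thesis
    unfolding rat_conj_Fract[OF q D0] aut_points_Fract[OF two quad_pair_conj[OF q D0]] using conj_table_closed[OF D ec] by blast
qed

lemma pmul_cong_hom:
  assumes "K_alg R' h'" "g \<in> Ring.ring_hom R R'" "table e" "table e'"
  shows "monoid.mult (PGL2_points R') (\<lambda>s t. g (e s t)) (\<lambda>s t. g (e' s t)) s t = g (pmul e e' s t)"
proof -
  interpret R': K_alg R' h' by fact
  obtain i j k l where s: "s = (i, j)" and t: "t = (k, l)" by (metis surj_pair)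
  have "R'.table (\<lambda>s t. g (e s t))" "R'.table (\<lambda>s t. g (e' s t))"
    unfolding R'.table_def using assms(3,4) ring_hom_closed[OF assms(2)] by simp_all
  then show ?thesis unfolding s t using assms(3,4)
    by (simp add: R'.pmul_eq pmul_eq R'.sum4_def sum4_def ring_hom_add[OF assms(2)] ring_hom_mult[OF assms(2)])
qed

end

lemma K_algebra_K_alg: "K_algebra R h \<longleftrightarrow> K_alg R h"
  by (simp add: K_algebra_def K_alg_def K_alg_axioms_def)

lemma quad_pair_standard: "quad_pair [:0, 1, 1:] [:1 :: 'k::field:]"
proof -
  have "qform [:1:] x y = y^2" for x y :: 'k by (simp add: qform_def numeral_2_eq_2)
  then show ?thesis unfolding quad_pair_def by (simp add: power2_eq_square)
qed

text \<open>Conjugation by a constant matrix carries the automorphism scheme of \<open>f\<close> to that of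
  \<open>z\<^sup>2 + z\<close>, and it is natural in the \<open>K\<close>-algebra because the matrix is constant. There the
  points are the translations \<open>z \<mapsto> z + t\<close> with \<open>t\<^sup>2 = 0\<close>, and the isomorphism reads
  off \<open>t\<close>.\<close>

lemma aut_scheme_alpha2:
  fixes f :: "'k::{alg_closed_field, field_gcd} poly fract"
  assumes two: "(2 :: 'k) = 0" and f: "f \<in> Rat2" and cf: "conjugate f (Fraction_Field.Fract [:0, 1, 1:] [:1:])"
  shows "group_scheme_iso (Aut_scheme f) (alpha2_scheme :: ('k, 'u, 'u) group_functor)"
proof -
  let ?f0 = "Fraction_Field.Fract [:0, 1, 1:] [:1:] :: 'k poly fract"
  obtain \<alpha> where \<alpha>: "\<alpha> \<in> carrier PGL2" "rat_conj f \<alpha> = ?f0" using cf unfolding conjugate_def by blast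
  obtain a' b' c' d' where D': "a' * d' - b' * c' \<noteq> 0" and \<alpha>': "\<alpha> = mob a' b' c' d'" using PGL2E[OF \<alpha>(1)] .
  \<comment> \<open>over an algebraically closed field the matrix can be scaled to determinant 1\<close>
  obtain r where r: "r^2 = inverse (a' * d' - b' * c')" using nth_root_exists[of 2 "inverse (a' * d' - b' * c')"] by auto
  then have r0: "r \<noteq> 0" using D' by auto
  define a b c d where "a = r * a'" and "b = r * b'" and "c = r * c'" and "d = r * d'"
  have "a * d - b * c = r^2 * (a' * d' - b' * c')"
    by (simp add: a_def b_def c_def d_def power2_eq_square algebra_simps)
  then have D: "a * d - b * c = 1" using r D' by simp
  have m: "rat_conj f (mob a b c d) = ?f0"
    using \<alpha>(2) mob_scaled[OF D' r0] unfolding \<alpha>' a_def b_def c_def d_def by simp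
  have D2: "d * a - (- b) * (- c) = 1" using D by (simp add: mult.commute)
  obtain F G where fFG: "f = Fraction_Field.Fract F G" and q: "quad_pair F G" using Rat2E[OF f] .
  have D0: "a * d - b * c \<noteq> 0" using D by simp
  have m': "rat_conj ?f0 (mob d (-b) (-c) a) = f"
  proof -
    have D3: "d * a - (- b) * (- c) \<noteq> 0" unfolding D2 by simp
    have "mob d (-b) (-c) a \<in> carrier PGL2" by (rule mob_in_PGL2[OF D3])
    moreover have "rat_comp (mob a b c d) (mob d (-b) (-c) a) = idz"
      using mob_adjugate[OF D3] by simp
    ultimately show ?thesis unfolding m[symmetric]
      using rat_conj_rat_conj[OF nonconstant_Rat2[OF f] mob_in_PGL2[OF D0]] nonconstant_Rat2[OF f] by simp
  qed
  note q0 = quad_pair_standard[where 'k = 'k]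
  define \<eta> :: "'u ring \<Rightarrow> ('k \<Rightarrow> 'u) \<Rightarrow> 'u pgl2_point \<Rightarrow> 'u" where
    "\<eta> R h e = K_alg.conj_table R h a b c d e (0, 0) (0, 1)" for R h e
  have iso: "\<eta> R h \<in> iso (points (Aut_scheme f) R h) (points (alpha2_scheme :: ('k, 'u, 'u) group_functor) R h)"
    if "K_algebra R h" for R :: "'u ring" and h :: "'k \<Rightarrow> 'u"
  proof -
    interpret K_alg R h using that unfolding K_algebra_K_alg .
    have pc: "carrier (points (Aut_scheme f) R h) = aut_points f"
      "monoid.mult (points (Aut_scheme f) R h) = pmul"
      by (simp_all add: Aut_scheme_def aut_points_def)
    have ac: "carrier (points (alpha2_scheme :: ('k, 'u, 'u) group_functor) R h) = {r \<in> carrier R. r \<otimes>\<^bsub>R\<^esub> r = \<zero>\<^bsub>R\<^esub>}"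
      "monoid.mult (points (alpha2_scheme :: ('k, 'u, 'u) group_functor) R h) = Ring.ring.add R"
      by (simp_all add: alpha2_scheme_def)
    have to0: "conj_table a b c d e \<in> aut_points ?f0" if "e \<in> aut_points f" for e
      using conj_table_aut_points[OF two q D] that m unfolding fFG by metis
    have from0: "conj_table d (-b) (-c) a e \<in> aut_points f" if "e \<in> aut_points ?f0" for e
      using conj_table_aut_points[OF two q0 D2 that] unfolding m' .
    have tb: "table e" if "e \<in> aut_points g" for e g
      using that unfolding aut_points_def carrier_PGL2_points by blast
    have std: "e = unipotent_table (e (0, 0) (0, 1)) \<and> e (0, 0) (0, 1) \<otimes>\<^bsub>R\<^esub> e (0, 0) (0, 1) = \<zero>\<^bsub>R\<^esub>" if "e \<in> aut_points ?f0" for e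
    proof -
      have "e \<in> carrier (PGL2_points R)" "intertwines e [:0, 1, 1:] [:1:] [:0, 1, 1:] [:1:]"
        using that unfolding aut_points_Fract[OF two q0] by blast+
      moreover from this have "comm_forms e [:0, 1, 1:] [:1:]"
        using comm_forms_iff_intertwines[OF tb[OF that] _ _ two, of "[:0, 1, 1:]" "[:1:]"] by simp
      ultimately show ?thesis using comm_forms_standard_imp[OF two] by blast
    qed
    have std': "unipotent_table t \<in> aut_points ?f0" if "t \<in> carrier R" "t \<otimes>\<^bsub>R\<^esub> t = \<zero>\<^bsub>R\<^esub>" for t
      unfolding aut_points_Fract[OF two q0]
      using comm_forms_standard_unipotent_table[OF two that] comm_forms_iff_intertwines[OF table_unipotent_table[OF that(1)] _ _ two, of "[:0, 1, 1:]" "[:1:]"]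
        unipotent_table_closed[OF that(1)] by simp
    have \<eta>: "\<eta> R h e = conj_table a b c d e (0, 0) (0, 1)" for e by (simp add: \<eta>_def)
    have \<eta>c: "\<eta> R h e \<in> carrier R \<and> \<eta> R h e \<otimes>\<^bsub>R\<^esub> \<eta> R h e = \<zero>\<^bsub>R\<^esub> \<and> conj_table a b c d e = unipotent_table (\<eta> R h e)" if "e \<in> aut_points f" for e
      using std[OF to0[OF that]] tb[OF to0[OF that]] unfolding \<eta> by simp
    have hom: "\<eta> R h (pmul e e') = \<eta> R h e \<oplus>\<^bsub>R\<^esub> \<eta> R h e'" if "e \<in> aut_points f" "e' \<in> aut_points f" for e e'
    proof -
      have "\<eta> R h (pmul e e') = pmul (conj_table a b c d e) (conj_table a b c d e') (0, 0) (0, 1)"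
        unfolding \<eta> using conj_table_pmul[OF D tb[OF that(1)] tb[OF that(2)]] by simp
      also have "\<dots> = pmul (unipotent_table (\<eta> R h e)) (unipotent_table (\<eta> R h e')) (0, 0) (0, 1)" using \<eta>c that by metis
      also have "\<dots> = \<eta> R h e \<oplus>\<^bsub>R\<^esub> \<eta> R h e'" using \<eta>c that by (intro unipotent_table_mult_entry) auto
      finally show ?thesis .
    qed
    have "bij_betw (\<eta> R h) (aut_points f) {r \<in> carrier R. r \<otimes>\<^bsub>R\<^esub> r = \<zero>\<^bsub>R\<^esub>}"
    proof (rule bij_betw_byWitness[where f' = "\<lambda>t. conj_table d (-b) (-c) a (unipotent_table t)"])
      show "\<forall>e\<in>aut_points f. conj_table d (-b) (-c) a (unipotent_table (\<eta> R h e)) = e"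
        using \<eta>c conj_table_conj_table[OF D tb] by metis
      show "\<forall>t\<in>{r \<in> carrier R. r \<otimes>\<^bsub>R\<^esub> r = \<zero>\<^bsub>R\<^esub>}. \<eta> R h (conj_table d (-b) (-c) a (unipotent_table t)) = t"
      proof
        fix t assume "t \<in> {r \<in> carrier R. r \<otimes>\<^bsub>R\<^esub> r = \<zero>\<^bsub>R\<^esub>}"
        then have t: "t \<in> carrier R" by blast
        have "conj_table a b c d (conj_table d (-b) (-c) a (unipotent_table t)) = unipotent_table t"
          using conj_table_conj_table[OF D2 table_unipotent_table[OF t]] by simp
        then show "\<eta> R h (conj_table d (-b) (-c) a (unipotent_table t)) = t" using t by (simp add: \<eta> unipotent_table_def)
      qed
      show "\<eta> R h ` aut_points f \<subseteq> {r \<in> carrier R. r \<otimes>\<^bsub>R\<^esub> r = \<zero>\<^bsub>R\<^esub>}" using \<eta>c by blast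
      show "(\<lambda>t. conj_table d (-b) (-c) a (unipotent_table t)) ` {r \<in> carrier R. r \<otimes>\<^bsub>R\<^esub> r = \<zero>\<^bsub>R\<^esub>} \<subseteq> aut_points f"
        using std' from0 by blast
    qed
    moreover have "\<eta> R h \<in> hom (points (Aut_scheme f) R h) (points (alpha2_scheme :: ('k, 'u, 'u) group_functor) R h)"
      unfolding hom_def pc ac using hom \<eta>c by blast
    ultimately show ?thesis unfolding iso_def pc ac by blast
  qed
  have nat: "\<eta> R' h' (points_map (Aut_scheme f :: ('k, 'u, 'u pgl2_point) group_functor) g e) =
      points_map (alpha2_scheme :: ('k, 'u, 'u) group_functor) g (\<eta> R h e)"
    if "K_algebra R h" "K_algebra R' h'" "K_algebra_hom R h R' h' g" "e \<in> carrier (points (Aut_scheme f) R h)"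
    for R R' :: "'u ring" and h h' :: "'k \<Rightarrow> 'u" and g e
  proof -
    interpret A: K_alg R h using that(1) unfolding K_algebra_K_alg .
    interpret B: K_alg R' h' using that(2) unfolding K_algebra_K_alg .
    have g: "g \<in> Ring.ring_hom R R'" "\<And>x. g (h x) = h' x" using that(3) by (auto simp: K_algebra_hom_def)
    have te: "A.table e" using that(4) unfolding Aut_scheme_def A.table_def by (simp add: PGL2_points_def)
    have ct: "B.const_table u v w z = (\<lambda>s t. g (A.const_table u v w z s t))" for u v w z
      unfolding A.const_table_def B.const_table_def g(2) ..
    have "B.conj_table a b c d (\<lambda>s t. g (e s t)) (0, 0) (0, 1) = g (A.conj_table a b c d e (0, 0) (0, 1))"
    proof -
      have 1: "monoid.mult (PGL2_points R') (\<lambda>s t. g (e s t)) (B.const_table a b c d) = (\<lambda>s t. g (A.pmul e (A.const_table a b c d) s t))"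
        unfolding ct by (intro ext A.pmul_cong_hom[OF B.K_alg_axioms g(1) te A.table_const_table])
      have 2: "A.table (A.pmul e (A.const_table a b c d))" using te by simp
      show ?thesis unfolding B.conj_table_def A.conj_table_def 1
        unfolding ct[of d "-b" "-c" a] by (rule A.pmul_cong_hom[OF B.K_alg_axioms g(1) A.table_const_table 2])
    qed
    then show ?thesis by (simp add: \<eta>_def Aut_scheme_def alpha2_scheme_def)
  qed
  show ?thesis unfolding group_scheme_iso_def using iso nat by blast
qed

section \<open>The automorphism locus\<close>

lemma Fp_bar_of_nat_eq_0: "(of_nat n :: 'p::prime_card Fp_bar) = 0 \<longleftrightarrow> CARD('p) dvd n"
proof -
  have "(of_nat n :: 'p Fp_bar) = to_ac (of_nat n)" by simp
  then show ?thesis by (simp only: to_ac_eq_0_iff of_nat_eq_0_iff_char_dvd semiring_char_mod_ring)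
qed

text \<open>The substitution \<open>1/z\<close> moves the fixed point of multiplier 0 to \<open>\<infinity>\<close>, which
  makes the map a polynomial.\<close>

lemma conjugate_Qmap_standard:
  "conjugate (Qmap 0 1) (Fraction_Field.Fract [:0, 1, 1:] [:1 :: 'k::{alg_closed_field, field_gcd}:])"
  unfolding Qmap_def
proof (rule conjugate_Fract[where a = 0 and b = 1 and c = 1 and d = 0 and k = "-1"])
  show "quad_pair [:0, 0, 1:] [:1, 1 :: 'k:]" using quad_pair_Qmap[of 0 "1 :: 'k"] by simp
qed (simp_all add: conj_num_def conj_den_def qsub_def numeral_2_eq_2)

theorem theorem1p8:
  fixes p :: nat
  assumes "p = CARD('p::prime_card)"
  shows
   "(p = 2 \<longrightarrow>
       (aut_locus :: ('p Fp_bar \<times> 'p Fp_bar) set) = {(0, s) | s. s \<noteq> 1} \<and>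
       zariski_closure (aut_locus :: ('p Fp_bar \<times> 'p Fp_bar) set) = {(0, s) | s. True} \<and>
       (\<forall>s :: 'p Fp_bar. s \<noteq> 0 \<and> s \<noteq> 1 \<longrightarrow> holds_at (0, s) (\<lambda>f. Aut f \<cong> integer_mod_group 2)) \<and>
       holds_at (0 :: 'p Fp_bar, 0) (\<lambda>f. Aut f \<cong> sym_group 3) \<and>
       holds_at (0 :: 'p Fp_bar, 1) (\<lambda>f. carrier (Aut f) = {\<one>\<^bsub>Aut f\<^esub>} \<and>
         group_scheme_iso (Aut_scheme f) (alpha2_scheme :: ('p Fp_bar, 'u, 'u) group_functor))) \<and>
    (p = 3 \<longrightarrow>
       (let P = 2 * var_x ^ 3 + var_x ^ 2 * var_y - var_x ^ 2 - var_y ^ 2 - 2 * var_x * var_y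
                  :: 'p Fp_bar poly poly
        in cuspidal_cubic P \<and> aut_locus = plane_curve P \<and>
           (\<forall>x \<in> plane_curve P. holds_at x (\<lambda>f. Aut f \<cong> integer_mod_group 2)))) \<and>
    (p > 3 \<longrightarrow>
       (let P = 2 * var_x ^ 3 + var_x ^ 2 * var_y - var_x ^ 2 - 4 * var_y ^ 2 - 8 * var_x * var_y
                  + 12 * var_x + 12 * var_y - 36 :: 'p Fp_bar poly poly
        in cuspidal_cubic P \<and> aut_locus = plane_curve P \<and>
           (\<forall>x \<in> plane_curve P - singular_points P. holds_at x (\<lambda>f. Aut f \<cong> integer_mod_group 2)) \<and>
           (\<forall>x \<in> singular_points P. holds_at x (\<lambda>f. Aut f \<cong> sym_group 3))))"
proof (intro conjI impI)
  note char = Fp_bar_of_nat_eq_0[where 'p = 'p, folded assms]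
  {
    assume "p = 2"
    then have two: "(2 :: 'p Fp_bar) = 0" using char[of 2] by simp
    show locus: "(aut_locus :: ('p Fp_bar \<times> 'p Fp_bar) set) = {(0, s) | s. s \<noteq> 1}"
      by (rule aut_locus_char2[OF two])
    show "zariski_closure (aut_locus :: ('p Fp_bar \<times> 'p Fp_bar) set) = {(0, s) | s. True}"
      unfolding locus by (rule zariski_closure_char2[OF two])
    show "\<forall>s :: 'p Fp_bar. s \<noteq> 0 \<and> s \<noteq> 1 \<longrightarrow> holds_at (0, s) (\<lambda>f. Aut f \<cong> integer_mod_group 2)"
      using holds_at_char2_C2[OF two] by blast
    show "holds_at (0 :: 'p Fp_bar, 0) (\<lambda>f. Aut f \<cong> sym_group 3)" by (rule holds_at_char2_S3[OF two])
    show "holds_at (0 :: 'p Fp_bar, 1) (\<lambda>f. carrier (Aut f) = {\<one>\<^bsub>Aut f\<^esub>} \<and>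
         group_scheme_iso (Aut_scheme f) (alpha2_scheme :: ('p Fp_bar, 'u, 'u) group_functor))"
    proof (rule holds_atI)
      fix f :: "'p Fp_bar poly fract" assume f: "f \<in> Rat2" "fixed_sigma f = (0, 1)"
      have "conjugate f (Fraction_Field.Fract [:0, 1, 1:] [:1:])"
        by (rule conjugate_trans[OF f(1) Rat2_char2(2)[OF two f refl] conjugate_Qmap_standard])
      then have "group_scheme_iso (Aut_scheme f) (alpha2_scheme :: ('p Fp_bar, 'u, 'u) group_functor)"
        by (rule aut_scheme_alpha2[OF two f(1)])
      then show "carrier (Aut f) = {\<one>\<^bsub>Aut f\<^esub>} \<and>
         group_scheme_iso (Aut_scheme f) (alpha2_scheme :: ('p Fp_bar, 'u, 'u) group_functor)"
        using char2_trivial_Aut[OF two f] by simp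
    qed
  }
  {
    assume p: "p = 3"
    have three: "(3 :: 'p Fp_bar) = 0" using char[of 3] p by simp
    have "\<not> p dvd 2" using p by (simp add: dvd_def) presburger
    then have two: "(2 :: 'p Fp_bar) \<noteq> 0" using char[of 2] by simp
    show "let P = 2 * var_x ^ 3 + var_x ^ 2 * var_y - var_x ^ 2 - var_y ^ 2 - 2 * var_x * var_y
                  :: 'p Fp_bar poly poly
        in cuspidal_cubic P \<and> aut_locus = plane_curve P \<and>
           (\<forall>x \<in> plane_curve P. holds_at x (\<lambda>f. Aut f \<cong> integer_mod_group 2))"
      unfolding Let_def cubic_eq_char3[OF three] plane_curve_cubic
    proof (intro conjI ballI)
      fix v :: "'p Fp_bar \<times> 'p Fp_bar" assume "v \<in> {(x, y). cubic_at x y = 0}"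
      then show "holds_at v (\<lambda>f. Aut f \<cong> integer_mod_group 2)"
        using holds_at_cubic_C2[OF two] three by (cases v) simp
    qed (rule cuspidal_cubic[OF two] aut_locus_cubic[OF two])+
  }
  {
    assume p: "p > 3"
    have "\<not> p dvd 2" "\<not> p dvd 3" using p by (auto dest: dvd_imp_le)
    then have two: "(2 :: 'p Fp_bar) \<noteq> 0" and three: "(3 :: 'p Fp_bar) \<noteq> 0" using char[of 2] char[of 3] by simp_all
    show "let P = 2 * var_x ^ 3 + var_x ^ 2 * var_y - var_x ^ 2 - 4 * var_y ^ 2 - 8 * var_x * var_y
                  + 12 * var_x + 12 * var_y - 36 :: 'p Fp_bar poly poly
        in cuspidal_cubic P \<and> aut_locus = plane_curve P \<and>
           (\<forall>x \<in> plane_curve P - singular_points P. holds_at x (\<lambda>f. Aut f \<cong> integer_mod_group 2)) \<and>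
           (\<forall>x \<in> singular_points P. holds_at x (\<lambda>f. Aut f \<cong> sym_group 3))"
      unfolding Let_def cubic_eq plane_curve_cubic singular_points_cubic[OF two]
    proof (intro conjI ballI)
      fix v :: "'p Fp_bar \<times> 'p Fp_bar" assume "v \<in> {(x, y). cubic_at x y = 0} - {(-6, 12)}"
      then show "holds_at v (\<lambda>f. Aut f \<cong> integer_mod_group 2)"
        using holds_at_cubic_C2[OF two] by (cases v) simp
    next
      fix v :: "'p Fp_bar \<times> 'p Fp_bar" assume "v \<in> {(-6, 12)}"
      then show "holds_at v (\<lambda>f. Aut f \<cong> sym_group 3)" using holds_at_cusp_S3[OF two three] by simp
    qed (rule cuspidal_cubic[OF two] aut_locus_cubic[OF two])+
  }
qed

end
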